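(* Let $A$ be a $C^*$-algebra with the ideal property. Then the Cuntz semigroup $W(A)$ has the weak Riesz interpolation by projections property; that is, for all $a_1,a_2,b_1,b_2\in M_\infty(A)^+$ such that $\langle a_i\rangle\le\langle b_j\rangle$ in $W(A)$ for all $1\le i,j\le 2$, and for every $\varepsilon>0$, there exist a projection $p\in\mathcal P(M_\infty(A))$ and $m\in\mathbb N$ such that $\langle (a_i-\varepsilon)_+\rangle\le\langle p\rangle\le m\langle b_j\rangle$ in $W(A)$ for all $1\le i,j\le 2$.
   Context: "Ideal" means closed two-sided ideal. A $C^*$-algebra $A$ has the ideal property if each of its ideals is generated (as an ideal) by the projections it contains. $M_\infty(A)$ is the algebraic inductive limit of the $M_n(A)$ under $x\mapsto x\oplus 0$, and $M_\infty(A)^+$ is its set of positive elements. For $a,b\in M_\infty(A)^+$ write $a\precsim b$ if for some $n$ with $a,b\in M_n(A)$ there is a sequence $\{x_k\}$ in $M_n(A)$ with $a=\lim_k x_k b x_k^*$; write $a\sim b$ if $a\precsim b$ and $b\precsim a$. The Cuntz semigroup is $W(A)=M_\infty(A)^+/\!\sim$, with classes $\langle a\rangle$, addition $\langle a\rangle+\langle b\rangle=\langle a\oplus b\rangle$, and order $\langle a\rangle\le\langle b\rangle\iff a\precsim b$. $\mathcal P(M_\infty(A))$ is the set of projections in $M_\infty(A)$. For positive $a$ and $\varepsilon>0$, $(a-\varepsilon)_+=h_\varepsilon(a)$ where $h_\varepsilon(t)=\max\{t-\varepsilon,0\}$. $\mathbb N$ denotes the positive integers. *)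

theory Defs
  imports "HOL-Analysis.Analysis" "HOL-Computational_Algebra.Polynomial"
    "HOL-Library.Function_Algebras"
begin

section \<open>C*-algebras\<close>

text \<open>Algebras are complex and not assumed to be unital. The operation \<open>scaleR\<close> inherited from
  \<^class>\<open>real_normed_algebra\<close> is the restriction of \<open>scaleC\<close>.\<close>

class cstar_algebra = real_normed_algebra + banach +
  fixes scaleC :: "complex \<Rightarrow> 'a \<Rightarrow> 'a"
    and star :: "'a \<Rightarrow> 'a"
  assumes scaleC_add_right: "scaleC c (x + y) = scaleC c x + scaleC c y"
    and scaleC_add_left: "scaleC (c + d) x = scaleC c x + scaleC d x"
    and scaleC_scaleC: "scaleC c (scaleC d x) = scaleC (c * d) x"
    and scaleR_scaleC: "scaleR r x = scaleC (complex_of_real r) x"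
    and mult_scaleC_left: "scaleC c x * y = scaleC c (x * y)"
    and mult_scaleC_right: "x * scaleC c y = scaleC c (x * y)"
    and norm_scaleC: "norm (scaleC c x) = cmod c * norm x"
    and star_add: "star (x + y) = star x + star y"
    and star_scaleC: "star (scaleC c x) = scaleC (cnj c) (star x)"
    and star_mult: "star (x * y) = star y * star x"
    and star_star: "star (star x) = x"
    and cstar_identity: "norm (star x * x) = (norm x)\<^sup>2"

instantiation complex :: cstar_algebra
begin

definition scaleC_complex :: "complex \<Rightarrow> complex \<Rightarrow> complex" where
  "scaleC_complex c x = c * x"

definition star_complex :: "complex \<Rightarrow> complex" where
  "star_complex x = cnj x"

instance
  by standard
    (auto simp: scaleC_complex_def star_complex_def algebra_simps scaleR_conv_of_real
      norm_mult power2_eq_square)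

end

definition closed_ideal :: "'a::cstar_algebra set \<Rightarrow> bool" where
  "closed_ideal I \<longleftrightarrow>
     0 \<in> I \<and> (\<forall>x\<in>I. \<forall>y\<in>I. x + y \<in> I) \<and> (\<forall>c. \<forall>x\<in>I. scaleC c x \<in> I) \<and>
     (\<forall>a. \<forall>x\<in>I. a * x \<in> I \<and> x * a \<in> I) \<and> closed I"

definition ideal_generated :: "'a::cstar_algebra set \<Rightarrow> 'a set" where
  "ideal_generated S = \<Inter> {I. closed_ideal I \<and> S \<subseteq> I}"

definition projection :: "'a::cstar_algebra \<Rightarrow> bool" where
  "projection p \<longleftrightarrow> star p = p \<and> p * p = p"

definition ideal_property :: "'a::cstar_algebra itself \<Rightarrow> bool" where
  "ideal_property (_ :: 'a itself) \<longleftrightarrow>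
     (\<forall>I :: 'a set. closed_ideal I \<longrightarrow> ideal_generated {p \<in> I. projection p} = I)"


section \<open>Matrices over a C*-algebra\<close>

text \<open>An element of $M_n(A)$ is an infinite matrix whose entries outside the upper left
  $n \times n$ corner vanish, so that the embedding $x \mapsto x \oplus 0$ of $M_n(A)$ into
  $M_{n+1}(A)$ is an inclusion and $M_\infty(A)$ is a union. Addition, subtraction and zero are the
  pointwise operations on functions. Multiplication is \<open>mat_mult\<close> below, not the pointwise
  product.\<close>

type_synonym 'a infmat = "nat \<Rightarrow> nat \<Rightarrow> 'a"

definition Mat :: "nat \<Rightarrow> 'a::cstar_algebra infmat set" where
  "Mat n = {x. \<forall>i j. n \<le> i \<or> n \<le> j \<longrightarrow> x i j = 0}"

definition Mat_inf :: "'a::cstar_algebra infmat set" where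
  "Mat_inf = (\<Union>n. Mat n)"

definition mat_mult :: "'a::cstar_algebra infmat \<Rightarrow> 'a infmat \<Rightarrow> 'a infmat" where
  "mat_mult x y = (\<lambda>i j. \<Sum>k | x i k \<noteq> 0. x i k * y k j)"

definition mat_scaleC :: "complex \<Rightarrow> 'a::cstar_algebra infmat \<Rightarrow> 'a infmat" where
  "mat_scaleC c x = (\<lambda>i j. scaleC c (x i j))"

definition mat_star :: "'a::cstar_algebra infmat \<Rightarrow> 'a infmat" where
  "mat_star x = (\<lambda>i j. star (x j i))"

text \<open>The C*-norm of $M_n(A)$ is the operator norm for the action on the Hilbert $A$-module $A^n$
  of columns. It does not depend on $n$, so finitely supported columns of any length are used.\<close>

definition col_norm :: "(nat \<Rightarrow> 'a::cstar_algebra) \<Rightarrow> real" where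
  "col_norm v = sqrt (norm (\<Sum>i | v i \<noteq> 0. star (v i) * v i))"

definition mat_vec :: "'a::cstar_algebra infmat \<Rightarrow> (nat \<Rightarrow> 'a) \<Rightarrow> nat \<Rightarrow> 'a" where
  "mat_vec x v = (\<lambda>i. \<Sum>j | x i j \<noteq> 0. x i j * v j)"

definition mat_norm :: "'a::cstar_algebra infmat \<Rightarrow> real" where
  "mat_norm x = (SUP v\<in>{v. finite {i. v i \<noteq> 0} \<and> col_norm v \<le> 1}. col_norm (mat_vec x v))"

definition mat_lim :: "(nat \<Rightarrow> 'a::cstar_algebra infmat) \<Rightarrow> 'a infmat \<Rightarrow> bool" where
  "mat_lim X a \<longleftrightarrow> (\<lambda>k. mat_norm (X k - a)) \<longlonglongrightarrow> 0"

definition mat_projections :: "'a::cstar_algebra infmat set" where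
  "mat_projections = {p \<in> Mat_inf. mat_star p = p \<and> mat_mult p p = p}"


section \<open>Spectrum, positivity and functional calculus\<close>

text \<open>The pair $(x, s)$ stands for $x + s1$ in the unitization.\<close>

definition unitization_mult ::
  "'a::cstar_algebra infmat \<times> complex \<Rightarrow> 'a infmat \<times> complex \<Rightarrow> 'a infmat \<times> complex" where
  "unitization_mult = (\<lambda>(x, s) (y, t).
     (mat_mult x y + mat_scaleC s y + mat_scaleC t x, s * t))"

text \<open>The spectrum is computed in the unitization. For $a$ in $M_n(A)$ an inverse of
  $\lambda 1 - a$ has its matrix part in $M_n(A)$ again, so this is the spectrum of $a$ in
  $M_n(A)$ with 0 adjoined. Neither positivity nor the functional calculus for functions vanishing
  at 0 is affected by the adjoined 0.\<close>

definition mat_spectrum :: "'a::cstar_algebra infmat \<Rightarrow> complex set" where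
  "mat_spectrum a = {l. \<not> (\<exists>w \<in> Mat_inf \<times> UNIV.
     unitization_mult (- a, l) w = (0, 1) \<and> unitization_mult w (- a, l) = (0, 1))}"

definition Mat_pos :: "'a::cstar_algebra infmat set" where
  "Mat_pos = {a \<in> Mat_inf. mat_star a = a \<and> mat_spectrum a \<subseteq> complex_of_real ` {0..}}"

text \<open>Evaluation of a real polynomial without constant term. The term \<open>(mat_mult a ^^ k) a\<close> is the
  power with exponent \<open>k + 1\<close>.\<close>

definition mat_poly :: "real poly \<Rightarrow> 'a::cstar_algebra infmat \<Rightarrow> 'a infmat" where
  "mat_poly p a = (\<Sum>k<degree p.
     mat_scaleC (complex_of_real (coeff p (Suc k))) ((mat_mult a ^^ k) a))"

text \<open>Continuous functional calculus for self-adjoint \<open>a\<close> and real functions \<open>f\<close> that are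
  continuous on the spectrum and satisfy \<open>f 0 = 0\<close>: the common limit of $p_k(a)$ for all sequences
  of polynomials $p_k$ with $p_k(0) = 0$ that converge to \<open>f\<close> uniformly on the spectrum.\<close>

definition mat_fun_calc :: "(real \<Rightarrow> real) \<Rightarrow> 'a::cstar_algebra infmat \<Rightarrow> 'a infmat" where
  "mat_fun_calc f a = (THE c. c \<in> Mat_inf \<and>
     (\<forall>p. (\<forall>k. poly (p k) 0 = 0) \<and>
          uniform_limit {t. complex_of_real t \<in> mat_spectrum a} (\<lambda>k. poly (p k)) f sequentially
        \<longrightarrow> mat_lim (\<lambda>k. mat_poly (p k) a) c))"

definition cut_down :: "'a::cstar_algebra infmat \<Rightarrow> real \<Rightarrow> 'a infmat" where
  "cut_down a \<epsilon> = mat_fun_calc (\<lambda>t. max (t - \<epsilon>) 0) a"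


section \<open>The Cuntz semigroup\<close>

definition cuntz_below :: "'a::cstar_algebra infmat \<Rightarrow> 'a infmat \<Rightarrow> bool" where
  "cuntz_below a b \<longleftrightarrow> (\<exists>n. a \<in> Mat n \<and> b \<in> Mat n \<and>
     (\<exists>x. (\<forall>k. x k \<in> Mat n) \<and>
          mat_lim (\<lambda>k. mat_mult (mat_mult (x k) b) (mat_star (x k))) a))"

definition cuntz_rel :: "('a::cstar_algebra infmat \<times> 'a infmat) set" where
  "cuntz_rel = {(a, b). a \<in> Mat_pos \<and> b \<in> Mat_pos \<and> cuntz_below a b \<and> cuntz_below b a}"

definition cuntz_semigroup :: "'a::cstar_algebra infmat set set" where
  "cuntz_semigroup = Mat_pos // cuntz_rel"

definition cuntz_class :: "'a::cstar_algebra infmat \<Rightarrow> 'a infmat set" where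
  "cuntz_class a = cuntz_rel `` {a}"

definition cuntz_le :: "'a::cstar_algebra infmat set \<Rightarrow> 'a infmat set \<Rightarrow> bool" where
  "cuntz_le X Y \<longleftrightarrow> (\<exists>a\<in>X. \<exists>b\<in>Y. cuntz_below a b)"

text \<open>Direct sum of \<open>a\<close>, regarded as an element of $M_n(A)$, and \<open>b\<close>. Its Cuntz class does not
  depend on the choice of \<open>n\<close>.\<close>

definition mat_dsum :: "nat \<Rightarrow> 'a::cstar_algebra infmat \<Rightarrow> 'a infmat \<Rightarrow> 'a infmat" where
  "mat_dsum n a b = (\<lambda>i j.
     if i < n \<and> j < n then a i j else if n \<le> i \<and> n \<le> j then b (i - n) (j - n) else 0)"

definition cuntz_add :: "'a::cstar_algebra infmat set \<Rightarrow> 'a infmat set \<Rightarrow> 'a infmat set" where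
  "cuntz_add X Y = (\<Union>a\<in>X. \<Union>b\<in>Y. \<Union>n\<in>{n. a \<in> Mat n}. cuntz_class (mat_dsum n a b))"

definition cuntz_multiple :: "nat \<Rightarrow> 'a::cstar_algebra infmat set \<Rightarrow> 'a infmat set" where
  "cuntz_multiple m X = (cuntz_add X ^^ m) (cuntz_class 0)"

end

theory Submission
  imports Defs "HOL-Computational_Algebra.Fundamental_Theorem_Algebra"
begin

text \<open>Let \<open>I\<close> be the intersection of the ideals generated by \<open>b\<^sub>1\<close> and \<open>b\<^sub>2\<close>; it contains \<open>a\<^sub>1\<close> and \<open>a\<^sub>2\<close>.
  By the ideal property \<open>a\<^sub>i\<close> is within \<open>\<epsilon>/2\<close> of a finite sum of terms \<open>r q y\<close> with projections
  \<open>q\<close> in \<open>I\<close>. Since \<open>r q y + (r q y)\<^sup>* \<le> r q r\<^sup>* + y\<^sup>* q y\<close>, it follows that \<open>a\<^sub>i - \<epsilon>/2 \<le> z p\<^sub>i z\<^sup>*\<close>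
  for a direct sum \<open>p\<^sub>i\<close> of such projections, and therefore \<open>(a\<^sub>i - \<epsilon>)\<^sub>+\<close> is Cuntz below \<open>p\<^sub>i\<close>. The
  projection \<open>p = p\<^sub>1 \<oplus> p\<^sub>2\<close> lies in the ideal generated by \<open>b\<^sub>j\<close>, and the same argument with \<open>p\<close> in place
  of \<open>a\<^sub>i\<close> and \<open>b\<^sub>j\<close> in place of \<open>q\<close> puts \<open>p\<close> below a multiple of \<open>b\<^sub>j\<close>.\<close>

section \<open>Spectral theory\<close>

text \<open>Spectral theory cannot be built on matrices directly: that the operator norm on columns
  is a C*-norm rests on Cauchy-Schwarz, hence on positivity of \<open>star a * a\<close> in A. It is
  therefore developed for an abstract class and applied twice, to the unitization of A and, once the
  norm is available, to the unitization of the algebra of finite matrices. Comparisons descend from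
  that unitization because every conjugating element found there has a factor
  \<open>psqrt (emb g)\<close>, whose scalar part is 0. The two halves of \<epsilon> serve different
  ends. One pays for the approximation. The other is a gap: g = (a - \<epsilon>)_+ satisfies g (a -
  \<epsilon>/2) \<ge> (\<epsilon>/2) g, which bounds g by a multiple of a conjugate of any c \<ge> a
  - \<epsilon>/2. A projection is its own cut-down in this sense, so nothing is lost when p is
  compared with multiples of b_j. The ideal property speaks of A, the comparison of matrices;
  entries and matrix units mediate. Direct sums replace sums throughout because they keep
  projections projections. The number of summands is not controlled in advance and differs for b_1
  and b_2, so multiples must be allowed to grow to a common m.\<close>

definition complete_wrt :: "('a \<Rightarrow> 'a \<Rightarrow> real) \<Rightarrow> 'a set \<Rightarrow> bool" where
  "complete_wrt d S \<longleftrightarrow> (\<forall>X. (\<forall>n. X n \<in> S) \<longrightarrow>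
     (\<forall>e>0. \<exists>M. \<forall>m\<ge>M. \<forall>n\<ge>M. d (X m) (X n) < e) \<longrightarrow>
     (\<exists>l\<in>S. \<forall>e>0. \<exists>M. \<forall>n\<ge>(M::nat). d (X n) l < e))"

text \<open>The matrices of all finite sizes form an incomplete algebra, each element of which lies in a
  complete subalgebra. This is all the completeness that spectral theory in one element needs.
  The constant \<^const>\<open>complete_wrt\<close> stands in for \<^const>\<open>complete\<close>, whose type is too special
  for a class declaration.\<close>

class local_cstar = real_normed_algebra +
  fixes cscale :: "complex \<Rightarrow> 'a \<Rightarrow> 'a" (infixr "*\<^sub>C" 75)
    and adj :: "'a \<Rightarrow> 'a"
  assumes cscale_add_right: "c *\<^sub>C (x + y) = c *\<^sub>C x + c *\<^sub>C y"
    and cscale_add_left: "(c + d) *\<^sub>C x = c *\<^sub>C x + d *\<^sub>C x"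
    and cscale_cscale [simp]: "c *\<^sub>C d *\<^sub>C x = (c * d) *\<^sub>C x"
    and scaleR_cscale: "r *\<^sub>R x = complex_of_real r *\<^sub>C x"
    and mult_cscale_left [simp]: "c *\<^sub>C x * y = c *\<^sub>C (x * y)"
    and mult_cscale_right [simp]: "x * c *\<^sub>C y = c *\<^sub>C (x * y)"
    and norm_cscale: "norm (c *\<^sub>C x) = cmod c * norm x"
    and adj_add: "adj (x + y) = adj x + adj y"
    and adj_cscale: "adj (c *\<^sub>C x) = cnj c *\<^sub>C adj x"
    and adj_mult: "adj (x * y) = adj y * adj x"
    and adj_adj [simp]: "adj (adj x) = x"
    and norm_adj_mult: "norm (adj x * x) = (norm x)\<^sup>2"
    and local_complete: "\<exists>S. x \<in> S \<and> complete_wrt dist S \<and> (\<forall>y\<in>S. \<forall>z\<in>S. y + z \<in> S \<and> y * z \<in> S) \<and>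
      (\<forall>c. \<forall>y\<in>S. c *\<^sub>C y \<in> S)"

text \<open>Neumann series and polynomials with a constant term have to stay inside the complete
  subalgebra, so it must contain 1 as well as x.\<close>

class unital_local_cstar = local_cstar + real_normed_algebra_1 +
  assumes local_complete_1: "\<exists>S. x \<in> S \<and> 1 \<in> S \<and> complete_wrt dist S \<and>
      (\<forall>y\<in>S. \<forall>z\<in>S. y + z \<in> S \<and> y * z \<in> S) \<and> (\<forall>c. \<forall>y\<in>S. c *\<^sub>C y \<in> S)"

context local_cstar
begin

lemma cscale_zero_left [simp]: "0 *\<^sub>C x = 0"
  using cscale_add_left[of 0 0 x] by simp

lemma cscale_zero_right [simp]: "c *\<^sub>C 0 = 0"
  using cscale_add_right[of c 0 0] by simp

lemma cscale_minus_left [simp]: "(- c) *\<^sub>C x = - (c *\<^sub>C x)"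
  using cscale_add_left[of c "- c" x] by (simp add: eq_neg_iff_add_eq_0 add.commute)

lemma cscale_minus_right [simp]: "c *\<^sub>C (- x) = - (c *\<^sub>C x)"
  using cscale_add_right[of c "- x" x] by (simp add: eq_neg_iff_add_eq_0)

lemma cscale_diff_left: "(c - d) *\<^sub>C x = c *\<^sub>C x - d *\<^sub>C x"
  using cscale_add_left[of c "- d" x] by simp

lemma cscale_diff_right: "c *\<^sub>C (x - y) = c *\<^sub>C x - c *\<^sub>C y"
  using cscale_add_right[of c x "- y"] by simp

lemma cscale_one [simp]: "1 *\<^sub>C x = x"
  using scaleR_cscale[of 1 x] scaleR_one[of x] by simp

lemma cscale_sum_right: "c *\<^sub>C sum f A = (\<Sum>i\<in>A. c *\<^sub>C f i)"
  by (induction A rule: infinite_finite_induct) (auto simp: cscale_add_right)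

lemma cscale_sum_left: "sum f A *\<^sub>C x = (\<Sum>i\<in>A. f i *\<^sub>C x)"
  by (induction A rule: infinite_finite_induct) (auto simp: cscale_add_left)

lemma adj_zero [simp]: "adj 0 = 0"
  using adj_add[of 0 0] by simp

lemma adj_minus: "adj (- x) = - adj x"
  using adj_add[of x "- x"] by (simp add: eq_neg_iff_add_eq_0 add.commute)

lemma adj_diff: "adj (x - y) = adj x - adj y"
  using adj_add[of x "- y"] by (simp add: adj_minus)

lemma adj_scaleR: "adj (r *\<^sub>R x) = r *\<^sub>R adj x"
  by (simp add: scaleR_cscale adj_cscale)

lemma norm_adj [simp]: "norm (adj x) = norm x"
proof -
  have le: "norm y \<le> norm (adj y)" for y
  proof (cases "y = 0")
    case False
    have "(norm y)\<^sup>2 \<le> norm (adj y) * norm y"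
      using norm_adj_mult[of y] norm_mult_ineq[of "adj y" y] by simp
    then show ?thesis using False by (simp add: power2_eq_square)
  qed auto
  show ?thesis using le[of x] le[of "adj x"] by simp
qed

lemma norm_mult_adj: "norm (x * adj x) = (norm x)\<^sup>2"
  using norm_adj_mult[of "adj x"] by simp

end

lemma adj_mult_self_eq_0: "adj x * x = 0 \<longleftrightarrow> x = (0::'a::local_cstar)"
  by (metis norm_adj_mult norm_eq_zero zero_eq_power2 mult_zero_right)

lemmas adj_simps = adj_add adj_minus adj_diff adj_cscale adj_mult adj_scaleR

lemma complete_wrt_dist: "complete_wrt dist S \<longleftrightarrow> complete S"
  unfolding complete_wrt_def complete_def Cauchy_def lim_sequentially by blast

lemma bounded_linear_cscale: "bounded_linear (\<lambda>x::'a::local_cstar. c *\<^sub>C x)"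
  by (rule bounded_linear_intro[of _ "cmod c"])
     (auto simp: cscale_add_right norm_cscale scaleR_cscale mult.commute)

lemma bounded_linear_adj: "bounded_linear (adj :: 'a::local_cstar \<Rightarrow> 'a)"
  by (rule bounded_linear_intro[of _ 1]) (auto simp: adj_add adj_scaleR)

lemma cscale_power: "(c *\<^sub>C x) ^ n = c ^ n *\<^sub>C (x :: 'a::unital_local_cstar) ^ n"
  by (induction n) (auto simp: mult.commute)

lemma adj_one [simp]: "adj 1 = (1::'a::unital_local_cstar)"
  by (metis adj_adj adj_mult mult.right_neutral mult.left_neutral)

lemma adj_power: "adj (x ^ n) = adj x ^ n" for x :: "'a::unital_local_cstar"
  by (induction n) (auto simp: adj_mult power_commutes)

text \<open>The ambient space may be incomplete; a summable majorant produces a limit only because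
  the partial sums stay in a complete set.\<close>

lemma complete_convergent_sum:
  fixes f :: "nat \<Rightarrow> 'a::real_normed_vector"
  assumes S: "complete S" and mem: "\<And>n. (\<Sum>k<n. f k) \<in> S" and g: "\<And>k. norm (f k) \<le> g k" "summable g"
  shows "\<exists>s\<in>S. (\<lambda>n. \<Sum>k<n. f k) \<longlonglongrightarrow> s"
proof -
  have "Cauchy (\<lambda>n. \<Sum>k<n. f k)"
  proof (rule CauchyI')
    fix e :: real assume "e > 0"
    have "Cauchy (\<lambda>n. \<Sum>k<n. g k)"
      using g(2) summable_iff_convergent[of g] convergent_Cauchy by blast
    then obtain M where M: "\<And>m n. m \<ge> M \<Longrightarrow> n \<ge> M \<Longrightarrow> norm ((\<Sum>k<m. g k) - (\<Sum>k<n. g k)) < e"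
      using \<open>e > 0\<close> CauchyD by blast
    have "norm ((\<Sum>k<m. f k) - (\<Sum>k<n. f k)) < e" if mn: "m \<ge> M" "n > m" for m n
    proof -
      have split: "(\<Sum>k<n. h k) - (\<Sum>k<m. h k) = (\<Sum>k\<in>{m..<n}. h k)" for h :: "nat \<Rightarrow> 'b::real_normed_vector"
        using sum_diff_nat_ivl[of 0 m n h] mn by (simp add: atLeast0LessThan)
      have "norm ((\<Sum>k<m. f k) - (\<Sum>k<n. f k)) = norm (\<Sum>k\<in>{m..<n}. f k)"
        using split[of f] by (metis norm_minus_commute)
      also have "\<dots> \<le> (\<Sum>k\<in>{m..<n}. g k)" by (rule sum_norm_le) (use g in auto)
      also have "\<dots> = (\<Sum>k<n. g k) - (\<Sum>k<m. g k)" 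
        using sum_diff_nat_ivl[of 0 m n g] mn by (simp add: atLeast0LessThan)
      also have "\<dots> < e" using M[of n m] mn by (auto simp: abs_if split: if_splits)
      finally show ?thesis .
    qed
    then show "\<exists>M. \<forall>m\<ge>M. \<forall>n>m. dist (\<Sum>k<m. f k) (\<Sum>k<n. f k) < e"
      unfolding dist_norm by blast
  qed
  then show ?thesis using S[unfolded complete_def, rule_format, of "\<lambda>n. \<Sum>k<n. f k"] mem by blast
qed

section \<open>Invertible elements and the spectrum\<close>

definition is_inv :: "'a::monoid_mult \<Rightarrow> bool" where
  "is_inv x \<longleftrightarrow> (\<exists>y. x * y = 1 \<and> y * x = 1)"

definition spec :: "'a::unital_local_cstar \<Rightarrow> complex set" where
  "spec x = {l. \<not> is_inv (l *\<^sub>C 1 - x)}"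

lemma is_inv_one [simp]: "is_inv 1" by (auto simp: is_inv_def)

lemma is_inv_mult: "is_inv x \<Longrightarrow> is_inv y \<Longrightarrow> is_inv (x * y)"
  unfolding is_inv_def by (metis mult.assoc mult.left_neutral)

lemma is_inv_cscale:
  fixes x :: "'a::unital_local_cstar"
  assumes "is_inv x" "c \<noteq> 0" shows "is_inv (c *\<^sub>C x)"
proof -
  obtain y where "x * y = 1" "y * x = 1" using assms by (auto simp: is_inv_def)
  then have "(c *\<^sub>C x) * (inverse c *\<^sub>C y) = 1" "(inverse c *\<^sub>C y) * (c *\<^sub>C x) = 1"
    using assms by auto
  then show ?thesis unfolding is_inv_def by blast
qed

lemma is_inv_cscale_iff: "c \<noteq> 0 \<Longrightarrow> is_inv (c *\<^sub>C x) \<longleftrightarrow> is_inv (x :: 'a::unital_local_cstar)"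
  using is_inv_cscale[of x c] is_inv_cscale[of "c *\<^sub>C x" "inverse c"] by auto

lemma is_inv_minus_iff [simp]: "is_inv (- x) \<longleftrightarrow> is_inv (x :: 'a::unital_local_cstar)"
  using is_inv_cscale_iff[of "-1" x] by simp

lemma one_minus_power_eq:
  fixes x :: "'a::ring_1"
  shows "1 - x ^ n = (1 - x) * (\<Sum>i<n. x ^ i)" "1 - x ^ n = (\<Sum>i<n. x ^ i) * (1 - x)"
  by (induction n) (auto simp: algebra_simps power_commutes)

text \<open>The inverse is the Neumann series, summed inside a complete subalgebra around x and
  1.\<close>

lemma is_inv_one_minus:
  fixes x :: "'a::unital_local_cstar"
  assumes "norm x < 1" shows "is_inv (1 - x)"
proof -
  obtain S where S: "x \<in> S" "1 \<in> S" "complete S" "\<And>y z. y \<in> S \<Longrightarrow> z \<in> S \<Longrightarrow> y + z \<in> S"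
    "\<And>y z. y \<in> S \<Longrightarrow> z \<in> S \<Longrightarrow> y * z \<in> S" "\<And>c y. y \<in> S \<Longrightarrow> c *\<^sub>C y \<in> S"
    using local_complete_1[of x] unfolding complete_wrt_dist by auto
  have pow: "x ^ k \<in> S" for k by (induction k) (auto intro: S)
  have zero: "0 \<in> S" using S(6)[OF S(2), of 0] by simp
  have sums: "(\<Sum>k<n. x ^ k) \<in> S" for n by (induction n) (auto intro: S pow zero)
  have "\<exists>s\<in>S. (\<lambda>n. \<Sum>k<n. x ^ k) \<longlonglongrightarrow> s"
    by (rule complete_convergent_sum[OF S(3) sums, of "\<lambda>k. norm x ^ k"])
       (use assms in \<open>auto simp: norm_power_ineq summable_geometric\<close>)
  then obtain s where s: "(\<lambda>n. \<Sum>k<n. x ^ k) \<longlonglongrightarrow> s" by blast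
  have "(\<lambda>n. norm x ^ n) \<longlonglongrightarrow> 0" using assms by (intro LIMSEQ_realpow_zero) auto
  then have x0: "(\<lambda>n. x ^ n) \<longlonglongrightarrow> 0"
    by (rule Lim_null_comparison[OF always_eventually, rotated]) (simp add: norm_power_ineq)
  have one: "(\<lambda>n. 1 - x ^ n) \<longlonglongrightarrow> 1" using tendsto_diff[OF tendsto_const[of 1] x0] by simp
  have "(\<lambda>n. (1 - x) * (\<Sum>k<n. x ^ k)) \<longlonglongrightarrow> (1 - x) * s" by (intro tendsto_intros s)
  then have "(1 - x) * s = 1"
    using one LIMSEQ_unique by (simp add: one_minus_power_eq(1)[symmetric]) blast
  moreover have "(\<lambda>n. (\<Sum>k<n. x ^ k) * (1 - x)) \<longlonglongrightarrow> s * (1 - x)" by (intro tendsto_intros s)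
  then have "s * (1 - x) = 1"
    using one LIMSEQ_unique by (simp add: one_minus_power_eq(2)[symmetric]) blast
  ultimately show ?thesis by (auto simp: is_inv_def)
qed

lemma spec_norm_le:
  fixes x :: "'a::unital_local_cstar"
  assumes "l \<in> spec x" shows "cmod l \<le> norm x"
proof (rule ccontr)
  assume "\<not> ?thesis"
  then have l: "cmod l > norm x" by simp
  then have "l \<noteq> 0" using norm_ge_zero[of x] by (metis norm_zero not_less)
  have "norm (inverse l *\<^sub>C x) = norm x / cmod l"
    by (simp add: norm_cscale norm_inverse divide_inverse mult.commute)
  then have "norm (inverse l *\<^sub>C x) < 1" using l \<open>l \<noteq> 0\<close> by simp
  then have "is_inv (l *\<^sub>C (1 - inverse l *\<^sub>C x))" using \<open>l \<noteq> 0\<close> is_inv_one_minus is_inv_cscale by blast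
  then show False using assms \<open>l \<noteq> 0\<close> by (simp add: spec_def cscale_diff_right)
qed

lemma spec_shift: "l \<in> spec x \<longleftrightarrow> l + c \<in> spec (x + c *\<^sub>C 1)"
  by (simp add: spec_def cscale_add_left algebra_simps)

text \<open>Arens' shift: l + i n lies in the spectrum of h + i n, whose squared norm is at most
  norm h ^ 2 + n ^ 2 by the C*-identity. The squares of n cancel and leave a bound on 2 n Im l for
  every real n.\<close>

lemma spec_selfadjoint_real:
  fixes h :: "'a::unital_local_cstar"
  assumes h: "adj h = h" and l: "l \<in> spec h" shows "Im l = 0"
proof -
  have "(Re l)\<^sup>2 + (Im l + n)\<^sup>2 \<le> (norm h)\<^sup>2 + n\<^sup>2" for n :: real
  proof -
    let ?c = "\<i> * complex_of_real n"
    have "l + ?c \<in> spec (h + ?c *\<^sub>C 1)" using l spec_shift by blast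
    then have "cmod (l + ?c) \<le> norm (h + ?c *\<^sub>C 1)" by (rule spec_norm_le)
    then have "(cmod (l + ?c))\<^sup>2 \<le> (norm (h + ?c *\<^sub>C 1))\<^sup>2" by (rule power_mono) simp
    also have "\<dots> = norm (adj (h + ?c *\<^sub>C 1) * (h + ?c *\<^sub>C 1))" by (simp add: norm_adj_mult)
    also have "adj (h + ?c *\<^sub>C 1) * (h + ?c *\<^sub>C 1) = h * h + complex_of_real (n\<^sup>2) *\<^sub>C 1"
      by (simp add: adj_simps h algebra_simps cscale_diff_right power2_eq_square)
    also have "norm \<dots> \<le> norm (h * h) + n\<^sup>2"
      by (rule order_trans[OF norm_triangle_ineq]) (simp add: norm_cscale norm_power)
    also have "\<dots> \<le> (norm h)\<^sup>2 + n\<^sup>2" using norm_mult_ineq[of h h] by (simp add: power2_eq_square)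
    finally show ?thesis by (simp add: cmod_power2)
  qed
  note * = this
  show ?thesis
  proof (rule ccontr)
    assume "Im l \<noteq> 0"
    \<comment> \<open>With this n the cross term is twice the right-hand side, which the positive
      (Im l)^2 makes impossible.\<close>
    define n where "n = (norm h)\<^sup>2 / Im l"
    have "(Re l)\<^sup>2 + (Im l)\<^sup>2 + 2 * (Im l * n) \<le> (norm h)\<^sup>2"
      using *[of n] by (simp add: power2_eq_square algebra_simps)
    moreover have "Im l * n = (norm h)\<^sup>2" using \<open>Im l \<noteq> 0\<close> by (simp add: n_def)
    moreover have "(Im l)\<^sup>2 > 0" using \<open>Im l \<noteq> 0\<close> by simp
    ultimately show False using zero_le_power2[of "Re l"] zero_le_power2[of "norm h"] by linarith
  qed
qed

lemma sum_powers_root_of_unity: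
  assumes "k < n" 
  shows "(\<Sum>j<n. (exp (2 * of_real pi * \<i> * of_nat j / of_nat n)) ^ k) = (if k = 0 then of_nat n else (0::complex))"
proof (cases "k = 0")
  case False
  have n: "1 \<le> n" using assms by auto
  define w where "w = exp (2 * of_real pi * \<i> * of_nat k / of_nat n)"
  have w1: "w \<noteq> 1" using complex_root_unity_eq_1[OF n, of k] False assms
    by (auto simp: w_def dest: dvd_imp_le)
  have wn: "w ^ n = 1" unfolding w_def using complex_root_unity[of n k] n by simp
  have "(\<Sum>j<n. (exp (2 * of_real pi * \<i> * of_nat j / of_nat n)) ^ k) = (\<Sum>j<n. w ^ j)"
    unfolding w_def exp_of_nat_mult[symmetric] by (simp add: algebra_simps)
  also have "\<dots> = 0" using geometric_sum[OF w1, of n] wn by simp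
  finally show ?thesis using False by simp
qed simp

text \<open>Averaging the resolvent over the \<open>n\<close>-th roots of unity turns \<open>(1 - l x)\<^sup>-\<^sup>1\<close> into
  \<open>(1 - (l x)\<^sup>n)\<^sup>-\<^sup>1\<close>; uniform continuity transports the limit as \<open>n\<close> grows from a radius
  \<open>l < 1\<close> to \<open>l = 1\<close>.\<close>

lemma powers_decay_if_unit_circle_resolvent:
  fixes x :: "'a::unital_local_cstar"
  assumes nx: "norm x \<le> 1" and res: "\<And>l. cmod l = 1 \<Longrightarrow> l \<notin> spec x"
  shows "\<exists>N. \<forall>n\<ge>N. norm (x ^ n) \<le> 1/2"
proof -
  have inv: "is_inv (1 - l *\<^sub>C x)" if "cmod l \<le> 1" for l
  proof (cases "cmod l = 1")
    case True
    then have "l \<noteq> 0" by auto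
    have "cmod (inverse l) = 1" using True by (simp add: norm_inverse)
    then have "is_inv (l *\<^sub>C (inverse l *\<^sub>C 1 - x))" using res \<open>l \<noteq> 0\<close> is_inv_cscale by (force simp: spec_def)
    then show ?thesis using \<open>l \<noteq> 0\<close> by (simp add: cscale_diff_right)
  next
    case False
    have "cmod l * norm x \<le> cmod l * 1" using nx by (intro mult_left_mono) auto
    then show ?thesis using False that by (intro is_inv_one_minus) (simp add: norm_cscale)
  qed
  define R where "R l = (SOME y. (1 - l *\<^sub>C x) * y = 1 \<and> y * (1 - l *\<^sub>C x) = 1)" for l
  have R: "(1 - l *\<^sub>C x) * R l = 1" "R l * (1 - l *\<^sub>C x) = 1" if "cmod l \<le> 1" for l
    using someI_ex[OF inv[OF that, unfolded is_inv_def]] unfolding R_def by auto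
  \<comment> \<open>The resolvent identity, in the form suited to 1 - l x instead of l - x.\<close>
  have Rdiff: "R l - R m = (l - m) *\<^sub>C (R l * x * R m)" if "cmod l \<le> 1" "cmod m \<le> 1" for l m
  proof -
    have "R l * ((1 - m *\<^sub>C x) - (1 - l *\<^sub>C x)) * R m = R l - R m"
    proof -
      have "R l * ((1 - m *\<^sub>C x) - (1 - l *\<^sub>C x)) * R m =
          R l * ((1 - m *\<^sub>C x) * R m) - R l * (1 - l *\<^sub>C x) * R m"
        by (simp only: right_diff_distrib[of "R l"] left_diff_distrib[of _ _ "R m"] mult.assoc)
      then show ?thesis by (simp only: R[OF that(1)] R[OF that(2)] mult_1_left mult_1_right)
    qed
    moreover have "(1 - m *\<^sub>C x) - (1 - l *\<^sub>C x) = (l - m) *\<^sub>C x" by (simp add: cscale_diff_left)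
    ultimately show ?thesis by simp
  qed
  have Rdiff_le: "norm (R l - R m) \<le> cmod (l - m) * norm (R l) * norm (R m)" if "cmod l \<le> 1" "cmod m \<le> 1" for l m
  proof -
    have "norm (R l * x * R m) \<le> norm (R l) * norm x * norm (R m)"
      by (meson norm_mult_ineq order_trans mult_right_mono norm_ge_zero)
    also have "\<dots> \<le> norm (R l) * 1 * norm (R m)" using nx by (intro mult_mono) auto
    finally show ?thesis using that
      by (simp add: Rdiff norm_cscale mult.assoc mult_left_mono)
  qed
  have cont: "continuous_on (cball 0 1) R"
  proof (subst continuous_on_iff, intro ballI allI impI)
    fix m :: complex and e :: real assume m: "m \<in> cball 0 1" and e: "e > 0"
    define K where "K = norm (R m) + 1"
    have K: "K > 0" "K \<ge> norm (R m)" by (auto simp: K_def add_nonneg_pos)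
    \<comment> \<open>The first bound makes \<open>cmod (l - m) * norm (R m)\<close> at most 1/2,
      which gives the a priori estimate \<open>norm (R l) \<le> 2 * K\<close>; the second then
      brings the resolvent identity below e.\<close>
    define d where "d = min (1 / (2 * K)) (e / (2 * K\<^sup>2))"
    have "d > 0" using K e by (auto simp: d_def)
    have "dist (R l) (R m) < e" if l: "l \<in> cball 0 1" "dist l m < d" for l
    proof -
      have D: "norm (R l - R m) \<le> cmod (l - m) * norm (R l) * norm (R m)"
        using Rdiff_le l m by auto
      have lm: "cmod (l - m) < d" using l by (simp add: dist_norm)
      have "cmod (l - m) * norm (R m) \<le> 1 / (2 * K) * K"
        using lm K by (intro mult_mono) (auto simp: d_def)
      then have "cmod (l - m) * norm (R m) \<le> 1/2" using K by simp
      then have "(cmod (l - m) * norm (R m)) * norm (R l) \<le> 1/2 * norm (R l)"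
        by (intro mult_right_mono) auto
      moreover have "norm (R l) \<le> norm (R m) + norm (R l - R m)"
        using norm_triangle_ineq[of "R m" "R l - R m"] by simp
      ultimately have Rl: "norm (R l) \<le> 2 * K" using D K by (simp add: mult_ac)
      have "norm (R l - R m) \<le> cmod (l - m) * (2 * K) * K"
        by (rule order_trans[OF D]) (use Rl K in \<open>auto intro!: mult_mono\<close>)
      also have "\<dots> < d * (2 * K) * K" using lm K by simp
      also have "\<dots> \<le> e / (2 * K\<^sup>2) * (2 * K) * K" using K by (intro mult_right_mono) (auto simp: d_def)
      also have "\<dots> = e" using K by (simp add: power2_eq_square)
      finally show ?thesis by (simp add: dist_norm)
    qed
    then show "\<exists>d>0. \<forall>l\<in>cball 0 1. dist l m < d \<longrightarrow> dist (R l) (R m) < e" using \<open>d > 0\<close> by blast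
  qed
  obtain C where C: "\<And>l. cmod l \<le> 1 \<Longrightarrow> norm (R l) \<le> C"
    using compact_imp_bounded[OF compact_continuous_image[OF cont compact_cball]]
    unfolding bounded_iff by (metis (no_types, lifting) imageI mem_cball_0)
  have "uniformly_continuous_on (cball 0 1) R" using cont by (intro compact_uniformly_continuous) auto
  then obtain d where d: "d > 0" "\<And>l m. cmod l \<le> 1 \<Longrightarrow> cmod m \<le> 1 \<Longrightarrow> cmod (l - m) < d \<Longrightarrow> norm (R l - R m) < 1/6"
    unfolding uniformly_continuous_on_def
    by (metis (no_types, opaque_lifting) dist_norm mem_cball_0 zero_less_divide_1_iff zero_less_numeral)
  \<comment> \<open>A radius below 1, so that r^n tends to 0, yet within d of the unit circle, so
    that \<open>R\<close> changes by less than 1/6 along each radius.\<close>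
  define r :: real where "r = max 0 (1 - d/2)"
  have r: "0 \<le> r" "r < 1" "1 - r < d" using d(1) by (auto simp: r_def max_def)
  define w where "w n j = exp (2 * of_real pi * \<i> * of_nat j / of_nat n)" for n j :: nat
  have w1: "cmod (w n j) = 1" for n j by (simp add: w_def)
  define S where "S n l = inverse (of_nat n) *\<^sub>C (\<Sum>j<n. R (w n j * l))" for n :: nat and l :: complex
  \<comment> \<open>By the geometric sum, 1 - (l x)^n times \<open>R (w n j * l)\<close> is a
    polynomial in w l x. Summing over the roots of unity kills every power except the
    zeroth.\<close>
  have S: "(1 - l ^ n *\<^sub>C x ^ n) * S n l = 1" if l: "cmod l \<le> 1" and n: "n > 0" for n l
  proof -
    have wn: "w n j ^ n = 1" for j unfolding w_def using complex_root_unity[of n j] n by simp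
    have "(1 - l ^ n *\<^sub>C x ^ n) * R (w n j * l) = (\<Sum>k<n. w n j ^ k *\<^sub>C (l *\<^sub>C x) ^ k)" for j
    proof -
      let ?u = "(w n j * l) *\<^sub>C x"
      have wl: "cmod (w n j * l) \<le> 1" using l by (simp add: norm_mult w1)
      have "l ^ n *\<^sub>C x ^ n = ?u ^ n" by (simp add: cscale_power power_mult_distrib wn)
      then have "1 - l ^ n *\<^sub>C x ^ n = (\<Sum>k<n. ?u ^ k) * (1 - ?u)" 
        by (simp add: one_minus_power_eq(2))
      then have "(1 - l ^ n *\<^sub>C x ^ n) * R (w n j * l) = (\<Sum>k<n. ?u ^ k)"
        using R(1)[OF wl] by (simp add: mult.assoc)
      then show ?thesis by (simp add: cscale_power power_mult_distrib)
    qed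
    then have "(1 - l ^ n *\<^sub>C x ^ n) * (\<Sum>j<n. R (w n j * l)) = (\<Sum>j<n. \<Sum>k<n. w n j ^ k *\<^sub>C (l *\<^sub>C x) ^ k)"
      by (simp add: sum_distrib_left)
    also have "\<dots> = (\<Sum>k<n. (\<Sum>j<n. w n j ^ k) *\<^sub>C (l *\<^sub>C x) ^ k)"
      by (subst sum.swap) (simp add: cscale_sum_left)
    also have "\<dots> = (\<Sum>k<n. (if k = 0 then of_nat n else 0) *\<^sub>C (l *\<^sub>C x) ^ k)"
      unfolding w_def by (intro sum.cong refl) (simp add: sum_powers_root_of_unity)
    also have "\<dots> = (\<Sum>k<n. if k = 0 then of_nat n *\<^sub>C 1 else 0)"
      by (intro sum.cong) auto
    also have "\<dots> = of_nat n *\<^sub>C 1" using n by (simp add: sum.delta)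
    finally show ?thesis using n by (simp add: S_def)
  qed
  have S_diff: "norm (S n (of_real r) - S n 1) \<le> 1/6" if "n > 0" for n
  proof -
    have "norm (\<Sum>j<n. R (w n j * of_real r) - R (w n j * 1)) \<le> (\<Sum>j<n. 1/6)"
    proof (rule sum_norm_le)
      fix j
      have "w n j * of_real r - w n j * 1 = w n j * of_real (r - 1)" by (simp add: algebra_simps)
      then have "cmod (w n j * of_real r - w n j * 1) < d" using r by (simp add: norm_mult w1 abs_if del: of_real_diff)
      then show "norm (R (w n j * of_real r) - R (w n j * 1)) \<le> 1/6"
        using d(2)[of "w n j * of_real r" "w n j * 1"] r by (simp add: norm_mult w1)
    qed
    moreover have "S n (of_real r) - S n 1 = inverse (of_nat n) *\<^sub>C (\<Sum>j<n. R (w n j * of_real r) - R (w n j * 1))"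
      by (simp add: S_def cscale_diff_right sum_subtractf)
    ultimately show ?thesis using that
      by (simp only: norm_cscale norm_inverse norm_of_nat) (simp add: field_simps)
  qed
  have S_bound: "norm (S n (of_real r)) \<le> C" if "n > 0" for n
  proof -
    have "norm (\<Sum>j<n. R (w n j * of_real r)) \<le> (\<Sum>j<n. C)"
      by (rule sum_norm_le, rule C) (use r in \<open>simp add: norm_mult w1\<close>)
    then show ?thesis using that
      unfolding S_def by (simp only: norm_cscale norm_inverse norm_of_nat) (simp add: field_simps)
  qed
  have "(\<lambda>n. C * r ^ n) \<longlonglongrightarrow> C * 0" using r by (intro tendsto_intros LIMSEQ_power_zero) auto
  then have "eventually (\<lambda>n. C * r ^ n < 1/6) sequentially" by (intro order_tendstoD) auto
  then obtain N where N: "\<And>n. n \<ge> N \<Longrightarrow> C * r ^ n < 1/6" by (auto simp: eventually_sequentially)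
  have "norm (x ^ n) \<le> 1/2" if "n \<ge> max N 1" for n
  proof -
    have n: "n \<ge> N" "n > 0" using that by auto
    have "C \<ge> 0" using C[of 0] norm_ge_zero[of "R 0"] by (simp del: norm_ge_zero)
    have xn: "norm (x ^ n) \<le> 1" using norm_power_ineq[of x n] nx by (meson norm_ge_zero order_trans power_le_one)
    have "S n (of_real r) = 1 + (of_real r) ^ n *\<^sub>C (x ^ n * S n (of_real r))"
      using S[of "of_real r" n] n r by (simp add: left_diff_distrib) (metis add.commute diff_eq_eq)
    then have "norm (S n (of_real r) - 1) = r ^ n * norm (x ^ n * S n (of_real r))"
      using r by (metis add_diff_cancel_left' norm_cscale norm_power norm_of_real abs_of_nonneg)
    also have "\<dots> \<le> r ^ n * (1 * C)"
    proof (intro mult_left_mono)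
      show "norm (x ^ n * S n (of_real r)) \<le> 1 * C"
        by (rule order_trans[OF norm_mult_ineq mult_mono]) (use xn S_bound[OF n(2)] in auto)
    qed (use r in auto)
    finally have "norm (S n (of_real r) - 1) \<le> 1/6" using N[OF n(1)] by (simp add: mult.commute)
    moreover have "S n 1 - 1 = (S n (of_real r) - 1) - (S n (of_real r) - S n 1)" by simp
    \<comment> \<open>The two errors 1/6 add up to 1/3. The formula for x^n below then gives t \<le>
      1/3 + t/3 for t = norm (x^n), that is t \<le> 1/2.\<close>
    ultimately have S1: "norm (S n 1 - 1) \<le> 1/3"
      using S_diff[OF n(2)] norm_triangle_ineq4[of "S n (of_real r) - 1" "S n (of_real r) - S n 1"] by simp
    have "x ^ n * S n 1 = S n 1 - 1"
    proof -
      have "S n 1 - x ^ n * S n 1 = 1" using S[of 1 n] n by (simp add: left_diff_distrib)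
      then show ?thesis by (metis diff_add_cancel add_diff_cancel_left')
    qed
    then have "x ^ n = (S n 1 - 1) - x ^ n * (S n 1 - 1)" by (simp add: right_diff_distrib)
    then have "norm (x ^ n) \<le> norm (S n 1 - 1) + norm (x ^ n * (S n 1 - 1))"
      by (metis norm_triangle_ineq4)
    also have "norm (x ^ n * (S n 1 - 1)) \<le> norm (x ^ n) * (1/3)"
      by (rule order_trans[OF norm_mult_ineq mult_left_mono]) (use S1 in auto)
    finally show ?thesis using S1 by simp
  qed
  then show ?thesis by blast
qed

text \<open>For self-adjoint elements the C*-identity reads norm (h^2) = norm h ^ 2. Iterated along
  powers of two, this is enough to contradict decay of all powers.\<close>

lemma norm_selfadjoint_power_2:
  fixes h :: "'a::unital_local_cstar"
  assumes "adj h = h" shows "norm (h ^ (2 ^ m)) = norm h ^ (2 ^ m)"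
proof (induction m)
  case (Suc m)
  have "h ^ (2 ^ Suc m) = adj (h ^ (2 ^ m)) * h ^ (2 ^ m)"
    using assms by (simp add: adj_power power_mult power2_eq_square mult.commute power_add[symmetric] mult_2)
  then show ?case using Suc by (simp add: norm_adj_mult power_mult[symmetric] mult.commute)
qed simp

lemma spec_cscale:
  assumes "c \<noteq> 0" shows "l \<in> spec x \<longleftrightarrow> c * l \<in> spec (c *\<^sub>C x)"
  using is_inv_cscale_iff[OF assms, of "l *\<^sub>C 1 - x"] by (simp add: spec_def cscale_diff_right)

text \<open>Scale h to norm 1. If the spectrum missed the unit circle, the powers would decay, while
  those with exponent 2^m keep norm 1. So a spectral value of modulus 1 exists, and self-adjointness
  makes it real.\<close>

lemma spectral_radius_selfadjoint:
  fixes h :: "'a::unital_local_cstar"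
  assumes h: "adj h = h" shows "\<exists>t. complex_of_real t \<in> spec h \<and> \<bar>t\<bar> = norm h"
proof (cases "h = 0")
  case True
  then show ?thesis by (intro exI[of _ 0]) (auto simp: spec_def is_inv_def)
next
  case False
  define c where "c = inverse (norm h)"
  define k where "k = complex_of_real c *\<^sub>C h"
  have c: "c > 0" using False by (simp add: c_def)
  have k: "adj k = k" "norm k = 1" using h False by (auto simp: k_def adj_cscale norm_cscale c_def norm_inverse)
  have "\<exists>l. cmod l = 1 \<and> l \<in> spec k"
  proof (rule ccontr)
    assume "\<not> ?thesis"
    then obtain N where N: "\<And>n. n \<ge> N \<Longrightarrow> norm (k ^ n) \<le> 1/2"
      using powers_decay_if_unit_circle_resolvent[of k] k by auto
    have "N \<le> 2 ^ N" using less_exp[of N] by simp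
    then show False using N[of "2 ^ N"] norm_selfadjoint_power_2[OF k(1), of N] k(2) by simp
  qed
  then obtain l where l: "cmod l = 1" "l \<in> spec k" by blast
  then have "Im l = 0" using spec_selfadjoint_real k(1) by blast
  then have "l = complex_of_real (Re l)" by (simp add: complex_eq_iff)
  then have lr: "\<bar>Re l\<bar> = 1" using l(1) by (metis norm_of_real)
  have "complex_of_real c * (inverse (complex_of_real c) * l) \<in> spec k" using l c by (simp add: mult.assoc[symmetric])
  then have "inverse (complex_of_real c) * l \<in> spec h" unfolding k_def using spec_cscale c by (metis of_real_eq_0_iff less_irrefl)
  moreover have "inverse (complex_of_real c) * l = complex_of_real (norm h * Re l)"
    using \<open>l = complex_of_real (Re l)\<close> by (simp add: c_def)
  ultimately show ?thesis using lr by (metis abs_mult abs_norm_cancel mult.right_neutral)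
qed

section \<open>Functional calculus and positivity\<close>

definition ceval :: "complex poly \<Rightarrow> 'a::unital_local_cstar \<Rightarrow> 'a" where
  "ceval p x = (\<Sum>i\<le>degree p. coeff p i *\<^sub>C x ^ i)"

lemma ceval_upto: "degree p \<le> n \<Longrightarrow> ceval p x = (\<Sum>i\<le>n. coeff p i *\<^sub>C x ^ i)"
  unfolding ceval_def by (intro sum.mono_neutral_left) (auto simp: coeff_eq_0)

lemma ceval_0 [simp]: "ceval 0 x = 0" by (simp add: ceval_def)

lemma ceval_pCons: "ceval (pCons a p) x = a *\<^sub>C 1 + x * ceval p x"
proof -
  have "ceval (pCons a p) x = (\<Sum>i\<le>Suc (degree p). coeff (pCons a p) i *\<^sub>C x ^ i)"
    by (intro ceval_upto) (simp add: degree_pCons_le)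
  also have "\<dots> = a *\<^sub>C 1 + (\<Sum>i\<le>degree p. coeff p i *\<^sub>C (x * x ^ i))"
    by (subst sum.atMost_Suc_shift) simp
  finally show ?thesis by (simp add: ceval_def sum_distrib_left)
qed

lemma ceval_add: "ceval (p + q) x = ceval p x + ceval q x"
  by (simp add: ceval_upto[of _ "max (degree p) (degree q)"] degree_add_le cscale_add_left sum.distrib)

lemma ceval_smult: "ceval (smult c p) x = c *\<^sub>C ceval p x"
  by (simp add: ceval_upto[of _ "degree p"] degree_smult_le cscale_sum_right)

lemma ceval_minus: "ceval (- p) x = - ceval p x"
  using ceval_smult[of "-1" p x] by simp

lemma ceval_diff: "ceval (p - q) x = ceval p x - ceval q x"
  using ceval_add[of p "- q" x] by (simp add: ceval_minus)

lemma ceval_mult: "ceval (p * q) x = ceval p x * ceval q x"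
  by (induction p) (auto simp: ceval_add ceval_smult ceval_pCons algebra_simps)

lemma ceval_commute: "x * y = y * x \<Longrightarrow> ceval p x * y = y * ceval p x"
proof (induction p)
  case (pCons a p)
  then have "x * ceval p x * y = y * (x * ceval p x)" by (metis mult.assoc)
  then show ?case by (simp add: ceval_pCons algebra_simps)
qed simp

text \<open>Over the complex numbers p splits into linear factors; a factor is invertible at x when
  its root avoids the spectrum. The induction removes one root at a time.\<close>

lemma is_inv_ceval:
  assumes "p \<noteq> 0" "\<And>l. poly p l = 0 \<Longrightarrow> l \<notin> spec x" shows "is_inv (ceval p x)"
  using assms
proof (induction "degree p" arbitrary: p)
  case 0
  then obtain c where "p = [:c:]" by (metis degree_0_id)
  then show ?case using 0 by (auto simp: ceval_pCons intro: is_inv_cscale)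
next
  case (Suc n)
  then have "\<not> constant (poly p)" by (simp add: constant_degree)
  then obtain z where z: "poly p z = 0" using fundamental_theorem_of_algebra by blast
  then obtain q where q: "p = [:- z, 1:] * q" by (metis poly_eq_0_iff_dvd dvdE)
  have "q \<noteq> 0" using Suc q by auto
  then have "degree p = Suc (degree q)" unfolding q by (subst degree_mult_eq) auto
  then have "is_inv (ceval q x)" using Suc \<open>q \<noteq> 0\<close> by (intro Suc(1)) (auto simp: q)
  moreover have "is_inv (- (z *\<^sub>C 1 - x))" using Suc(4)[OF z] by (simp add: spec_def del: minus_diff_eq)
  then have "is_inv (ceval [:- z, 1:] x)" by (simp add: ceval_pCons)
  ultimately show ?case unfolding q ceval_mult by (rule is_inv_mult[rotated])
qed

text \<open>The half of spectral mapping that bounds norms: if l - p had no root in the spectrum, l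
  - p(x) would be invertible. A nonempty spectrum excludes that p is the constant l.\<close>

lemma spec_ceval:
  assumes l: "l \<in> spec (ceval p x)" and ne: "spec x \<noteq> {}" shows "\<exists>m\<in>spec x. poly p m = l"
proof (rule ccontr)
  assume no: "\<not> ?thesis"
  have "[:l:] - p \<noteq> 0" using no ne by auto
  then have "is_inv (ceval ([:l:] - p) x)" using no by (intro is_inv_ceval) auto
  then show False using l by (simp add: ceval_diff ceval_pCons spec_def)
qed

definition rspec :: "'a::unital_local_cstar \<Rightarrow> real set" where
  "rspec x = {t. complex_of_real t \<in> spec x}"

lemma rspec_norm: "t \<in> rspec x \<Longrightarrow> \<bar>t\<bar> \<le> norm x"
  using spec_norm_le[of "complex_of_real t" x] by (simp add: rspec_def)

lemma spec_selfadjointE: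
  assumes "adj h = h" "l \<in> spec h" obtains t where "t \<in> rspec h" "l = complex_of_real t"
proof
  show "l = complex_of_real (Re l)" using spec_selfadjoint_real[OF assms] by (simp add: complex_eq_iff)
  then show "Re l \<in> rspec h" using assms by (simp add: rspec_def)
qed

lemma rspec_radius:
  assumes "adj h = h" obtains t where "t \<in> rspec h" "\<bar>t\<bar> = norm h"
  using spectral_radius_selfadjoint[OF assms] by (auto simp: rspec_def)

abbreviation cpoly :: "real poly \<Rightarrow> complex poly" where "cpoly \<equiv> map_poly complex_of_real"

definition reval :: "real poly \<Rightarrow> 'a::unital_local_cstar \<Rightarrow> 'a" where
  "reval p x = ceval (cpoly p) x"

lemma reval_pCons: "reval (pCons a p) x = a *\<^sub>R 1 + x * reval p x"
  by (simp add: reval_def map_poly_pCons ceval_pCons scaleR_cscale)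

lemma reval_0 [simp]: "reval 0 x = 0" by (simp add: reval_def)

lemma reval_add: "reval (p + q) x = reval p x + reval q x"
proof -
  have "cpoly (p + q) = cpoly p + cpoly q" by (intro poly_eqI) (simp add: coeff_map_poly)
  then show ?thesis by (simp add: reval_def ceval_add)
qed

lemma reval_mult: "reval (p * q) x = reval p x * reval q x"
proof -
  have "cpoly (p * q) = cpoly p * cpoly q" by (intro poly_eqI) (simp add: coeff_map_poly coeff_mult)
  then show ?thesis by (simp add: reval_def ceval_mult)
qed

lemma reval_diff: "reval (p - q) x = reval p x - reval q x"
  using reval_add[of "p - q" q x] by simp

lemma reval_commute: "x * y = y * x \<Longrightarrow> reval p x * y = y * reval p x"
  unfolding reval_def by (rule ceval_commute)

lemma reval_self_commute: "x * reval p x = reval p x * x"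
  using reval_commute[of x x p] by simp

lemma adj_reval: "adj h = h \<Longrightarrow> adj (reval p h) = reval p h"
  by (induction p) (auto simp: reval_pCons adj_simps reval_self_commute)

lemma poly_cpoly: "poly (cpoly p) (complex_of_real t) = complex_of_real (poly p t)"
  by (induction p) (auto simp: map_poly_pCons)

lemma rspec_reval:
  assumes h: "adj h = h" and t: "t \<in> rspec (reval p h)" shows "\<exists>s\<in>rspec h. poly p s = t"
proof -
  have "spec h \<noteq> {}" using rspec_radius[OF h] by (auto simp: rspec_def)
  then obtain m where m: "m \<in> spec h" "poly (cpoly p) m = complex_of_real t"
    using t spec_ceval[of "complex_of_real t" "cpoly p" h] by (auto simp: rspec_def reval_def)
  obtain s where s: "s \<in> rspec h" "m = complex_of_real s" using spec_selfadjointE[OF h m(1)] by blast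
  then show ?thesis using m(2) by (auto simp: poly_cpoly intro!: bexI[of _ s])
qed

text \<open>The norm of a self-adjoint element is attained in its spectrum, and spectral values of
  p(h) are values of p on the spectrum of h. This is what turns uniform approximation into norm
  convergence.\<close>

lemma norm_reval_le:
  assumes h: "adj h = h" and B: "\<And>t. t \<in> rspec h \<Longrightarrow> \<bar>poly p t\<bar> \<le> B" shows "norm (reval p h) \<le> B"
proof -
  obtain t where "t \<in> rspec (reval p h)" "\<bar>t\<bar> = norm (reval p h)" 
    using rspec_radius[OF adj_reval[OF h]] by blast
  then show ?thesis using rspec_reval[OF h] B by metis
qed

section \<open>Continuous functional calculus\<close>

lemma weierstrass_sequence:
  fixes f :: "real \<Rightarrow> real"
  assumes "continuous_on UNIV f"
  obtains p :: "nat \<Rightarrow> real poly" where "uniform_limit {a..b} (\<lambda>k. poly (p k)) f sequentially"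
proof -
  have "\<exists>p. \<forall>t\<in>{a..b}. \<bar>poly p t - f t\<bar> < e" if e: "e > 0" for e
  proof -
    have f: "continuous_on {a..b} f" by (rule continuous_on_subset[OF assms]) simp
    obtain g where g: "real_polynomial_function g" "\<And>x. x \<in> {a..b} \<Longrightarrow> \<bar>f x - g x\<bar> < e"
      by (rule Stone_Weierstrass_real_polynomial_function[OF compact_Icc f e]) blast
    obtain c n where "g = (\<lambda>x. \<Sum>i\<le>n. c i * x ^ i)"
      using g(1)[unfolded real_polynomial_function_iff_sum] by blast
    then have "poly (\<Sum>i\<le>n. monom (c i) i) t = g t" for t by (simp add: poly_sum poly_monom)
    then show ?thesis using g(2) by (intro exI[of _ "\<Sum>i\<le>n. monom (c i) i"]) (simp add: abs_minus_commute)
  qed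
  then have "\<forall>k. \<exists>p. \<forall>t\<in>{a..b}. \<bar>poly p t - f t\<bar> < 1 / real (Suc k)" by simp
  from choice[OF this] obtain p where
    p: "\<And>k t. t \<in> {a..b} \<Longrightarrow> \<bar>poly (p k) t - f t\<bar> < 1 / real (Suc k)" by blast
  have "uniform_limit {a..b} (\<lambda>k. poly (p k)) f sequentially"
  proof (rule uniform_limitI)
    fix e :: real assume "e > 0"
    then obtain N where N: "1 / real (Suc N) < e" by (metis inverse_eq_divide reals_Archimedean)
    have "dist (poly (p k) t) (f t) < e" if "k \<ge> N" "t \<in> {a..b}" for k t
    proof -
      have "1 / real (Suc k) \<le> 1 / real (Suc N)" using that by (intro divide_left_mono) auto
      then show ?thesis using p[OF that(2), of k] N by (simp add: dist_real_def)
    qed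
    then show "\<forall>\<^sub>F k in sequentially. \<forall>t\<in>{a..b}. dist (poly (p k) t) (f t) < e"
      unfolding eventually_sequentially by blast
  qed
  then show ?thesis using that by blast
qed

text \<open>Specifying f(h) by an error bound avoids fixing an approximating sequence: d tending to
  0 gives the limit along every such sequence, p = 0 gives the norm estimate, and d = 0 gives the
  value on polynomials.\<close>

definition fc :: "(real \<Rightarrow> real) \<Rightarrow> 'a::unital_local_cstar \<Rightarrow> 'a" where
  "fc f h = (SOME c. \<forall>p d. (\<forall>t\<in>rspec h. \<bar>poly p t - f t\<bar> \<le> d) \<longrightarrow> norm (reval p h - c) \<le> d)"

text \<open>The Weierstrass polynomials are Cauchy by \<open>norm_reval_le\<close> and lie in a
  complete subalgebra. The bound for an arbitrary polynomial follows by comparing it with them and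
  passing to the limit.\<close>

lemma fc_exists:
  fixes h :: "'a::unital_local_cstar"
  assumes h: "adj h = h" and f: "continuous_on UNIV f"
  shows "\<exists>c. \<forall>p d. (\<forall>t\<in>rspec h. \<bar>poly p t - f t\<bar> \<le> d) \<longrightarrow> norm (reval p h - c) \<le> d"
proof -
  obtain p where ulI: "uniform_limit {-norm h..norm h} (\<lambda>k. poly (p k)) f sequentially"
    using weierstrass_sequence[OF f] by blast
  have ul: "uniform_limit (rspec h) (\<lambda>k. poly (p k)) f sequentially"
    by (rule uniform_limit_on_subset[OF ulI]) (use rspec_norm[of _ h] in force)
  have ev: "\<exists>M. \<forall>k\<ge>M. \<forall>t\<in>rspec h. \<bar>poly (p k) t - f t\<bar> < e" if "e > 0" for e
    using uniform_limitD[OF ul that] by (simp add: eventually_sequentially dist_real_def)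
  obtain S where S: "h \<in> S" "1 \<in> S" "complete S" "\<And>y z. y \<in> S \<Longrightarrow> z \<in> S \<Longrightarrow> y + z \<in> S"
    "\<And>y z. y \<in> S \<Longrightarrow> z \<in> S \<Longrightarrow> y * z \<in> S" "\<And>c y. y \<in> S \<Longrightarrow> c *\<^sub>C y \<in> S"
    using local_complete_1[of h] unfolding complete_wrt_dist by auto
  have mem: "reval q h \<in> S" for q
  proof (induction q)
    case 0 then show ?case using S(6)[OF S(2), of 0] by simp
  next
    case (pCons a q) then show ?case by (simp add: reval_pCons scaleR_cscale S(1,2,4-6))
  qed
  have "Cauchy (\<lambda>k. reval (p k) h)"
  proof (rule CauchyI)
    fix e :: real assume "e > 0"
    then obtain M where M: "\<forall>k\<ge>M. \<forall>t\<in>rspec h. \<bar>poly (p k) t - f t\<bar> < e / 4" using ev[of "e/4"] by auto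
    have "norm (reval (p m) h - reval (p n) h) < e" if "m \<ge> M" "n \<ge> M" for m n
    proof -
      have "norm (reval (p m - p n) h) \<le> e / 2"
      proof (rule norm_reval_le[OF h])
        fix t assume "t \<in> rspec h"
        then show "\<bar>poly (p m - p n) t\<bar> \<le> e / 2" 
          using M[rule_format, of m t] M[rule_format, of n t] that
            abs_triangle_ineq4[of "poly (p m) t - f t" "poly (p n) t - f t"] by simp
      qed
      then show ?thesis using \<open>e > 0\<close> by (simp add: reval_diff)
    qed
    then show "\<exists>M. \<forall>m\<ge>M. \<forall>n\<ge>M. norm (reval (p m) h - reval (p n) h) < e" by blast
  qed
  then have "\<exists>c\<in>S. (\<lambda>k. reval (p k) h) \<longlonglongrightarrow> c"
    using S(3)[unfolded complete_def, rule_format, of "\<lambda>k. reval (p k) h"] mem by simp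
  then obtain c where c: "(\<lambda>k. reval (p k) h) \<longlonglongrightarrow> c" by blast
  have bound: "norm (reval q h - c) \<le> d" if q: "\<forall>t\<in>rspec h. \<bar>poly q t - f t\<bar> \<le> d" for q d
  proof (rule field_le_epsilon)
    fix e :: real assume "e > 0"
    from ev[OF this] obtain M where M: "\<forall>k\<ge>M. \<forall>t\<in>rspec h. \<bar>poly (p k) t - f t\<bar> < e" by (elim exE)
    have lim: "(\<lambda>k. norm (reval q h - reval (p k) h)) \<longlonglongrightarrow> norm (reval q h - c)" by (intro tendsto_intros c)
    have "norm (reval q h - reval (p k) h) \<le> d + e" if k: "k \<ge> M" for k
    proof -
      have "norm (reval (q - p k) h) \<le> d + e"
      proof (rule norm_reval_le[OF h])
        fix t assume "t \<in> rspec h"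
        then show "\<bar>poly (q - p k) t\<bar> \<le> d + e" 
          using M[rule_format, of k t] k q[rule_format, of t]
            abs_triangle_ineq4[of "poly q t - f t" "poly (p k) t - f t"] by simp
      qed
      then show ?thesis by (simp add: reval_diff)
    qed
    then have "\<forall>k\<ge>M. norm (reval q h - reval (p k) h) \<le> d + e" by simp
    then have "\<exists>N. \<forall>k\<ge>N. norm (reval q h - reval (p k) h) \<le> d + e" by (rule exI)
    then show "norm (reval q h - c) \<le> d + e" by (rule LIMSEQ_le_const2[OF lim])
  qed
  show ?thesis
  proof (rule exI[of _ c], rule allI, rule allI, rule impI)
    fix q d assume "\<forall>t\<in>rspec h. \<bar>poly q t - f t\<bar> \<le> d"
    then show "norm (reval q h - c) \<le> d" by (rule bound)
  qed
qed

lemma fc_approx: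
  assumes "adj h = h" "continuous_on UNIV f" "\<And>t. t \<in> rspec h \<Longrightarrow> \<bar>poly p t - f t\<bar> \<le> d"
  shows "norm (reval p h - fc f h) \<le> d"
proof -
  have "\<forall>p d. (\<forall>t\<in>rspec h. \<bar>poly p t - f t\<bar> \<le> d) \<longrightarrow> norm (reval p h - fc f h) \<le> d"
    unfolding fc_def by (rule someI_ex[OF fc_exists[OF assms(1,2)]])
  then show ?thesis using assms(3) by simp
qed

lemma fc_limit:
  assumes h: "adj h = h" and f: "continuous_on UNIV f"
    and ul: "uniform_limit (rspec h) (\<lambda>k. poly (p k)) f sequentially"
  shows "(\<lambda>k. reval (p k) h) \<longlonglongrightarrow> fc f h"
proof (rule LIMSEQ_I)
  fix e :: real assume "e > 0"
  then obtain M where M: "\<forall>k\<ge>M. \<forall>t\<in>rspec h. \<bar>poly (p k) t - f t\<bar> < e/2"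
    using uniform_limitD[OF ul, of "e/2"] by (auto simp: eventually_sequentially dist_real_def)
  have "norm (reval (p k) h - fc f h) \<le> e/2" if "k \<ge> M" for k
    by (rule fc_approx[OF h f]) (use M that in \<open>auto intro: less_imp_le\<close>)
  then show "\<exists>M. \<forall>k\<ge>M. norm (reval (p k) h - fc f h) < e" using \<open>e > 0\<close> by (intro exI[of _ M]) force
qed

lemma fc_sequence:
  assumes h: "adj h = h" and f: "continuous_on UNIV f"
  obtains p where "uniform_limit (rspec h) (\<lambda>k. poly (p k)) f sequentially" "(\<lambda>k. reval (p k) h) \<longlonglongrightarrow> fc f h"
proof -
  obtain p where ulI: "uniform_limit {-norm h..norm h} (\<lambda>k. poly (p k)) f sequentially"
    using weierstrass_sequence[OF f] by blast
  have ul: "uniform_limit (rspec h) (\<lambda>k. poly (p k)) f sequentially"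
    by (rule uniform_limit_on_subset[OF ulI]) (use rspec_norm[of _ h] in force)
  then show ?thesis using that fc_limit[OF h f] by blast
qed

lemma fc_cong: "(\<And>t. t \<in> rspec h \<Longrightarrow> f t = g t) \<Longrightarrow> fc f h = fc g h"
  unfolding fc_def by (intro arg_cong[where f = Eps] ext) auto

lemma fc_poly: "adj h = h \<Longrightarrow> fc (poly p) h = reval p h"
  using fc_approx[of h "poly p" p 0] by (simp add: continuous_on_poly)

lemma fc_id: "adj h = h \<Longrightarrow> fc (\<lambda>t. t) h = h"
  using fc_poly[of h "[:0, 1:]"] fc_cong[of h "\<lambda>t. t" "poly [:0, 1:]"] by (simp add: reval_pCons)

lemma fc_const: "adj h = h \<Longrightarrow> fc (\<lambda>t. c) h = of_real c"
  using fc_poly[of h "[:c:]"] fc_cong[of h "\<lambda>t. c" "poly [:c:]"] by (simp add: reval_pCons of_real_def)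

lemma fc_add:
  assumes h: "adj h = h" and f: "continuous_on UNIV f" and g: "continuous_on UNIV g"
  shows "fc (\<lambda>t. f t + g t) h = fc f h + fc g h"
proof -
  obtain p where p: "uniform_limit (rspec h) (\<lambda>k. poly (p k)) f sequentially" "(\<lambda>k. reval (p k) h) \<longlonglongrightarrow> fc f h"
    using fc_sequence[OF h f] by blast
  obtain q where q: "uniform_limit (rspec h) (\<lambda>k. poly (q k)) g sequentially" "(\<lambda>k. reval (q k) h) \<longlonglongrightarrow> fc g h"
    using fc_sequence[OF h g] by blast
  have "uniform_limit (rspec h) (\<lambda>k. poly (p k + q k)) (\<lambda>t. f t + g t) sequentially"
    using uniform_limit_add[OF p(1) q(1)] by (subst (asm) poly_add[symmetric])
  then have "(\<lambda>k. reval (p k + q k) h) \<longlonglongrightarrow> fc (\<lambda>t. f t + g t) h"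
    by (rule fc_limit[OF h continuous_on_add[OF f g]])
  moreover have "(\<lambda>k. reval (p k + q k) h) \<longlonglongrightarrow> fc f h + fc g h"
    unfolding reval_add by (intro tendsto_intros p q)
  ultimately show ?thesis by (rule LIMSEQ_unique)
qed

lemma bounded_rspec_image:
  fixes f :: "real \<Rightarrow> real"
  assumes "continuous_on UNIV f" shows "bounded (f ` rspec h)"
proof (rule bounded_subset)
  show "bounded (f ` {- norm h..norm h})"
    by (intro compact_imp_bounded compact_continuous_image) (use assms continuous_on_subset in auto)
  show "f ` rspec h \<subseteq> f ` {- norm h..norm h}" using rspec_norm[of _ h] by (intro image_mono) force
qed

lemma fc_mult:
  assumes h: "adj h = h" and f: "continuous_on UNIV f" and g: "continuous_on UNIV g"
  shows "fc (\<lambda>t. f t * g t) h = fc f h * fc g h"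
proof -
  obtain p where p: "uniform_limit (rspec h) (\<lambda>k. poly (p k)) f sequentially" "(\<lambda>k. reval (p k) h) \<longlonglongrightarrow> fc f h"
    using fc_sequence[OF h f] by blast
  obtain q where q: "uniform_limit (rspec h) (\<lambda>k. poly (q k)) g sequentially" "(\<lambda>k. reval (q k) h) \<longlonglongrightarrow> fc g h"
    using fc_sequence[OF h g] by blast
  have "uniform_limit (rspec h) (\<lambda>k. poly (p k * q k)) (\<lambda>t. f t * g t) sequentially"
    using uniform_lim_mult[OF p(1) q(1) bounded_rspec_image[OF f] bounded_rspec_image[OF g]]
    by (subst (asm) poly_mult[symmetric])
  then have "(\<lambda>k. reval (p k * q k) h) \<longlonglongrightarrow> fc (\<lambda>t. f t * g t) h"
    by (rule fc_limit[OF h continuous_on_mult[OF f g]])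
  moreover have "(\<lambda>k. reval (p k * q k) h) \<longlonglongrightarrow> fc f h * fc g h"
    unfolding reval_mult by (intro tendsto_intros p q)
  ultimately show ?thesis by (rule LIMSEQ_unique)
qed

lemma adj_fc:
  assumes h: "adj h = h" and f: "continuous_on UNIV f" shows "adj (fc f h) = fc f h"
proof -
  obtain p where p: "(\<lambda>k. reval (p k) h) \<longlonglongrightarrow> fc f h" using fc_sequence[OF h f] by blast
  have "(\<lambda>k. adj (reval (p k) h)) \<longlonglongrightarrow> adj (fc f h)"
    using bounded_linear.tendsto[OF bounded_linear_adj p] .
  then show ?thesis using p LIMSEQ_unique by (simp add: adj_reval[OF h]) blast
qed

lemma fc_commute:
  assumes h: "adj h = h" and f: "continuous_on UNIV f" and y: "h * y = y * h"
  shows "fc f h * y = y * fc f h"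
proof -
  obtain p where p: "(\<lambda>k. reval (p k) h) \<longlonglongrightarrow> fc f h" using fc_sequence[OF h f] by blast
  have "(\<lambda>k. reval (p k) h * y) \<longlonglongrightarrow> fc f h * y" "(\<lambda>k. y * reval (p k) h) \<longlonglongrightarrow> y * fc f h"
    by (intro tendsto_intros p)+
  then show ?thesis using LIMSEQ_unique by (simp add: reval_commute[OF y]) blast
qed

lemma norm_fc_le:
  assumes "adj h = h" "continuous_on UNIV f" "\<And>t. t \<in> rspec h \<Longrightarrow> \<bar>f t\<bar> \<le> d"
  shows "norm (fc f h) \<le> d"
  using fc_approx[OF assms(1,2), of 0 d] assms(3) by simp

section \<open>Positive elements\<close>

definition pos :: "'a::unital_local_cstar \<Rightarrow> bool" where
  "pos x \<longleftrightarrow> adj x = x \<and> (\<forall>t\<in>rspec x. 0 \<le> t)"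

lemma posD: "pos x \<Longrightarrow> adj x = x" "pos x \<Longrightarrow> t \<in> rspec x \<Longrightarrow> 0 \<le> t"
  by (auto simp: pos_def)

lemma of_real_cscale: "(of_real r :: 'a::unital_local_cstar) = complex_of_real r *\<^sub>C 1"
  by (simp add: of_real_def scaleR_cscale)

lemma adj_of_real [simp]: "adj (of_real r) = (of_real r :: 'a::unital_local_cstar)"
  by (simp add: of_real_cscale adj_cscale)

lemma rspec_minus: "t \<in> rspec (- x) \<longleftrightarrow> - t \<in> rspec x"
  using spec_cscale[of "-1" "complex_of_real t" "- x"] by (simp add: rspec_def)

lemma rspec_shift: "t \<in> rspec (x + of_real r) \<longleftrightarrow> t - r \<in> rspec x"
  using spec_shift[of "complex_of_real (t - r)" x "complex_of_real r"] by (simp add: rspec_def of_real_cscale)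

lemma rspec_of_real_diff: "t \<in> rspec (of_real r - x) \<longleftrightarrow> r - t \<in> rspec x"
  using rspec_shift[of t "- x" r] rspec_minus[of "t - r" x] by (simp add: add.commute)

text \<open>Positivity becomes membership in a ball around the scalar M. In this form the triangle
  inequality shows that positive elements are closed under addition, which the spectrum alone does
  not reveal.\<close>

lemma pos_norm_iff:
  assumes h: "adj h = h" and M: "norm h \<le> M" shows "pos h \<longleftrightarrow> norm (of_real M - h) \<le> M"
proof
  assume p: "pos h"
  have "adj (of_real M - h) = of_real M - h" by (simp add: adj_diff h)
  then obtain t where t: "t \<in> rspec (of_real M - h)" "\<bar>t\<bar> = norm (of_real M - h)"
    using rspec_radius by blast
  then have "M - t \<in> rspec h" by (simp add: rspec_of_real_diff)
  then have "0 \<le> M - t" "\<bar>M - t\<bar> \<le> norm h" using p posD rspec_norm by blast+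
  then show "norm (of_real M - h) \<le> M" using t M by simp
next
  assume n: "norm (of_real M - h) \<le> M"
  show "pos h" unfolding pos_def
  proof (intro conjI ballI h)
    fix t assume "t \<in> rspec h"
    then have "M - t \<in> rspec (of_real M - h)" by (simp add: rspec_of_real_diff)
    then show "0 \<le> t" using rspec_norm[of "M - t"] n by force
  qed
qed

lemma pos_add:
  assumes "pos x" "pos y" shows "pos (x + y)"
proof -
  have "norm (of_real (norm x + norm y) - (x + y)) \<le> norm (of_real (norm x) - x) + norm (of_real (norm y) - y)"
    using norm_triangle_ineq[of "of_real (norm x) - x" "of_real (norm y) - y"] by (simp add: algebra_simps)
  also have "\<dots> \<le> norm x + norm y" 
    using assms by (intro add_mono) (simp_all add: pos_norm_iff[symmetric] posD)
  finally show ?thesis using assms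
    by (subst pos_norm_iff[of _ "norm x + norm y"]) (auto simp: posD adj_add norm_triangle_ineq)
qed

lemma pos_scaleR:
  assumes "pos x" "0 \<le> r" shows "pos (r *\<^sub>R x)"
proof -
  have "norm (of_real (r * norm x) - r *\<^sub>R x) = norm (r *\<^sub>R (of_real (norm x) - x))"
    by (simp add: of_real_def scaleR_right_diff_distrib)
  also have "\<dots> \<le> r * norm x"
    using assms by (simp add: mult_left_mono pos_norm_iff[symmetric] posD)
  finally show ?thesis using assms
    by (subst pos_norm_iff[of _ "r * norm x"]) (auto simp: posD adj_scaleR)
qed

lemma pos_square:
  assumes k: "adj k = k" shows "pos (k * k)"
  unfolding pos_def
proof (intro conjI ballI)
  show "adj (k * k) = k * k" by (simp add: adj_mult k)
  fix t assume "t \<in> rspec (k * k)"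
  then have "t \<in> rspec (reval [:0, 0, 1:] k)" by (simp add: reval_pCons)
  then obtain s where "poly [:0, 0, 1:] s = t" using rspec_reval[OF k] by blast
  then show "0 \<le> t" by auto
qed

lemma pos_0 [simp]: "pos 0" using pos_square[of 0] by simp

text \<open>On the spectrum f is the square of a continuous real function, so f(h) is the square of
  a self-adjoint element.\<close>

lemma pos_fc:
  assumes h: "adj h = h" and f: "continuous_on UNIV f" and p: "\<And>t. t \<in> rspec h \<Longrightarrow> 0 \<le> f t"
  shows "pos (fc f h)"
proof -
  let ?g = "\<lambda>t. sqrt (max 0 (f t))"
  have g: "continuous_on UNIV ?g" by (intro continuous_intros f)
  have "fc f h = fc (\<lambda>t. ?g t * ?g t) h" by (rule fc_cong) (use p in auto)
  also have "\<dots> = fc ?g h * fc ?g h" by (rule fc_mult[OF h g g])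
  finally show ?thesis using pos_square adj_fc[OF h g] by metis
qed

definition psqrt :: "'a::unital_local_cstar \<Rightarrow> 'a" where
  "psqrt x = fc (\<lambda>t. sqrt (max 0 t)) x"

lemma continuous_psqrt: "continuous_on UNIV (\<lambda>t::real. sqrt (max 0 t))"
  by (intro continuous_intros)

lemma adj_psqrt: "pos x \<Longrightarrow> adj (psqrt x) = psqrt x"
  unfolding psqrt_def by (intro adj_fc continuous_psqrt) (simp add: posD)

lemma psqrt_mult_self: "pos x \<Longrightarrow> psqrt x * psqrt x = x"
proof -
  assume x: "pos x"
  have "psqrt x * psqrt x = fc (\<lambda>t. sqrt (max 0 t) * sqrt (max 0 t)) x"
    unfolding psqrt_def using x by (intro fc_mult[symmetric] continuous_psqrt) (simp add: posD)
  also have "\<dots> = fc (\<lambda>t. t) x" by (rule fc_cong) (use posD(2)[OF x] in auto)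
  finally show ?thesis using x by (simp add: fc_id posD)
qed

lemma psqrt_commute: "pos x \<Longrightarrow> x * y = y * x \<Longrightarrow> psqrt x * y = y * psqrt x"
  unfolding psqrt_def by (intro fc_commute continuous_psqrt) (auto simp: posD)

text \<open>If z inverts 1 - y x, the formal geometric series suggests 1 + x z y as inverse of 1 - x
  y, and the suggestion can be verified directly.\<close>

lemma is_inv_one_minus_swap:
  fixes x y :: "'a::unital_local_cstar"
  assumes "is_inv (1 - y * x)" shows "is_inv (1 - x * y)"
proof -
  obtain z where z: "(1 - y * x) * z = 1" "z * (1 - y * x) = 1" using assms by (auto simp: is_inv_def)
  have "(1 - x * y) * (1 + x * z * y) = 1 - x * y + x * ((1 - y * x) * z) * y"
    by (simp add: algebra_simps)
  moreover have "(1 + x * z * y) * (1 - x * y) = 1 - x * y + x * (z * (1 - y * x)) * y"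
    by (simp add: algebra_simps)
  ultimately show ?thesis using z unfolding is_inv_def by (intro exI[of _ "1 + x * z * y"]) simp
qed

lemma spec_mult_commute:
  fixes x y :: "'a::unital_local_cstar"
  assumes "l \<in> spec (x * y)" "l \<noteq> 0" shows "l \<in> spec (y * x)"
proof -
  have *: "is_inv (l *\<^sub>C 1 - u) \<longleftrightarrow> is_inv (1 - inverse l *\<^sub>C u)" for u :: 'a
    using is_inv_cscale_iff[OF assms(2), of "1 - inverse l *\<^sub>C u"] assms(2) by (simp add: cscale_diff_right)
  show ?thesis using assms(1) is_inv_one_minus_swap[of y "inverse l *\<^sub>C x"] by (auto simp: spec_def *)
qed

lemma pos_antisym_0: assumes "pos x" "pos (- x)" shows "x = 0"
proof -
  obtain t where t: "t \<in> rspec x" "\<bar>t\<bar> = norm x" using rspec_radius posD(1)[OF assms(1)] by blast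
  then have "0 \<le> t" "0 \<le> - t" using assms posD(2) rspec_minus by (metis, metis minus_minus)
  then show ?thesis using t by simp
qed

text \<open>With \<open>n\<close> the negative part of \<open>adj x * x\<close> and \<open>y = x * n\<close>, the element \<open>adj y * y = - n\<^sup>3\<close>
  is negative, while \<open>y * adj y + adj y * y\<close> is a sum of two squares. Since both products have the
  same nonzero spectrum, \<open>n\<^sup>3\<close> vanishes.\<close>

lemma pos_adj_mult: "pos (adj x * x)"
proof -
  define h where "h = adj x * x"
  have h: "adj h = h" by (simp add: h_def adj_mult)
  let ?m = "\<lambda>t::real. max (- t) 0"
  have m: "continuous_on UNIV ?m" by (intro continuous_intros)
  define n where "n = fc ?m h"
  define y where "y = x * n"
  have n: "adj n = n" unfolding n_def by (rule adj_fc[OF h m])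
  \<comment> \<open>Holds pointwise: t max(-t, 0) = - max(-t, 0)^2.\<close>
  have hn: "h * n = - (n * n)"
  proof -
    have "fc (\<lambda>t. t * ?m t) h = h * n"
      unfolding n_def by (subst fc_mult[OF h continuous_on_id m]) (simp add: fc_id h)
    moreover have "fc (\<lambda>t. (-1) * (?m t * ?m t)) h = - (n * n)"
      unfolding n_def by (subst fc_mult[OF h continuous_on_const continuous_on_mult[OF m m]])
        (simp add: fc_const h fc_mult[OF h m m])
    moreover have "fc (\<lambda>t. t * ?m t) h = fc (\<lambda>t. (-1) * (?m t * ?m t)) h"
      by (rule fc_cong) (auto simp: max_def)
    ultimately show ?thesis by simp
  qed
  have yy: "- (adj y * y) = n * n * n"
  proof -
    have "adj y * y = n * (h * n)" by (simp add: y_def adj_mult n h_def mult.assoc)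
    then show ?thesis by (simp add: hn mult.assoc)
  qed
  have "n * n * n = fc (\<lambda>t. ?m t * ?m t * ?m t) h"
    unfolding n_def by (simp add: fc_mult[OF h m m] fc_mult[OF h continuous_on_mult[OF m m] m])
  then have neg: "pos (- (adj y * y))" unfolding yy
    using pos_fc[OF h continuous_on_mult[OF continuous_on_mult[OF m m] m]] by simp
  \<comment> \<open>Up to sign, u and v are twice the real and imaginary parts of y, so u^2 + v^2 =
    2 (y y* + y* y).\<close>
  define u where "u = y + adj y"
  define v where "v = \<i> *\<^sub>C (y - adj y)"
  have uv: "adj u = u" "adj v = v" by (simp_all add: u_def v_def adj_simps cscale_diff_right algebra_simps)
  have "u * u + v * v = 2 *\<^sub>R (y * adj y + adj y * y)"
    by (simp add: u_def v_def algebra_simps cscale_diff_right scaleR_2)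
  then have "y * adj y = (1/2) *\<^sub>R (u * u + v * v) + - (adj y * y)" by simp
  then have py: "pos (y * adj y)"
    using pos_add[OF pos_scaleR[OF pos_add[OF pos_square[OF uv(1)] pos_square[OF uv(2)]], of "1/2"] neg] by simp
  have "pos (adj y * y)" unfolding pos_def
  proof (intro conjI ballI)
    show "adj (adj y * y) = adj y * y" by (simp add: adj_mult)
    fix t assume t: "t \<in> rspec (adj y * y)"
    show "0 \<le> t"
    proof (cases "t = 0")
      case False
      then have "t \<in> rspec (y * adj y)" using t spec_mult_commute[of "complex_of_real t" "adj y" y] by (simp add: rspec_def)
      then show ?thesis using py posD by blast
    qed simp
  qed
  then have "adj y * y = 0" using pos_antisym_0 neg by blast
  then have "n * n * n = 0" using yy by simp
  \<comment> \<open>The fourth power has the shape to which the C*-identity applies, twice.\<close>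
  then have "adj (n * n) * (n * n) = 0" by (simp add: adj_mult n mult.assoc[symmetric])
  then have "adj n * n = 0" by (simp add: adj_mult_self_eq_0 n)
  then have n0: "n = 0" by (simp add: adj_mult_self_eq_0)
  \<comment> \<open>t + max(-t, 0) is the positive part of t, so h coincides with its positive
    part.\<close>
  have "h = fc (\<lambda>t. t + ?m t) h"
    by (subst fc_add[OF h continuous_on_id m]) (simp add: fc_id h n_def[symmetric] n0)
  moreover have "pos (fc (\<lambda>t. t + ?m t) h)" by (intro pos_fc h continuous_intros) auto
  ultimately show ?thesis by (simp add: h_def)
qed

text \<open>With s the square root of c, the conjugate is (s x)* (s x).\<close>

lemma pos_conj: assumes "pos c" shows "pos (adj x * c * x)"
proof -
  have "adj x * c * x = adj (psqrt c * x) * (psqrt c * x)"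
    using psqrt_mult_self[OF assms] by (simp add: adj_mult adj_psqrt[OF assms] mult.assoc) (metis mult.assoc)
  then show ?thesis using pos_adj_mult by metis
qed

lemma pos_of_real_diff:
  assumes "adj x = x" "norm x \<le> B" shows "pos (of_real B - x)"
  unfolding pos_def
proof (intro conjI ballI)
  show "adj (of_real B - x) = of_real B - x" by (simp add: adj_diff assms)
  fix t assume "t \<in> rspec (of_real B - x)"
  then show "0 \<le> t" using rspec_norm[of "B - t" x] assms(2) by (simp add: rspec_of_real_diff)
qed

text \<open>From x \<le> y \<le> norm y, no spectral value of x exceeds norm y, and norm x is one of
  them.\<close>

lemma pos_norm_mono:
  assumes "pos x" "pos (y - x)" shows "norm x \<le> norm y"
proof -
  have x: "adj x = x" using assms posD by blast
  have y: "adj y = y" using posD(1)[OF assms(2)] x by (simp add: adj_diff)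
  have "pos (of_real (norm y) - y + (y - x))" using pos_add[OF pos_of_real_diff[OF y order_refl] assms(2)] .
  then have p: "pos (of_real (norm y) - x)" by simp
  obtain t where t: "t \<in> rspec x" "\<bar>t\<bar> = norm x" using rspec_radius[OF x] by blast
  then have "0 \<le> t" using assms(1) posD by blast
  moreover have "norm y - t \<in> rspec (of_real (norm y) - x)" using t by (simp add: rspec_of_real_diff)
  then have "t \<le> norm y" using posD(2)[OF p] by force
  ultimately show ?thesis using t by simp
qed

lemma pos_conj_norm: "pos c \<Longrightarrow> pos (norm c *\<^sub>R (adj x * x) - adj x * c * x)"
proof -
  assume c: "pos c"
  have "pos (adj x * (of_real (norm c) - c) * x)" using c by (intro pos_conj pos_of_real_diff) (auto simp: posD)
  then show ?thesis by (simp add: algebra_simps of_real_def)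
qed

section \<open>Comparison of positive elements\<close>

text \<open>Let w = \<psi>(y) and q = \<theta>(y) with t \<psi>(t)^2 + \<theta>(t)^2 = 1. With s the
  root of x, the error is s q^2 s, whose norm is that of q x q \<le> q y q, and t \<theta>(t)^2 is
  uniformly small. The factor \<open>psqrt x\<close> is kept in the conclusion because it forces the
  conjugating element out of the unitization.\<close>

lemma cuntz_below_of_le:
  fixes x y :: "'a::unital_local_cstar"
  assumes x: "pos x" and y: "pos y" and xy: "pos (y - x)" and e: "e > 0"
  shows "\<exists>w. norm (x - (psqrt x * w) * y * adj (psqrt x * w)) < e"
proof -
  define \<eta> where "\<eta> = e / 4"
  have \<eta>: "\<eta> > 0" using e by (simp add: \<eta>_def)
  \<comment> \<open>\<psi> approximates t^(-1/2), with \<eta> as regularization. Replacing t by max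
    0 t keeps the denominators away from 0, so both functions are continuous on the whole
    line.\<close>
  let ?\<psi> = "\<lambda>t::real. sqrt (max 0 t) / (max 0 t + \<eta>)"
  let ?\<theta> = "\<lambda>t::real. sqrt (\<eta> * (2 * max 0 t + \<eta>)) / (max 0 t + \<eta>)"
  have nz: "max 0 t + \<eta> \<noteq> 0" for t using \<eta> by (simp add: max_def)
  have \<psi>: "continuous_on UNIV ?\<psi>" and \<theta>: "continuous_on UNIV ?\<theta>"
    by (intro continuous_intros ballI nz)+
  have ya: "adj y = y" using y posD by blast
  define w where "w = fc ?\<psi> y"
  define q where "q = fc ?\<theta> y"
  have q: "adj q = q" and w: "adj w = w" using adj_fc[OF ya] \<psi> \<theta> by (auto simp: q_def w_def)
  define s where "s = psqrt x"
  have s: "adj s = s" "s * s = x" using adj_psqrt psqrt_mult_self x by (auto simp: s_def)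
  have "w * y * w = fc (\<lambda>t. ?\<psi> t * t * ?\<psi> t) y"
    unfolding w_def using fc_mult[OF ya continuous_on_mult[OF \<psi> continuous_on_id] \<psi>]
      fc_mult[OF ya \<psi> continuous_on_id] by (simp add: fc_id[OF ya])
  moreover have "q * q = fc (\<lambda>t. ?\<theta> t * ?\<theta> t) y"
    unfolding q_def by (rule fc_mult[OF ya \<theta> \<theta>, symmetric])
  ultimately have "q * q + w * y * w = fc (\<lambda>t. ?\<theta> t * ?\<theta> t + ?\<psi> t * t * ?\<psi> t) y"
    using fc_add[OF ya continuous_on_mult[OF \<theta> \<theta>] continuous_on_mult[OF continuous_on_mult[OF \<psi> continuous_on_id] \<psi>]]
    by simp
  also have "\<dots> = fc (\<lambda>t. 1) y"
  proof (rule fc_cong)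
    fix t assume "t \<in> rspec y"
    then have t: "0 \<le> t" using y posD by blast
    have "?\<theta> t * ?\<theta> t + ?\<psi> t * t * ?\<psi> t = (\<eta> * (2 * t + \<eta>) + t * t) / (t + \<eta>)\<^sup>2"
      using t \<eta> by (simp add: power2_eq_square add_divide_distrib max_def)
    also have "\<eta> * (2 * t + \<eta>) + t * t = (t + \<eta>)\<^sup>2" by (simp add: power2_eq_square algebra_simps)
    finally show "?\<theta> t * ?\<theta> t + ?\<psi> t * t * ?\<psi> t = 1" using t \<eta> by simp
  qed
  also have "\<dots> = 1" using fc_const[OF ya, of 1] by simp
  finally have one: "1 - w * y * w = q * q" by (simp add: algebra_simps)
  have "x - (s * w) * y * adj (s * w) = s * (1 - w * y * w) * s"
    by (simp add: algebra_simps adj_mult s w mult.assoc)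
  also have "\<dots> = adj (q * s) * (q * s)" by (simp only: one) (simp add: adj_mult s q mult.assoc)
  \<comment> \<open>Passing from z* z to z z* puts x between the two factors q, where it can be
    compared with y.\<close>
  finally have "norm (x - (s * w) * y * adj (s * w)) = norm ((q * s) * adj (q * s))"
    by (simp add: norm_adj_mult norm_mult_adj)
  also have "(q * s) * adj (q * s) = adj q * x * q" by (simp add: adj_mult s q mult.assoc) (metis s(2) mult.assoc)
  also have "norm \<dots> \<le> norm (adj q * y * q)"
    by (rule pos_norm_mono[OF pos_conj[OF x]]) (use pos_conj[OF xy, of q] in \<open>simp add: algebra_simps\<close>)
  also have "adj q * y * q = fc (\<lambda>t. ?\<theta> t * t * ?\<theta> t) y"
    unfolding q_def using fc_mult[OF ya continuous_on_mult[OF \<theta> continuous_on_id] \<theta>]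
      fc_mult[OF ya \<theta> continuous_on_id] adj_fc[OF ya \<theta>] by (simp add: fc_id[OF ya])
  also have "norm \<dots> \<le> 2 * \<eta>"
  proof (rule norm_fc_le[OF ya])
    show "continuous_on UNIV (\<lambda>t. ?\<theta> t * t * ?\<theta> t)"
      by (intro continuous_on_mult \<theta> continuous_on_id)
    fix t assume "t \<in> rspec y"
    then have t: "0 \<le> t" using y posD by blast
    have "?\<theta> t * t * ?\<theta> t = (\<eta> * (2 * t + \<eta>) * t) / (t + \<eta>)\<^sup>2"
      using t \<eta> by (simp add: power2_eq_square max_def)
    also have "\<dots> \<le> 2 * \<eta>"
    proof -
      have "(2 * t + \<eta>) * t \<le> 2 * (t + \<eta>)\<^sup>2" using t \<eta> by (simp add: power2_eq_square algebra_simps)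
      then have "\<eta> * ((2 * t + \<eta>) * t) \<le> \<eta> * (2 * (t + \<eta>)\<^sup>2)" using \<eta> by (intro mult_left_mono) auto
      then show ?thesis using t \<eta> by (simp add: divide_le_eq mult_ac)
    qed
    finally show "\<bar>?\<theta> t * t * ?\<theta> t\<bar> \<le> 2 * \<eta>" using t \<eta> by (simp add: abs_mult)
  qed
  finally have "norm (x - (s * w) * y * adj (s * w)) < e" using e by (simp add: \<eta>_def)
  then show ?thesis unfolding s_def by blast
qed

text \<open>With s the root of g, conjugation by s gives s c s \<ge> g (h - \<delta>) \<ge>
  (\<epsilon> - \<delta>) g, so g is at most a multiple of s c s. The hypotheses on g cover both g =
  (h - \<epsilon>)_+ and a projection g = h with \<epsilon> = 1/2.\<close>

lemma cuntz_below_of_cut_le: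
  fixes g h c :: "'a::unital_local_cstar"
  assumes g: "pos g" and c: "pos c" and gh: "g * h = h * g" and cut: "pos (g * h - \<epsilon> *\<^sub>R g)"
    and hc: "pos (c - (h - of_real \<delta>))" and de: "\<delta> < \<epsilon>" and e: "e > 0"
  shows "\<exists>w. norm (g - (psqrt g * w) * c * adj (psqrt g * w)) < e"
proof -
  define s where "s = psqrt g"
  have s: "adj s = s" "s * s = g" "s * h = h * s"
    using adj_psqrt psqrt_mult_self psqrt_commute[OF g gh] g by (auto simp: s_def)
  define k where "k = \<epsilon> - \<delta>"
  have k: "k > 0" using de by (simp add: k_def)
  define y where "y = inverse k *\<^sub>R (s * c * s)"
  have "pos (adj s * c * s)" by (rule pos_conj[OF c])
  then have y: "pos y" using k s by (simp add: y_def pos_scaleR)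
  have "s * (h - of_real \<delta>) * s = g * h - \<delta> *\<^sub>R g"
    by (simp add: algebra_simps of_real_def s(2)) (metis s(2,3) mult.assoc gh)
  moreover have "pos (adj s * (c - (h - of_real \<delta>)) * s)" by (rule pos_conj[OF hc])
  ultimately have "pos (s * c * s - (g * h - \<delta> *\<^sub>R g))"
    by (simp add: s(1) right_diff_distrib left_diff_distrib)
  from pos_add[OF this cut] have "pos (s * c * s - k *\<^sub>R g)"
    by (simp add: k_def algebra_simps)
  then have "pos (inverse k *\<^sub>R (s * c * s - k *\<^sub>R g))" using k by (intro pos_scaleR) auto
  then have "pos (y - g)" using k by (simp add: y_def scaleR_right_diff_distrib)
  then obtain w where w: "norm (g - (s * w) * y * adj (s * w)) < e"
    using cuntz_below_of_le[OF g y _ e] unfolding s_def by blast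
  \<comment> \<open>Absorbs the scalar 1/k and the inner s, so that y can be replaced by c.\<close>
  define v where "v = sqrt (inverse k) *\<^sub>R (w * s)"
  have "sqrt (inverse k) * sqrt (inverse k) = inverse k" using k by simp
  then have "(s * w) * y * adj (s * w) = (s * v) * c * adj (s * v)"
    by (simp add: y_def v_def adj_simps s mult.assoc)
  then show ?thesis using w unfolding s_def by auto
qed

text \<open>Expand the positive element (r* - y)* d (r* - y).\<close>

lemma pos_polarization:
  assumes "pos d" shows "pos (r * d * adj r + adj y * d * y - (r * d * y + adj (r * d * y)))"
proof -
  have "pos (adj (adj r - y) * d * (adj r - y))" by (rule pos_conj[OF assms])
  then show ?thesis using posD(1)[OF assms] by (simp add: adj_simps algebra_simps)
qed

section \<open>The unitization\<close>

text \<open>The scalar part enters the norm below because the operator norm is not definite on the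
  unitization of an algebra that is already unital.\<close>

datatype 'a uni = Uni (uvec: 'a) (uscal: complex)

text \<open>Left multiplication of the unitization on the algebra, which is an ideal in it.\<close>

definition uop :: "'a::local_cstar uni \<Rightarrow> 'a \<Rightarrow> 'a" where
  "uop x y = uvec x * y + uscal x *\<^sub>C y"

lemma bounded_linear_uop: "bounded_linear (uop x)"
  unfolding uop_def[abs_def]
  by (intro bounded_linear_add bounded_linear_mult_right bounded_linear_cscale)

instantiation uni :: (local_cstar) unital_local_cstar
begin

definition zero_uni :: "'a uni" where "zero_uni = Uni 0 0"
definition one_uni :: "'a uni" where "one_uni = Uni 0 1"
definition plus_uni :: "'a uni \<Rightarrow> 'a uni \<Rightarrow> 'a uni" where
  "plus_uni x y = Uni (uvec x + uvec y) (uscal x + uscal y)"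
definition minus_uni :: "'a uni \<Rightarrow> 'a uni \<Rightarrow> 'a uni" where
  "minus_uni x y = Uni (uvec x - uvec y) (uscal x - uscal y)"
definition uminus_uni :: "'a uni \<Rightarrow> 'a uni" where
  "uminus_uni x = Uni (- uvec x) (- uscal x)"
definition times_uni :: "'a uni \<Rightarrow> 'a uni \<Rightarrow> 'a uni" where
  "times_uni x y = Uni (uvec x * uvec y + uscal x *\<^sub>C uvec y + uscal y *\<^sub>C uvec x) (uscal x * uscal y)"
definition cscale_uni :: "complex \<Rightarrow> 'a uni \<Rightarrow> 'a uni" where
  "cscale_uni c x = Uni (c *\<^sub>C uvec x) (c * uscal x)"
definition scaleR_uni :: "real \<Rightarrow> 'a uni \<Rightarrow> 'a uni" where
  "scaleR_uni r x = Uni (r *\<^sub>R uvec x) (r *\<^sub>R uscal x)"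
definition adj_uni :: "'a uni \<Rightarrow> 'a uni" where
  "adj_uni x = Uni (adj (uvec x)) (cnj (uscal x))"
definition norm_uni :: "'a uni \<Rightarrow> real" where
  "norm_uni x = max (cmod (uscal x)) (onorm (uop x))"
definition dist_uni :: "'a uni \<Rightarrow> 'a uni \<Rightarrow> real" where
  "dist_uni x y = norm (x - y)"
definition sgn_uni :: "'a uni \<Rightarrow> 'a uni" where
  "sgn_uni x = inverse (norm x) *\<^sub>R x"
definition uniformity_uni :: "('a uni \<times> 'a uni) filter" where
  "uniformity_uni = (INF e\<in>{0 <..}. principal {(x, y). dist x y < e})"
definition open_uni :: "'a uni set \<Rightarrow> bool" where
  "open_uni U = (\<forall>x\<in>U. eventually (\<lambda>(x', y). x' = x \<longrightarrow> y \<in> U) uniformity)"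

lemmas uni_defs = zero_uni_def one_uni_def plus_uni_def minus_uni_def uminus_uni_def times_uni_def
  cscale_uni_def scaleR_uni_def adj_uni_def

lemma uop_add: "uop (x + y) = (\<lambda>z. uop x z + uop y z)"
  by (auto simp: uop_def plus_uni_def algebra_simps cscale_add_left)

lemma uop_mult: "uop (x * y) = uop x \<circ> uop y"
  by (auto simp: uop_def times_uni_def algebra_simps cscale_add_right mult.commute)

lemma uop_cscale: "uop (c *\<^sub>C x) = (\<lambda>z. c *\<^sub>C uop x z)"
  by (auto simp: uop_def cscale_uni_def algebra_simps cscale_add_right)

lemma norm_uni_triangle: "norm (x + y) \<le> norm x + norm (y :: 'a uni)"
proof -
  have "cmod (uscal (x + y)) \<le> cmod (uscal x) + cmod (uscal y)"
    by (simp add: plus_uni_def norm_triangle_ineq)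
  moreover have "onorm (uop (x + y)) \<le> onorm (uop x) + onorm (uop y)"
    unfolding uop_add by (intro onorm_triangle bounded_linear_uop)
  ultimately show ?thesis unfolding norm_uni_def by linarith
qed

lemma norm_uni_mult: "norm (x * y) \<le> norm x * norm (y :: 'a uni)"
proof -
  have "cmod (uscal (x * y)) = cmod (uscal x) * cmod (uscal y)"
    by (simp add: times_uni_def norm_mult)
  also have "\<dots> \<le> norm x * norm y" by (intro mult_mono) (auto simp: norm_uni_def le_max_iff_disj)
  finally have 1: "cmod (uscal (x * y)) \<le> norm x * norm y" .
  have "onorm (uop (x * y)) \<le> onorm (uop x) * onorm (uop y)"
    unfolding uop_mult by (intro onorm_compose bounded_linear_uop)
  also have "\<dots> \<le> norm x * norm y"
    by (intro mult_mono) (auto simp: norm_uni_def le_max_iff_disj onorm_pos_le[OF bounded_linear_uop])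
  finally show ?thesis using 1 by (simp add: norm_uni_def[of "x * y"])
qed

lemma onorm_uop_cscale: "onorm (uop (c *\<^sub>C x)) = cmod c * onorm (uop x)"
proof -
  have le: "onorm (uop (c *\<^sub>C x)) \<le> cmod c * onorm (uop x)" for c and x :: "'a uni"
    unfolding uop_cscale
    by (rule onorm_bound) (auto simp: norm_cscale mult.assoc onorm[OF bounded_linear_uop]
        onorm_pos_le[OF bounded_linear_uop] mult_left_mono)
  show ?thesis
  proof (cases "c = 0")
    case True
    then show ?thesis using le[of c x] onorm_pos_le[OF bounded_linear_uop, of "c *\<^sub>C x"] by simp
  next
    case False
    have "inverse c *\<^sub>C c *\<^sub>C x = x" using False by (simp add: cscale_uni_def mult.assoc[symmetric])
    then have "cmod c * onorm (uop x) \<le> cmod c * (cmod (inverse c) * onorm (uop (c *\<^sub>C x)))"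
      using le[of "inverse c" "c *\<^sub>C x"] by (intro mult_left_mono) auto
    also have "\<dots> = onorm (uop (c *\<^sub>C x))" using False by (simp add: norm_inverse)
    finally show ?thesis using le[of c x] by simp
  qed
qed

lemma norm_uni_cscale: "norm (c *\<^sub>C x) = cmod c * norm (x :: 'a uni)"
proof -
  have "cmod c * max a b = max (cmod c * a) (cmod c * b)" for a b by (simp add: max_mult_distrib_left)
  then show ?thesis by (simp add: norm_uni_def onorm_uop_cscale) (simp add: cscale_uni_def norm_mult)
qed

text \<open>The C*-identity of the algebra, applied to the vectors \<open>uop z y\<close>, bounds
  the squared norm of z by that of z* z. Submultiplicativity gives the other inequality, once the
  first has shown that z and z* have equal norm.\<close>

lemma onorm_uop_adj_mult: "onorm (uop (adj x * x)) = (onorm (uop x))\<^sup>2"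
proof -
  have pos: "0 \<le> onorm (uop z)" for z :: "'a uni" by (rule onorm_pos_le[OF bounded_linear_uop])
  have sq: "(onorm (uop z))\<^sup>2 \<le> onorm (uop (adj z * z))" for z :: "'a uni"
  proof -
    let ?N = "onorm (uop (adj z * z))"
    have "norm (uop z y) \<le> sqrt ?N * norm y" for y
    proof -
      have "adj (uop z y) * uop z y = adj y * uop (adj z * z) y"
        by (simp add: uop_def times_uni_def adj_uni_def adj_simps algebra_simps cscale_add_right)
      then have "(norm (uop z y))\<^sup>2 \<le> norm y * norm (uop (adj z * z) y)"
        using norm_adj_mult[of "uop z y"] norm_mult_ineq[of "adj y" "uop (adj z * z) y"] by simp
      also have "\<dots> \<le> norm y * (?N * norm y)" by (intro mult_left_mono onorm bounded_linear_uop) auto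
      also have "\<dots> = (sqrt ?N * norm y)\<^sup>2" using pos[of "adj z * z"] by (simp add: power_mult_distrib) (simp add: power2_eq_square)
      finally show ?thesis by (rule power2_le_imp_le) (simp add: pos)
    qed
    then have "onorm (uop z) \<le> sqrt ?N" by (intro onorm_bound) (auto simp: pos)
    then have "(onorm (uop z))\<^sup>2 \<le> (sqrt ?N)\<^sup>2" using pos by (intro power_mono)
    then show ?thesis using pos[of "adj z * z"] by simp
  qed
  have le: "onorm (uop (adj z * z)) \<le> onorm (uop (adj z)) * onorm (uop z)" for z :: "'a uni"
    unfolding uop_mult by (intro onorm_compose bounded_linear_uop)
  have le_adj: "onorm (uop z) \<le> onorm (uop (adj z))" for z :: "'a uni"
  proof (cases "onorm (uop z) = 0")
    case False
    then have "onorm (uop z) > 0" using pos[of z] by simp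
    moreover have "onorm (uop z) * onorm (uop z) \<le> onorm (uop (adj z)) * onorm (uop z)"
      using sq[of z] le[of z] by (simp add: power2_eq_square)
    ultimately show ?thesis by (rule mult_right_le_imp_le[rotated])
  qed (use pos in auto)
  have "adj (adj x) = x" by (simp add: adj_uni_def)
  then have "onorm (uop (adj x)) = onorm (uop x)" using le_adj[of x] le_adj[of "adj x"] by simp
  then show ?thesis using sq[of x] le[of x] by (simp add: power2_eq_square)
qed

lemma norm_uni_adj_mult: "norm (adj x * x) = (norm (x :: 'a uni))\<^sup>2"
proof -
  have "cmod (uscal (adj x * x)) = (cmod (uscal x))\<^sup>2"
    by (simp add: times_uni_def adj_uni_def norm_mult power2_eq_square)
  moreover have "(max a b)\<^sup>2 = max (a\<^sup>2) (b\<^sup>2)" if "0 \<le> a" "0 \<le> b" for a b :: real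
    using that by (auto simp: max_def power_mono dest: power2_le_imp_le)
  ultimately show ?thesis using onorm_pos_le[OF bounded_linear_uop, of x]
    by (simp add: norm_uni_def onorm_uop_adj_mult)
qed

lemma norm_uni_le: "norm (Uni v c) \<le> norm v + cmod c"
proof -
  have "onorm (uop (Uni v c)) \<le> norm v + cmod c"
  proof (rule onorm_bound)
    fix y
    have "norm (uop (Uni v c) y) \<le> norm (v * y) + cmod c * norm y"
      by (simp add: uop_def norm_triangle_ineq flip: norm_cscale)
    then show "norm (uop (Uni v c) y) \<le> (norm v + cmod c) * norm y"
      using norm_mult_ineq[of v y] by (simp add: algebra_simps)
  qed simp
  then show ?thesis by (simp add: norm_uni_def)
qed

lemma norm_uni_scal: "cmod (uscal x) \<le> norm (x :: 'a uni)"
  by (simp add: norm_uni_def)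

text \<open>Tested on the vector v*, left multiplication by v already attains norm v.\<close>

lemma norm_uni_vec: "norm v \<le> norm (Uni v 0)"
proof (cases "v = 0")
  case False
  have "(norm v)\<^sup>2 = norm (uop (Uni v 0) (adj v))" by (simp add: uop_def norm_mult_adj)
  also have "\<dots> \<le> onorm (uop (Uni v 0)) * norm v"
    using onorm[OF bounded_linear_uop, of "Uni v 0" "adj v"] by simp
  also have "\<dots> \<le> norm (Uni v 0) * norm v" by (intro mult_right_mono) (auto simp: norm_uni_def)
  finally show ?thesis using False by (simp add: power2_eq_square)
qed (simp add: norm_uni_def le_max_iff_disj)

lemma norm_uvec_le: "norm (uvec x) \<le> norm x + cmod (uscal (x :: 'a uni))"
proof -
  have "Uni (uvec x) 0 = x + Uni 0 (- uscal x)" by (simp add: plus_uni_def)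
  then have "norm (Uni (uvec x) 0) \<le> norm x + norm (Uni (0::'a) (- uscal x))" using norm_uni_triangle by metis
  also have "norm (Uni (0::'a) (- uscal x)) \<le> cmod (uscal x)" using norm_uni_le[of 0 "- uscal x"] by simp
  finally show ?thesis using norm_uni_vec[of "uvec x"] by linarith
qed

text \<open>The norm controls the scalar part and, up to a factor 2, the vector part; so Cauchy
  sequences converge in each coordinate, and \<open>norm_uni_le\<close> recombines the
  limits.\<close>

lemma uni_complete:
  assumes S: "complete S" shows "complete_wrt dist {x :: 'a uni. uvec x \<in> S}"
  unfolding complete_wrt_def dist_uni_def
proof (intro allI impI)
  fix X :: "nat \<Rightarrow> 'a uni"
  assume X: "\<forall>n. X n \<in> {x. uvec x \<in> S}"
    and C: "\<forall>e>0. \<exists>M. \<forall>m\<ge>M. \<forall>n\<ge>M. norm (X m - X n) < e"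
  have "Cauchy (\<lambda>n. uscal (X n))" unfolding Cauchy_iff
  proof (intro allI impI)
    fix e :: real assume "e > 0"
    then obtain M where M: "\<forall>m\<ge>M. \<forall>n\<ge>M. norm (X m - X n) < e" using C by blast
    have "norm (uscal (X m) - uscal (X n)) < e" if "m \<ge> M" "n \<ge> M" for m n
      using norm_uni_scal[of "X m - X n"] M that by (fastforce simp: minus_uni_def)
    then show "\<exists>M. \<forall>m\<ge>M. \<forall>n\<ge>M. norm (uscal (X m) - uscal (X n)) < e" by blast
  qed
  then obtain c where c: "(\<lambda>n. uscal (X n)) \<longlonglongrightarrow> c" using Cauchy_convergent convergent_def by blast
  have "Cauchy (\<lambda>n. uvec (X n))" unfolding Cauchy_iff
  proof (intro allI impI)
    fix e :: real assume "e > 0"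
    then obtain M where M: "\<forall>m\<ge>M. \<forall>n\<ge>M. norm (X m - X n) < e / 2" using C half_gt_zero by blast
    have "norm (uvec (X m) - uvec (X n)) < e" if "m \<ge> M" "n \<ge> M" for m n
    proof -
      have "norm (uvec (X m - X n)) \<le> norm (X m - X n) + norm (X m - X n)"
        using norm_uvec_le[of "X m - X n"] norm_uni_scal[of "X m - X n"] by linarith
      then show ?thesis using M that by (fastforce simp: minus_uni_def)
    qed
    then show "\<exists>M. \<forall>m\<ge>M. \<forall>n\<ge>M. norm (uvec (X m) - uvec (X n)) < e" by blast
  qed
  moreover have "\<forall>n. uvec (X n) \<in> S" using X by simp
  ultimately obtain v where v: "v \<in> S" "(\<lambda>n. uvec (X n)) \<longlonglongrightarrow> v"
    using S[unfolded complete_def, rule_format, of "\<lambda>n. uvec (X n)"] by blast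
  have "(\<lambda>n. norm (uvec (X n) - v) + cmod (uscal (X n) - c)) \<longlonglongrightarrow> norm (v - v) + cmod (c - c)"
    by (intro tendsto_intros c v)
  then have lim: "(\<lambda>n. norm (uvec (X n) - v) + cmod (uscal (X n) - c)) \<longlonglongrightarrow> 0" by simp
  have "\<exists>M. \<forall>n\<ge>M. norm (X n - Uni v c) < e" if e: "e > 0" for e
  proof -
    obtain M where M: "\<forall>n\<ge>M. norm (uvec (X n) - v) + cmod (uscal (X n) - c) < e"
      using order_tendstoD(2)[OF lim e] by (auto simp: eventually_sequentially)
    have "norm (X n - Uni v c) \<le> norm (uvec (X n) - v) + cmod (uscal (X n) - c)" for n
      using norm_uni_le[of "uvec (X n) - v" "uscal (X n) - c"] by (simp add: minus_uni_def)
    then show ?thesis using M by (meson le_less_trans)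
  qed
  then show "\<exists>l\<in>{x. uvec x \<in> S}. \<forall>e>0. \<exists>M. \<forall>n\<ge>M. norm (X n - l) < e"
    using v(1) by (intro bexI[of _ "Uni v c"]) auto
qed

instance
proof
  fix x y z :: "'a uni" and a b :: real and c d :: complex
  show "x + y + z = x + (y + z)" "x + y = y + x" "0 + x = x" "- x + x = 0" "x - y = x + - y"
    by (simp_all add: uni_defs)
  show "a *\<^sub>R (x + y) = a *\<^sub>R x + a *\<^sub>R y" "(a + b) *\<^sub>R x = a *\<^sub>R x + b *\<^sub>R x"
    "a *\<^sub>R b *\<^sub>R x = (a * b) *\<^sub>R x" "1 *\<^sub>R x = x"
    by (simp_all add: uni_defs algebra_simps)
  show "dist x y = norm (x - y)" "sgn x = inverse (norm x) *\<^sub>R x"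
    by (simp_all add: dist_uni_def sgn_uni_def)
  show "uniformity = (INF e\<in>{0 <..}. principal {(x, y::'a uni). dist x y < e})"
    by (rule uniformity_uni_def)
  show "open U = (\<forall>x\<in>U. eventually (\<lambda>(x', y). x' = x \<longrightarrow> y \<in> U) uniformity)" for U :: "'a uni set"
    by (rule open_uni_def)
  show "norm x = 0 \<longleftrightarrow> x = 0"
  proof
    assume 0: "norm x = 0"
    then have "uscal x = 0" using norm_uni_scal[of x] by simp
    then have "norm (uvec x) \<le> 0" using norm_uvec_le[of x] 0 by simp
    then show "x = 0" using \<open>uscal x = 0\<close> by (cases x) (auto simp: uni_defs)
  next
    assume "x = 0"
    then show "norm x = 0" using norm_uni_le[of "0::'a" 0] norm_uni_scal[of "0 :: 'a uni"]
      by (simp add: zero_uni_def)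
  qed
  show "norm (x + y) \<le> norm x + norm y" by (rule norm_uni_triangle)
  show "c *\<^sub>C (x + y) = c *\<^sub>C x + c *\<^sub>C y" "(c + d) *\<^sub>C x = c *\<^sub>C x + d *\<^sub>C x"
    "c *\<^sub>C d *\<^sub>C x = (c * d) *\<^sub>C x"
    by (simp_all add: uni_defs algebra_simps cscale_add_left cscale_add_right)
  show aR: "a *\<^sub>R x = complex_of_real a *\<^sub>C x" for a and x :: "'a uni"
    by (simp add: uni_defs scaleR_cscale) (simp add: scaleR_conv_of_real)
  show "norm (a *\<^sub>R x) = \<bar>a\<bar> * norm x" by (simp add: aR norm_uni_cscale)
  show "x * y * z = x * (y * z)" "(x + y) * z = x * z + y * z" "x * (y + z) = x * y + x * z"
    by (simp_all add: uni_defs algebra_simps cscale_add_left cscale_add_right)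
  show "a *\<^sub>R x * y = a *\<^sub>R (x * y)" "x * a *\<^sub>R y = a *\<^sub>R (x * y)"
    by (simp_all add: uni_defs algebra_simps scaleR_cscale scaleR_conv_of_real cscale_add_right)
  show "1 * x = x" "x * 1 = x" "(0::'a uni) \<noteq> 1" by (simp_all add: uni_defs)
  show "norm (x * y) \<le> norm x * norm y" by (rule norm_uni_mult)
  show "norm (1 :: 'a uni) = 1"
    using norm_uni_le[of "0::'a" 1] norm_uni_scal[of "1 :: 'a uni"] by (simp add: one_uni_def)
  show "c *\<^sub>C x * y = c *\<^sub>C (x * y)" "x * c *\<^sub>C y = c *\<^sub>C (x * y)"
    by (simp_all add: uni_defs algebra_simps cscale_add_right)
  show "norm (c *\<^sub>C x) = cmod c * norm x" by (rule norm_uni_cscale)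
  show "adj (x + y) = adj x + adj y" "adj (c *\<^sub>C x) = cnj c *\<^sub>C adj x" "adj (x * y) = adj y * adj x" "adj (adj x) = x"
    by (simp_all add: uni_defs adj_simps algebra_simps)
  show "norm (adj x * x) = (norm x)\<^sup>2" by (rule norm_uni_adj_mult)
  obtain S where S: "uvec x \<in> S" "complete S" "\<And>y z. y \<in> S \<Longrightarrow> z \<in> S \<Longrightarrow> y + z \<in> S"
    "\<And>y z. y \<in> S \<Longrightarrow> z \<in> S \<Longrightarrow> y * z \<in> S" "\<And>c y. y \<in> S \<Longrightarrow> c *\<^sub>C y \<in> S"
    using local_complete[of "uvec x"] unfolding complete_wrt_dist by auto
  let ?S = "{z. uvec z \<in> S}"
  have 0: "0 \<in> S" using S(5)[OF S(1), of 0] by simp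
  have mem: "x \<in> ?S" "1 \<in> ?S" using S(1) 0 by (auto simp: uni_defs)
  have closed: "(\<forall>y\<in>?S. \<forall>z\<in>?S. y + z \<in> ?S \<and> y * z \<in> ?S) \<and> (\<forall>c. \<forall>y\<in>?S. c *\<^sub>C y \<in> ?S)"
    using S(3-5) by (simp add: uni_defs)
  show "\<exists>S. x \<in> S \<and> 1 \<in> S \<and> complete_wrt dist S \<and>
      (\<forall>y\<in>S. \<forall>z\<in>S. y + z \<in> S \<and> y * z \<in> S) \<and> (\<forall>c. \<forall>y\<in>S. c *\<^sub>C y \<in> S)"
    by (rule exI[of _ ?S], intro conjI mem closed[THEN conjunct1] closed[THEN conjunct2] uni_complete[OF S(2)])
  show "\<exists>S. x \<in> S \<and> complete_wrt dist S \<and>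
      (\<forall>y\<in>S. \<forall>z\<in>S. y + z \<in> S \<and> y * z \<in> S) \<and> (\<forall>c. \<forall>y\<in>S. c *\<^sub>C y \<in> S)"
    by (rule exI[of _ ?S], intro conjI mem closed[THEN conjunct1] closed[THEN conjunct2] uni_complete[OF S(2)])
qed

end

abbreviation emb :: "'a::local_cstar \<Rightarrow> 'a uni" where "emb v \<equiv> Uni v 0"

lemma norm_emb [simp]: "norm (emb v) = norm v"
  using norm_uni_vec[of v] norm_uni_le[of v 0] by simp

lemma uscal_simps [simp]:
  "uscal 0 = 0" "uscal 1 = 1" "uscal (x + y) = uscal x + uscal y" "uscal (x - y) = uscal x - uscal y"
  "uscal (- x) = - uscal x" "uscal (x * y) = uscal x * uscal y" "uscal (c *\<^sub>C x) = c * uscal x"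
  "uscal (r *\<^sub>R x) = r *\<^sub>R uscal x" "uscal (adj x) = cnj (uscal x)"
  by (auto simp: uni_defs)

lemma emb_simps:
  "emb 0 = 0" "emb (x + y) = emb x + emb y" "emb (x - y) = emb x - emb y"
  "emb (- x) = - emb x" "emb (x * y) = emb x * emb y" "emb (c *\<^sub>C x) = c *\<^sub>C emb x"
  "emb (r *\<^sub>R x) = r *\<^sub>R emb x" "emb (adj x) = adj (emb x)"
  by (auto simp: uni_defs)

lemma emb_uvec: "uscal x = 0 \<Longrightarrow> emb (uvec x) = x"
  by (cases x) auto

text \<open>The scalar part is multiplicative, so the scalar part of the root squares to 0. Square
  roots of elements of the algebra thus stay in the algebra.\<close>

lemma uscal_psqrt: "pos x \<Longrightarrow> uscal x = 0 \<Longrightarrow> uscal (psqrt x) = 0"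
  using psqrt_mult_self[of x] uscal_simps(6)[of "psqrt x" "psqrt x"] by simp

section \<open>The operator norm on matrices\<close>

text \<open>A copy of \<open>'a\<close> carrying the class \<^class>\<open>local_cstar\<close>, whose parameters differ
  from those of \<^class>\<open>cstar_algebra\<close>.\<close>

datatype 'a lc = Lc (unlc: 'a)

instantiation lc :: (cstar_algebra) local_cstar
begin

definition zero_lc :: "'a lc" where "zero_lc = Lc 0"
definition plus_lc :: "'a lc \<Rightarrow> 'a lc \<Rightarrow> 'a lc" where "plus_lc x y = Lc (unlc x + unlc y)"
definition minus_lc :: "'a lc \<Rightarrow> 'a lc \<Rightarrow> 'a lc" where "minus_lc x y = Lc (unlc x - unlc y)"
definition uminus_lc :: "'a lc \<Rightarrow> 'a lc" where "uminus_lc x = Lc (- unlc x)"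
definition times_lc :: "'a lc \<Rightarrow> 'a lc \<Rightarrow> 'a lc" where "times_lc x y = Lc (unlc x * unlc y)"
definition cscale_lc :: "complex \<Rightarrow> 'a lc \<Rightarrow> 'a lc" where "cscale_lc c x = Lc (scaleC c (unlc x))"
definition scaleR_lc :: "real \<Rightarrow> 'a lc \<Rightarrow> 'a lc" where "scaleR_lc r x = Lc (r *\<^sub>R unlc x)"
definition adj_lc :: "'a lc \<Rightarrow> 'a lc" where "adj_lc x = Lc (star (unlc x))"
definition norm_lc :: "'a lc \<Rightarrow> real" where "norm_lc x = norm (unlc x)"
definition dist_lc :: "'a lc \<Rightarrow> 'a lc \<Rightarrow> real" where "dist_lc x y = norm (x - y)"
definition sgn_lc :: "'a lc \<Rightarrow> 'a lc" where "sgn_lc x = inverse (norm x) *\<^sub>R x"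
definition uniformity_lc :: "('a lc \<times> 'a lc) filter" where
  "uniformity_lc = (INF e\<in>{0 <..}. principal {(x, y). dist x y < e})"
definition open_lc :: "'a lc set \<Rightarrow> bool" where
  "open_lc U = (\<forall>x\<in>U. eventually (\<lambda>(x', y). x' = x \<longrightarrow> y \<in> U) uniformity)"

lemmas lc_defs = zero_lc_def plus_lc_def minus_lc_def uminus_lc_def times_lc_def
  cscale_lc_def scaleR_lc_def adj_lc_def norm_lc_def

instance
proof
  fix x y z :: "'a lc" and a b :: real and c d :: complex
  show "x + y + z = x + (y + z)" "x + y = y + x" "0 + x = x" "- x + x = 0" "x - y = x + - y"
    by (simp_all add: lc_defs)
  show "a *\<^sub>R (x + y) = a *\<^sub>R x + a *\<^sub>R y" "(a + b) *\<^sub>R x = a *\<^sub>R x + b *\<^sub>R x"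
    "a *\<^sub>R b *\<^sub>R x = (a * b) *\<^sub>R x" "1 *\<^sub>R x = x"
    by (simp_all add: lc_defs algebra_simps)
  show "dist x y = norm (x - y)" "sgn x = inverse (norm x) *\<^sub>R x"
    by (simp_all add: dist_lc_def sgn_lc_def)
  show "uniformity = (INF e\<in>{0 <..}. principal {(x, y::'a lc). dist x y < e})"
    by (rule uniformity_lc_def)
  show "open U = (\<forall>x\<in>U. eventually (\<lambda>(x', y). x' = x \<longrightarrow> y \<in> U) uniformity)" for U :: "'a lc set"
    by (rule open_lc_def)
  show "norm x = 0 \<longleftrightarrow> x = 0" by (cases x) (simp add: lc_defs)
  show "norm (x + y) \<le> norm x + norm y" "norm (a *\<^sub>R x) = \<bar>a\<bar> * norm x" "norm (x * y) \<le> norm x * norm y"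
    by (simp_all add: lc_defs norm_triangle_ineq norm_mult_ineq)
  show "x * y * z = x * (y * z)" "(x + y) * z = x * z + y * z" "x * (y + z) = x * y + x * z"
    "a *\<^sub>R x * y = a *\<^sub>R (x * y)" "x * a *\<^sub>R y = a *\<^sub>R (x * y)"
    by (simp_all add: lc_defs algebra_simps)
  show "c *\<^sub>C (x + y) = c *\<^sub>C x + c *\<^sub>C y" "(c + d) *\<^sub>C x = c *\<^sub>C x + d *\<^sub>C x"
    "c *\<^sub>C d *\<^sub>C x = (c * d) *\<^sub>C x" "a *\<^sub>R x = complex_of_real a *\<^sub>C x"
    "c *\<^sub>C x * y = c *\<^sub>C (x * y)" "x * c *\<^sub>C y = c *\<^sub>C (x * y)" "norm (c *\<^sub>C x) = cmod c * norm x"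
    by (simp_all add: lc_defs scaleC_add_right scaleC_add_left scaleC_scaleC scaleR_scaleC
        mult_scaleC_left mult_scaleC_right norm_scaleC)
  show "adj (x + y) = adj x + adj y" "adj (c *\<^sub>C x) = cnj c *\<^sub>C adj x" "adj (x * y) = adj y * adj x"
    "adj (adj x) = x" "norm (adj x * x) = (norm x)\<^sup>2"
    by (simp_all add: lc_defs star_add star_scaleC star_mult star_star cstar_identity)
  show "\<exists>S. x \<in> S \<and> complete_wrt dist S \<and>
      (\<forall>y\<in>S. \<forall>z\<in>S. y + z \<in> S \<and> y * z \<in> S) \<and> (\<forall>c. \<forall>y\<in>S. c *\<^sub>C y \<in> S)"
  proof (rule exI[of _ UNIV], intro conjI allI ballI UNIV_I, unfold complete_wrt_def dist_lc_def, intro allI impI)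
    fix X :: "nat \<Rightarrow> 'a lc"
    assume "\<forall>e>0. \<exists>M. \<forall>m\<ge>M. \<forall>n\<ge>M. norm (X m - X n) < e"
    then have "Cauchy (\<lambda>n. unlc (X n))" by (simp add: Cauchy_iff lc_defs)
    then obtain l where "(\<lambda>n. unlc (X n)) \<longlonglongrightarrow> l" using Cauchy_convergent convergent_def by blast
    then have "\<forall>e>0. \<exists>M. \<forall>n\<ge>M. norm (X n - Lc l) < e" by (simp add: LIMSEQ_iff lc_defs)
    then show "\<exists>l\<in>UNIV. \<forall>e>0. \<exists>M. \<forall>n\<ge>(M::nat). norm (X n - l) < e" by blast
  qed
qed

end

lemma star_0 [simp]: "star 0 = (0::'a::cstar_algebra)"
  using star_add[of "0::'a" 0] by simp

lemma star_minus: "star (- x) = - star (x::'a::cstar_algebra)"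
  using star_add[of x "- x"] by (simp add: eq_neg_iff_add_eq_0 add.commute)

lemma star_diff: "star (x - y) = star x - star (y::'a::cstar_algebra)"
  using star_add[of x "- y"] by (simp add: star_minus)

lemma star_scaleR: "star (r *\<^sub>R x) = r *\<^sub>R star (x::'a::cstar_algebra)"
  by (simp add: scaleR_scaleC star_scaleC)

lemma star_sum: "star (sum f A) = (\<Sum>i\<in>A. star (f i :: 'a::cstar_algebra))"
  by (induction A rule: infinite_finite_induct) (auto simp: star_add)

lemma norm_star [simp]: "norm (star x) = norm (x::'a::cstar_algebra)"
  using norm_adj[of "Lc x"] by (simp add: norm_lc_def adj_lc_def)

lemma norm_mult_star: "norm (x * star x) = (norm (x::'a::cstar_algebra))\<^sup>2"
  using cstar_identity[of "star x"] by (simp add: star_star)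

lemma scaleC_0_left [simp]: "scaleC 0 x = (0::'a::cstar_algebra)"
  using scaleR_scaleC[of 0 x] by simp

lemma scaleC_0_right [simp]: "scaleC c 0 = (0::'a::cstar_algebra)"
  using scaleC_add_right[of c "0::'a" 0] by simp

lemma scaleC_sum_right: "scaleC c (sum f A) = (\<Sum>i\<in>A. scaleC c (f i :: 'a::cstar_algebra))"
  by (induction A rule: infinite_finite_induct) (auto simp: scaleC_add_right)

section \<open>Positivity in A, inherited from its unitization\<close>

definition apos :: "'a::cstar_algebra \<Rightarrow> bool" where
  "apos a \<longleftrightarrow> pos (emb (Lc a))"

lemma apos_add: "apos a \<Longrightarrow> apos b \<Longrightarrow> apos (a + b)"
  using pos_add[of "emb (Lc a)" "emb (Lc b)"] by (simp add: apos_def lc_defs flip: emb_simps)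

lemma apos_0: "apos 0"
  using pos_0 by (simp add: apos_def lc_defs[symmetric] emb_simps)

lemma apos_scaleR: "apos a \<Longrightarrow> 0 \<le> r \<Longrightarrow> apos (r *\<^sub>R a)"
  using pos_scaleR[of "emb (Lc a)" r] by (simp add: apos_def lc_defs flip: emb_simps)

lemma apos_star_mult: "apos (star a * a)"
  using pos_adj_mult[of "emb (Lc a)"] by (simp add: apos_def lc_defs flip: emb_simps)

lemma apos_sum: "(\<And>i. i \<in> A \<Longrightarrow> apos (f i)) \<Longrightarrow> apos (sum f A)"
  by (induction A rule: infinite_finite_induct) (auto simp: apos_0 apos_add)

lemma apos_norm_mono: "apos a \<Longrightarrow> apos (b - a) \<Longrightarrow> norm a \<le> norm b"
  using pos_norm_mono[of "emb (Lc a)" "emb (Lc b)"] by (simp add: apos_def lc_defs flip: emb_simps)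

lemma apos_conj_norm: "apos c \<Longrightarrow> apos (norm c *\<^sub>R (star a * a) - star a * c * a)"
  using pos_conj_norm[of "emb (Lc c)" "emb (Lc a)"] by (simp add: apos_def lc_defs flip: emb_simps)

section \<open>The Hilbert module of columns\<close>

definition ip :: "nat \<Rightarrow> (nat \<Rightarrow> 'a::cstar_algebra) \<Rightarrow> (nat \<Rightarrow> 'a) \<Rightarrow> 'a" where
  "ip n u v = (\<Sum>i<n. star (u i) * v i)"

definition cnorm :: "nat \<Rightarrow> (nat \<Rightarrow> 'a::cstar_algebra) \<Rightarrow> real" where
  "cnorm n v = sqrt (norm (ip n v v))"

lemma cnorm_nonneg: "0 \<le> cnorm n v" by (simp add: cnorm_def)

lemma cnorm_square: "(cnorm n v)\<^sup>2 = norm (ip n v v)" by (simp add: cnorm_def)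

lemma apos_ip: "apos (ip n v v)"
  unfolding ip_def by (intro apos_sum apos_star_mult)

lemma star_ip: "star (ip n u v) = ip n v u"
  by (simp add: ip_def star_sum star_mult star_star)

lemma norm_entry_le_cnorm: "i < n \<Longrightarrow> norm (v i) \<le> cnorm n v"
proof -
  assume i: "i < n"
  have "ip n v v - star (v i) * v i = (\<Sum>j\<in>{..<n} - {i}. star (v j) * v j)"
    unfolding ip_def using i by (subst sum.remove[of _ i]) auto
  then have "norm (star (v i) * v i) \<le> norm (ip n v v)"
    by (intro apos_norm_mono) (auto intro!: apos_star_mult apos_sum)
  then have "(norm (v i))\<^sup>2 \<le> (cnorm n v)\<^sup>2" by (simp add: cstar_identity cnorm_square)
  then show ?thesis using cnorm_nonneg power2_le_imp_le by blast
qed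

lemma cnorm_le_sum: "cnorm n v \<le> (\<Sum>i<n. norm (v i))"
proof -
  have "(cnorm n v)\<^sup>2 \<le> (\<Sum>i<n. (norm (v i))\<^sup>2)"
    unfolding cnorm_square ip_def cstar_identity[symmetric] by (rule norm_sum)
  also have "\<dots> \<le> (\<Sum>i<n. norm (v i) * (\<Sum>i<n. norm (v i)))"
    unfolding power2_eq_square by (intro sum_mono mult_left_mono member_le_sum) auto
  also have "\<dots> = (\<Sum>i<n. norm (v i))\<^sup>2" by (simp add: power2_eq_square sum_distrib_right)
  finally show ?thesis by (rule power2_le_imp_le) (simp add: sum_nonneg)
qed

lemma ip_diff_mult:
  "ip n (\<lambda>i. v i - u i * b) (\<lambda>i. v i - u i * b) =
    ip n v v - star b * ip n u v - ip n v u * b + star b * ip n u u * b"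
  by (simp add: ip_def star_diff star_mult algebra_simps sum.distrib sum_subtractf sum_distrib_left
      sum_distrib_right mult.assoc)

text \<open>With a = <u, v>, K = norm <u, u> and b = a/K, expand <v - u b, v - u b> \<ge> 0 and use
  <u, u> \<le> K. The result is a* a / K \<le> <v, v>, and the norm is monotone on positive
  elements.\<close>

lemma ip_Cauchy_Schwarz: "norm (ip n u v) \<le> cnorm n u * cnorm n v"
proof (cases "cnorm n u = 0")
  case True
  then have "\<And>i. i < n \<Longrightarrow> u i = 0" using norm_entry_le_cnorm[of _ n u] by fastforce
  then have "ip n u v = 0" by (simp add: ip_def)
  then show ?thesis using True by simp
next
  case False
  define K where "K = norm (ip n u u)"
  have K: "K > 0" using False by (simp add: K_def cnorm_def)
  define a where "a = ip n u v"
  define b where "b = inverse K *\<^sub>R a"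
  have "ip n (\<lambda>i. v i - u i * b) (\<lambda>i. v i - u i * b) + (inverse K)\<^sup>2 *\<^sub>R (K *\<^sub>R (star a * a) - star a * ip n u u * a)
    = ip n v v - inverse K *\<^sub>R (star a * a)"
  proof -
    have vu: "ip n v u = star a" by (simp add: a_def star_ip)
    have "(inverse K)\<^sup>2 * K = inverse K" using K by (simp add: power2_eq_square)
    then show ?thesis unfolding ip_diff_mult vu a_def[symmetric]
      by (simp add: b_def star_scaleR algebra_simps) (simp add: power2_eq_square scaleR_2[symmetric])
  qed
  moreover have "apos (ip n (\<lambda>i. v i - u i * b) (\<lambda>i. v i - u i * b) + (inverse K)\<^sup>2 *\<^sub>R (K *\<^sub>R (star a * a) - star a * ip n u u * a))"
    unfolding K_def by (intro apos_add apos_ip apos_scaleR apos_conj_norm) simp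
  ultimately have "norm (inverse K *\<^sub>R (star a * a)) \<le> norm (ip n v v)"
    using K by (intro apos_norm_mono apos_scaleR apos_star_mult) auto
  then have "(norm a)\<^sup>2 \<le> K * norm (ip n v v)"
    using K by (simp add: cstar_identity field_simps)
  also have "\<dots> = (cnorm n u * cnorm n v)\<^sup>2" by (simp add: power_mult_distrib cnorm_square K_def)
  finally show ?thesis unfolding a_def by (rule power2_le_imp_le) (simp add: cnorm_nonneg)
qed

lemma cnorm_triangle: "cnorm n (\<lambda>i. u i + v i) \<le> cnorm n u + cnorm n v"
proof -
  have "ip n (\<lambda>i. u i + v i) (\<lambda>i. u i + v i) = ip n u u + ip n u v + (ip n v u + ip n v v)"
    by (simp add: ip_def star_add algebra_simps sum.distrib)
  then have "(cnorm n (\<lambda>i. u i + v i))\<^sup>2 \<le> norm (ip n u u) + norm (ip n u v) + (norm (ip n v u) + norm (ip n v v))"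
    unfolding cnorm_square
    by (simp only:) (rule order_trans[OF norm_triangle_ineq add_mono[OF norm_triangle_ineq norm_triangle_ineq]])
  also have "\<dots> \<le> (cnorm n u)\<^sup>2 + cnorm n u * cnorm n v + (cnorm n v * cnorm n u + (cnorm n v)\<^sup>2)"
    by (intro add_mono ip_Cauchy_Schwarz) (simp_all add: cnorm_square)
  also have "\<dots> = (cnorm n u + cnorm n v)\<^sup>2" by (simp add: power2_eq_square algebra_simps)
  finally show ?thesis by (rule power2_le_imp_le) (simp add: cnorm_nonneg add_nonneg_nonneg)
qed

lemma cnorm_scaleC: "cnorm n (\<lambda>i. scaleC c (v i)) = cmod c * cnorm n v"
proof -
  have "ip n (\<lambda>i. scaleC c (v i)) (\<lambda>i. scaleC c (v i)) = (\<Sum>i<n. scaleC (cnj c * c) (star (v i) * v i))"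
    by (simp add: ip_def star_scaleC mult_scaleC_left mult_scaleC_right scaleC_scaleC mult.commute)
  also have "\<dots> = (cmod c)\<^sup>2 *\<^sub>R ip n v v"
    by (simp add: ip_def scaleC_sum_right scaleR_scaleC complex_norm_square[symmetric] mult.commute del: of_real_power)
  finally have "(cnorm n (\<lambda>i. scaleC c (v i)))\<^sup>2 = (cmod c * cnorm n v)\<^sup>2"
    by (simp add: cnorm_square power_mult_distrib)
  then show ?thesis by (simp add: cnorm_nonneg power2_eq_iff_nonneg)
qed

section \<open>Finite columns and finite matrices\<close>

definition fin_col :: "nat \<Rightarrow> (nat \<Rightarrow> 'a::zero) \<Rightarrow> bool" where
  "fin_col n v \<longleftrightarrow> (\<forall>i\<ge>n. v i = 0)"

lemma fin_col_finite: "fin_col n v \<Longrightarrow> finite {i. v i \<noteq> 0}"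
  unfolding fin_col_def by (rule finite_subset[of _ "{..<n}"]) (auto simp: not_less[symmetric])

lemma finite_fin_col: "finite {i. v i \<noteq> 0} \<Longrightarrow> \<exists>n. fin_col n v"
proof -
  assume "finite {i. v i \<noteq> 0}"
  then obtain n where n: "\<forall>i\<in>{i. v i \<noteq> 0}. i < n" unfolding finite_nat_set_iff_bounded by blast
  have "fin_col n v" unfolding fin_col_def
  proof (intro allI impI)
    fix i assume "n \<le> i"
    then show "v i = 0" using n by (cases "v i = 0") auto
  qed
  then show ?thesis by blast
qed

lemma fin_col_mono: "fin_col n v \<Longrightarrow> n \<le> m \<Longrightarrow> fin_col m v"
  by (auto simp: fin_col_def)

lemma col_norm_eq: "fin_col n v \<Longrightarrow> col_norm v = cnorm n v"
  unfolding col_norm_def cnorm_def ip_def fin_col_def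
  by (intro arg_cong[where f = sqrt] arg_cong[where f = norm] sum.mono_neutral_left)
     (auto simp: not_less[symmetric])

lemma Mat_mono: "x \<in> Mat n \<Longrightarrow> n \<le> m \<Longrightarrow> x \<in> Mat m"
  by (auto simp: Mat_def)

lemma Mat_infI: "x \<in> Mat n \<Longrightarrow> x \<in> Mat_inf" by (auto simp: Mat_inf_def)

lemma Mat_infE:
  assumes "x \<in> Mat_inf" obtains n where "x \<in> Mat n" 
  using assms by (auto simp: Mat_inf_def)

lemma Mat_inf_max2:
  assumes "x \<in> Mat_inf" "y \<in> Mat_inf" obtains n where "x \<in> Mat n" "y \<in> Mat n"
proof -
  obtain k l where "x \<in> Mat k" "y \<in> Mat l" using assms by (auto simp: Mat_inf_def)
  then have "x \<in> Mat (max k l)" "y \<in> Mat (max k l)" by (auto intro: Mat_mono)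
  then show ?thesis by (rule that)
qed

lemma Mat_inf_max3:
  assumes "x \<in> Mat_inf" "y \<in> Mat_inf" "z \<in> Mat_inf"
  obtains n where "x \<in> Mat n" "y \<in> Mat n" "z \<in> Mat n"
proof -
  obtain k where "x \<in> Mat k" "y \<in> Mat k" using Mat_inf_max2[OF assms(1,2)] by blast
  moreover obtain l where "z \<in> Mat l" using assms(3) by (auto simp: Mat_inf_def)
  ultimately have "x \<in> Mat (max k l)" "y \<in> Mat (max k l)" "z \<in> Mat (max k l)" by (auto intro: Mat_mono)
  then show ?thesis by (rule that)
qed

lemma mat_mult_eq: "x \<in> Mat n \<Longrightarrow> mat_mult x y i j = (\<Sum>k<n. x i k * y k j)"
  unfolding mat_mult_def Mat_def by (intro sum.mono_neutral_left) (auto simp: not_less[symmetric])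

lemma mat_vec_eq: "x \<in> Mat n \<Longrightarrow> mat_vec x v i = (\<Sum>k<n. x i k * v k)"
  unfolding mat_vec_def Mat_def by (intro sum.mono_neutral_left) (auto simp: not_less[symmetric])

lemma fin_col_mat_vec: "x \<in> Mat n \<Longrightarrow> fin_col n (mat_vec x v)"
  by (auto simp: fin_col_def mat_vec_eq Mat_def)

lemma mat_mult_Mat: "x \<in> Mat n \<Longrightarrow> y \<in> Mat n \<Longrightarrow> mat_mult x y \<in> Mat n"
  by (auto simp: Mat_def mat_mult_eq[unfolded Mat_def])

lemma mat_star_Mat: "x \<in> Mat n \<Longrightarrow> mat_star x \<in> Mat n"
  by (auto simp: Mat_def mat_star_def)

lemma mat_scaleC_Mat: "x \<in> Mat n \<Longrightarrow> mat_scaleC c x \<in> Mat n"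
  by (auto simp: Mat_def mat_scaleC_def)

lemma add_Mat: "x \<in> Mat n \<Longrightarrow> y \<in> Mat n \<Longrightarrow> x + y \<in> Mat n"
  and minus_Mat: "x \<in> Mat n \<Longrightarrow> y \<in> Mat n \<Longrightarrow> x - y \<in> Mat n"
  and uminus_Mat: "x \<in> Mat n \<Longrightarrow> - x \<in> Mat n"
  and zero_Mat: "0 \<in> Mat n"
  by (auto simp: Mat_def)

lemma mat_vec_mult:
  assumes "x \<in> Mat n" "y \<in> Mat n" shows "mat_vec (mat_mult x y) v = mat_vec x (mat_vec y v)"
proof
  fix i
  have "mat_vec (mat_mult x y) v i = (\<Sum>k<n. \<Sum>l<n. x i l * (y l k * v k))"
    by (simp add: mat_vec_eq[OF mat_mult_Mat[OF assms]] mat_mult_eq[OF assms(1)] sum_distrib_right mult.assoc)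
  also have "\<dots> = (\<Sum>l<n. x i l * (\<Sum>k<n. y l k * v k))"
    by (subst sum.swap) (simp add: sum_distrib_left)
  finally show "mat_vec (mat_mult x y) v i = mat_vec x (mat_vec y v) i"
    by (simp add: mat_vec_eq[OF assms(1)] mat_vec_eq[OF assms(2)])
qed

lemma ip_mat_vec:
  assumes "x \<in> Mat n" shows "ip n (mat_vec x u) v = ip n u (mat_vec (mat_star x) v)"
proof -
  have "ip n (mat_vec x u) v = (\<Sum>i<n. \<Sum>k<n. star (u k) * (star (x i k) * v i))"
    by (simp add: ip_def mat_vec_eq[OF assms] star_sum star_mult sum_distrib_right mult.assoc)
  also have "\<dots> = ip n u (mat_vec (mat_star x) v)"
    unfolding ip_def mat_vec_eq[OF mat_star_Mat[OF assms]]
    by (subst sum.swap) (simp add: sum_distrib_left mat_star_def)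
  finally show ?thesis .
qed

section \<open>The operator norm is a C*-norm\<close>

definition mat_size :: "nat \<Rightarrow> 'a::cstar_algebra infmat \<Rightarrow> real" where
  "mat_size n x = (\<Sum>i<n. \<Sum>j<n. norm (x i j))"

lemma cnorm_mat_vec_le_size:
  assumes x: "x \<in> Mat n" shows "cnorm n (mat_vec x v) \<le> mat_size n x * cnorm n v"
proof -
  have "norm (mat_vec x v i) \<le> (\<Sum>j<n. norm (x i j)) * cnorm n v" for i
  proof -
    have "norm (mat_vec x v i) \<le> (\<Sum>j<n. norm (x i j * v j))"
      unfolding mat_vec_eq[OF x] by (rule norm_sum)
    also have "\<dots> \<le> (\<Sum>j<n. norm (x i j) * cnorm n v)"
      by (intro sum_mono order_trans[OF norm_mult_ineq] mult_left_mono norm_entry_le_cnorm) auto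
    finally show ?thesis by (simp add: sum_distrib_right)
  qed
  then have "(\<Sum>i<n. norm (mat_vec x v i)) \<le> mat_size n x * cnorm n v"
    unfolding mat_size_def sum_distrib_right by (intro sum_mono) auto
  then show ?thesis using cnorm_le_sum order_trans by blast
qed

lemma mat_vec_trunc: "x \<in> Mat n \<Longrightarrow> mat_vec x (\<lambda>i. if i < n then v i else 0) = mat_vec x v"
  by (rule ext) (simp add: mat_vec_eq)

lemma cnorm_trunc: "cnorm n (\<lambda>i. if i < n then v i else 0) = cnorm n v"
  by (simp add: cnorm_def ip_def)

lemma cnorm_mono: "n \<le> m \<Longrightarrow> cnorm n v \<le> cnorm m v"
proof -
  assume nm: "n \<le> m"
  have "ip m v v - ip n v v = (\<Sum>j\<in>{n..<m}. star (v j) * v j)"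
    unfolding ip_def using sum_diff_nat_ivl[of 0 n m "\<lambda>j. star (v j) * v j"] nm by (simp add: atLeast0LessThan)
  then have "norm (ip n v v) \<le> norm (ip m v v)"
    by (intro apos_norm_mono apos_ip) (auto intro!: apos_star_mult apos_sum)
  then show ?thesis by (simp add: cnorm_def)
qed

text \<open>The supremum is finite because the sum of the norms of all entries bounds it, so every
  unit column may be compared with it.\<close>

lemma cnorm_mat_vec:
  assumes x: "x \<in> Mat n" shows "cnorm n (mat_vec x v) \<le> mat_norm x * cnorm n v"
proof (cases "cnorm n v = 0")
  case True
  then show ?thesis using cnorm_mat_vec_le_size[OF x, of v] by simp
next
  case False
  define V where "V = {v::nat \<Rightarrow> 'a. finite {i. v i \<noteq> 0} \<and> col_norm v \<le> 1}"
  have bound: "col_norm (mat_vec x u) \<le> mat_size n x" if u: "u \<in> V" for u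
  proof -
    obtain m where m: "fin_col m u" using u finite_fin_col by (auto simp: V_def)
    have "cnorm n u \<le> cnorm (max n m) u" by (rule cnorm_mono) simp
    also have "\<dots> = col_norm u" using col_norm_eq[OF fin_col_mono[OF m max.cobounded2]] by simp
    finally have "cnorm n u \<le> 1" using u by (simp add: V_def)
    then have "mat_size n x * cnorm n u \<le> mat_size n x * 1"
      by (intro mult_left_mono) (auto simp: mat_size_def sum_nonneg)
    then show ?thesis using cnorm_mat_vec_le_size[OF x, of u] col_norm_eq[OF fin_col_mat_vec[OF x]] by simp
  qed
  define c where "c = cnorm n v"
  have c: "c > 0" using False cnorm_nonneg[of n v] by (simp add: c_def)
  \<comment> \<open>Truncation makes the column finitely supported without changing its image under
    x, and scaling makes its norm 1.\<close>
  define u where "u = (\<lambda>i. if i < n then scaleC (of_real (inverse c)) (v i) else 0)"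
  have fu: "fin_col n u" by (simp add: fin_col_def u_def)
  have "cnorm n u = 1" unfolding u_def cnorm_trunc cnorm_scaleC using c by (simp add: c_def[symmetric] norm_inverse)
  then have uV: "u \<in> V" using fin_col_finite[OF fu] col_norm_eq[OF fu] by (simp add: V_def)
  have "col_norm (mat_vec x u) \<le> mat_norm x"
    unfolding mat_norm_def V_def[symmetric] using bound by (intro cSUP_upper uV bdd_aboveI[of _ "mat_size n x"]) auto
  moreover have "mat_vec x u = (\<lambda>i. scaleC (of_real (inverse c)) (mat_vec x v i))"
    unfolding u_def mat_vec_trunc[OF x]
    by (rule ext) (simp add: mat_vec_eq[OF x] mult_scaleC_right scaleR_scaleC[symmetric] scaleR_sum_right del: of_real_inverse)
  then have "col_norm (mat_vec x u) = inverse c * cnorm n (mat_vec x v)"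
    using col_norm_eq[OF fin_col_mat_vec[OF x, of u]] c by (simp add: cnorm_scaleC norm_inverse)
  ultimately show ?thesis using c by (simp add: c_def[symmetric] field_simps)
qed

lemma unit_columns_nonempty: "{v::nat \<Rightarrow> 'a::cstar_algebra. finite {i. v i \<noteq> 0} \<and> col_norm v \<le> 1} \<noteq> {}"
  unfolding ex_in_conv[symmetric] by (rule exI[of _ "\<lambda>_. 0"]) (simp add: col_norm_def)

lemma mat_norm_le:
  assumes x: "x \<in> Mat n" and K: "\<And>v. cnorm n (mat_vec x v) \<le> K * cnorm n v" "0 \<le> K"
  shows "mat_norm x \<le> K"
  unfolding mat_norm_def
proof (rule cSUP_least)
  show "{v::nat \<Rightarrow> 'a. finite {i. v i \<noteq> 0} \<and> col_norm v \<le> 1} \<noteq> {}" by (rule unit_columns_nonempty)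
  fix v :: "nat \<Rightarrow> 'a" assume v: "v \<in> {v. finite {i. v i \<noteq> 0} \<and> col_norm v \<le> 1}"
  then obtain m where m: "fin_col m v" using finite_fin_col by auto
  have "cnorm n v \<le> cnorm (max n m) v" by (rule cnorm_mono) simp
  also have "\<dots> = col_norm v" using col_norm_eq[OF fin_col_mono[OF m max.cobounded2]] by simp
  finally have "K * cnorm n v \<le> K * 1" using v K(2) by (intro mult_left_mono) auto
  then show "col_norm (mat_vec x v) \<le> K" using K(1)[of v] col_norm_eq[OF fin_col_mat_vec[OF x, of v]] by simp
qed

lemma mat_norm_nonneg: "x \<in> Mat n \<Longrightarrow> 0 \<le> mat_norm x"
proof -
  assume x: "x \<in> Mat n"
  show ?thesis
  proof (cases "\<exists>v::nat \<Rightarrow> 'a. cnorm n v \<noteq> 0")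
    case True
    then obtain v :: "nat \<Rightarrow> 'a" where v: "cnorm n v > 0" using cnorm_nonneg by (metis less_eq_real_def)
    have "0 \<le> mat_norm x * cnorm n v" using cnorm_mat_vec[OF x, of v] cnorm_nonneg order_trans by blast
    then show ?thesis using v by (simp add: zero_le_mult_iff)
  next
    \<comment> \<open>Occurs for n = 0 or trivial A: the supremum is then taken over zeros, and its
      value 0 depends on the index set being nonempty.\<close>
    case False
    let ?V = "{v::nat \<Rightarrow> 'a. finite {i. v i \<noteq> 0} \<and> col_norm v \<le> 1}"
    have ne: "?V \<noteq> {}" by (rule unit_columns_nonempty)
    have "col_norm (mat_vec x v) = 0" for v
      using col_norm_eq[OF fin_col_mat_vec[OF x, of v]] False by simp
    then have "mat_norm x = (SUP v\<in>?V. 0)" by (simp add: mat_norm_def)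
    also have "\<dots> = 0" by (rule cSUP_const[OF ne])
    finally show ?thesis by simp
  qed
qed

lemma mat_norm_le_size: "x \<in> Mat n \<Longrightarrow> mat_norm x \<le> mat_size n x"
  by (rule mat_norm_le[OF _ cnorm_mat_vec_le_size]) (auto simp: mat_size_def sum_nonneg)

text \<open>Apply x to the column with \<open>star (x i j)\<close> in position j; entry i of the
  image has norm (norm (x i j))^2.\<close>

lemma norm_entry_le:
  assumes x: "x \<in> Mat n" shows "norm (x i j) \<le> mat_norm x"
proof (cases "x i j = 0")
  case False
  then have ij: "i < n" "j < n" using x by (auto simp: Mat_def not_less[symmetric])
  define v where "v k = (if k = j then star (x i j) else 0)" for k
  have cv: "cnorm n v = norm (x i j)"
  proof -
    have "ip n v v = (\<Sum>k<n. if k = j then x i j * star (x i j) else 0)"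
      unfolding ip_def by (intro sum.cong) (auto simp: v_def star_star)
    then have "norm (ip n v v) = (norm (x i j))\<^sup>2" using ij by (simp add: norm_mult_star)
    then show ?thesis by (simp add: cnorm_def)
  qed
  have "mat_vec x v i = (\<Sum>k<n. if k = j then x i j * star (x i j) else 0)"
    unfolding mat_vec_eq[OF x] by (intro sum.cong) (auto simp: v_def)
  then have "(norm (x i j))\<^sup>2 = norm (mat_vec x v i)" using ij by (simp add: norm_mult_star)
  also have "\<dots> \<le> cnorm n (mat_vec x v)" by (rule norm_entry_le_cnorm[OF ij(1)])
  also have "\<dots> \<le> mat_norm x * norm (x i j)" using cnorm_mat_vec[OF x, of v] by (simp add: cv)
  finally show ?thesis using False by (simp add: power2_eq_square)
qed (simp add: mat_norm_nonneg[OF x])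

lemma mat_norm_triangle:
  assumes "x \<in> Mat n" "y \<in> Mat n" shows "mat_norm (x + y) \<le> mat_norm x + mat_norm y"
proof (rule mat_norm_le[OF add_Mat[OF assms]])
  fix v
  have "mat_vec (x + y) v = (\<lambda>i. mat_vec x v i + mat_vec y v i)"
    by (rule ext) (simp add: mat_vec_eq[OF assms(1)] mat_vec_eq[OF assms(2)] mat_vec_eq[OF add_Mat[OF assms]]
        distrib_right sum.distrib)
  then have "cnorm n (mat_vec (x + y) v) \<le> cnorm n (mat_vec x v) + cnorm n (mat_vec y v)"
    by (simp add: cnorm_triangle)
  then show "cnorm n (mat_vec (x + y) v) \<le> (mat_norm x + mat_norm y) * cnorm n v"
    using cnorm_mat_vec[OF assms(1), of v] cnorm_mat_vec[OF assms(2), of v] by (simp add: distrib_right)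
qed (simp add: mat_norm_nonneg[OF assms(1)] mat_norm_nonneg[OF assms(2)])

lemma mat_norm_mult:
  assumes "x \<in> Mat n" "y \<in> Mat n" shows "mat_norm (mat_mult x y) \<le> mat_norm x * mat_norm y"
proof (rule mat_norm_le[OF mat_mult_Mat[OF assms]])
  fix v
  have "cnorm n (mat_vec x (mat_vec y v)) \<le> mat_norm x * cnorm n (mat_vec y v)"
    by (rule cnorm_mat_vec[OF assms(1)])
  also have "\<dots> \<le> mat_norm x * (mat_norm y * cnorm n v)"
    by (intro mult_left_mono cnorm_mat_vec assms mat_norm_nonneg[OF assms(1)])
  finally show "cnorm n (mat_vec (mat_mult x y) v) \<le> mat_norm x * mat_norm y * cnorm n v"
    by (simp add: mat_vec_mult[OF assms] mult.assoc)
qed (simp add: mat_norm_nonneg[OF assms(1)] mat_norm_nonneg[OF assms(2)])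

lemma mat_norm_scaleC:
  assumes x: "x \<in> Mat n" shows "mat_norm (mat_scaleC c x) = cmod c * mat_norm x"
proof -
  have le: "mat_norm (mat_scaleC c x) \<le> cmod c * mat_norm x" if x: "x \<in> Mat n" for c and x :: "'a infmat"
  proof (rule mat_norm_le[OF mat_scaleC_Mat[OF x]])
    fix v
    have "mat_vec (mat_scaleC c x) v = (\<lambda>i. scaleC c (mat_vec x v i))"
      by (rule ext, subst mat_vec_eq[OF mat_scaleC_Mat[OF x]])
         (simp add: mat_vec_eq[OF x] mat_scaleC_def mult_scaleC_left scaleC_sum_right)
    then show "cnorm n (mat_vec (mat_scaleC c x) v) \<le> cmod c * mat_norm x * cnorm n v"
      using cnorm_mat_vec[OF x, of v] by (simp add: cnorm_scaleC mult.assoc mult_left_mono)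
  qed (simp add: mat_norm_nonneg[OF x])
  show ?thesis
  proof (cases "c = 0")
    case True
    then show ?thesis using le[OF x, of c] mat_norm_nonneg[OF mat_scaleC_Mat[OF x, of c]] by simp
  next
    case False
    have "mat_scaleC (inverse c) (mat_scaleC c x) = x" using False 
      by (intro ext) (simp add: mat_scaleC_def scaleC_scaleC scaleR_scaleC[of 1, simplified, symmetric])
    then have "cmod c * mat_norm x \<le> cmod c * (cmod (inverse c) * mat_norm (mat_scaleC c x))"
      using le[OF mat_scaleC_Mat[OF x, of c], of "inverse c"] by (intro mult_left_mono) auto
    also have "\<dots> = mat_norm (mat_scaleC c x)" using False by (simp add: norm_inverse)
    finally show ?thesis using le[OF x, of c] by simp
  qed
qed

text \<open>Since <x v, x v> = <v, x* x v>, Cauchy-Schwarz bounds the squared norm of x by that of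
  x* x. The rest follows as for the unitization.\<close>

lemma mat_norm_star_mult:
  assumes x: "x \<in> Mat n" shows "mat_norm (mat_mult (mat_star x) x) = (mat_norm x)\<^sup>2"
proof -
  have sq: "(mat_norm x)\<^sup>2 \<le> mat_norm (mat_mult (mat_star x) x)" if x: "x \<in> Mat n" for x :: "'a infmat"
  proof -
    let ?y = "mat_mult (mat_star x) x"
    have y: "?y \<in> Mat n" by (intro mat_mult_Mat mat_star_Mat x)
    have "cnorm n (mat_vec x v) \<le> sqrt (mat_norm ?y) * cnorm n v" for v
    proof -
      have "(cnorm n (mat_vec x v))\<^sup>2 = norm (ip n v (mat_vec ?y v))"
        by (simp add: cnorm_square ip_mat_vec[OF x] mat_vec_mult[OF mat_star_Mat[OF x] x])
      also have "\<dots> \<le> cnorm n v * (mat_norm ?y * cnorm n v)"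
        by (rule order_trans[OF ip_Cauchy_Schwarz]) (intro mult_left_mono cnorm_mat_vec y cnorm_nonneg)
      also have "\<dots> = (sqrt (mat_norm ?y) * cnorm n v)\<^sup>2"
        using mat_norm_nonneg[OF y] by (simp add: power_mult_distrib) (simp add: power2_eq_square)
      finally show ?thesis by (rule power2_le_imp_le) (simp add: cnorm_nonneg mat_norm_nonneg[OF y])
    qed
    then have "mat_norm x \<le> sqrt (mat_norm ?y)" by (intro mat_norm_le[OF x]) (auto simp: mat_norm_nonneg[OF y])
    then have "(mat_norm x)\<^sup>2 \<le> (sqrt (mat_norm ?y))\<^sup>2" by (intro power_mono mat_norm_nonneg[OF x])
    then show ?thesis using mat_norm_nonneg[OF y] by simp
  qed
  have star2: "mat_star (mat_star x) = x" for x :: "'a infmat" by (simp add: mat_star_def star_star)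
  have le: "mat_norm x \<le> mat_norm (mat_star x)" if x: "x \<in> Mat n" for x :: "'a infmat"
  proof (cases "mat_norm x = 0")
    case False
    then have "mat_norm x > 0" using mat_norm_nonneg[OF x] by simp
    moreover have "mat_norm x * mat_norm x \<le> mat_norm (mat_star x) * mat_norm x"
      using sq[OF x] mat_norm_mult[OF mat_star_Mat[OF x] x] by (simp add: power2_eq_square)
    ultimately show ?thesis by (rule mult_right_le_imp_le[rotated])
  qed (use mat_norm_nonneg[OF mat_star_Mat[OF x]] in auto)
  have "mat_norm (mat_star x) = mat_norm x" using le[OF x] le[OF mat_star_Mat[OF x]] by (simp add: star2)
  then show ?thesis using sq[OF x] mat_norm_mult[OF mat_star_Mat[OF x] x] by (simp add: power2_eq_square)
qed

section \<open>The local C*-algebra of finite matrices\<close>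

text \<open>As a type, the union over all sizes can carry the class \<open>local_cstar\<close>; any
  \<open>Mat n\<close> containing x serves as the complete subalgebra around x.\<close>

typedef (overloaded) 'a minf = "Mat_inf :: 'a::cstar_algebra infmat set" morphisms mat_of Mk
  by (rule exI[of _ 0]) (rule Mat_infI[OF zero_Mat])

lemma minf_eqI: "mat_of x = mat_of y \<Longrightarrow> x = y"
  by (simp add: mat_of_inject)

lemma mat_in_Mat: obtains n where "mat_of x \<in> Mat n"
  using mat_of[of x] by (auto simp: Mat_inf_def)

lemma mat_in_Mat2: obtains n where "mat_of x \<in> Mat n" "mat_of y \<in> Mat n"
  using Mat_inf_max2[OF mat_of[of x] mat_of[of y]] by blast

lemma mat_in_Mat3: obtains n where "mat_of x \<in> Mat n" "mat_of y \<in> Mat n" "mat_of z \<in> Mat n"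
  using Mat_inf_max3[OF mat_of[of x] mat_of[of y] mat_of[of z]] by blast

lemma mat_mult_assoc:
  assumes "x \<in> Mat n" "y \<in> Mat n" 
  shows "mat_mult (mat_mult x y) z = mat_mult x (mat_mult y z)"
proof (intro ext)
  fix i j
  have "mat_mult (mat_mult x y) z i j = (\<Sum>k<n. \<Sum>l<n. x i l * (y l k * z k j))"
    by (simp add: mat_mult_eq[OF mat_mult_Mat[OF assms]] mat_mult_eq[OF assms(1)] sum_distrib_right mult.assoc)
  also have "\<dots> = (\<Sum>l<n. x i l * (\<Sum>k<n. y l k * z k j))"
    by (subst sum.swap) (simp add: sum_distrib_left)
  finally show "mat_mult (mat_mult x y) z i j = mat_mult x (mat_mult y z) i j"
    by (simp add: mat_mult_eq[OF assms(1)] mat_mult_eq[OF assms(2)])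
qed

lemma mat_mult_add_right: "x \<in> Mat n \<Longrightarrow> mat_mult x (y + z) = mat_mult x y + mat_mult x z"
  by (intro ext) (simp add: mat_mult_eq distrib_left sum.distrib)

lemma mat_mult_add_left:
  assumes "x \<in> Mat n" "y \<in> Mat n" shows "mat_mult (x + y) z = mat_mult x z + mat_mult y z"
  by (intro ext) (simp add: mat_mult_eq[OF add_Mat[OF assms]] mat_mult_eq[OF assms(1)] mat_mult_eq[OF assms(2)]
    distrib_right sum.distrib)

lemma mat_mult_scaleC_right: "x \<in> Mat n \<Longrightarrow> mat_mult x (mat_scaleC c y) = mat_scaleC c (mat_mult x y)"
  by (intro ext) (simp add: mat_mult_eq mat_scaleC_def mult_scaleC_right scaleC_sum_right)

lemma mat_mult_scaleC_left:
  assumes "x \<in> Mat n" shows "mat_mult (mat_scaleC c x) y = mat_scaleC c (mat_mult x y)"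
proof (intro ext)
  fix i j
  show "mat_mult (mat_scaleC c x) y i j = mat_scaleC c (mat_mult x y) i j"
    by (subst mat_mult_eq[OF mat_scaleC_Mat[OF assms]])
      (simp add: mat_mult_eq[OF assms] mat_scaleC_def mult_scaleC_left scaleC_sum_right)
qed

lemma mat_star_mult:
  assumes "x \<in> Mat n" "y \<in> Mat n" shows "mat_star (mat_mult x y) = mat_mult (mat_star y) (mat_star x)"
proof (intro ext)
  fix i j
  show "mat_star (mat_mult x y) i j = mat_mult (mat_star y) (mat_star x) i j"
    by (subst mat_mult_eq[OF mat_star_Mat[OF assms(2)]])
      (simp add: mat_mult_eq[OF assms(1)] mat_star_def star_sum star_mult)
qed

lemma scaleC_one [simp]: "scaleC 1 x = (x::'a::cstar_algebra)"
  using scaleR_scaleC[of 1 x] by simp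

instantiation minf :: (cstar_algebra) local_cstar
begin

definition zero_minf :: "'a minf" where "zero_minf = Mk 0"
definition plus_minf :: "'a minf \<Rightarrow> 'a minf \<Rightarrow> 'a minf" where "plus_minf x y = Mk (mat_of x + mat_of y)"
definition minus_minf :: "'a minf \<Rightarrow> 'a minf \<Rightarrow> 'a minf" where "minus_minf x y = Mk (mat_of x - mat_of y)"
definition uminus_minf :: "'a minf \<Rightarrow> 'a minf" where "uminus_minf x = Mk (- mat_of x)"
definition times_minf :: "'a minf \<Rightarrow> 'a minf \<Rightarrow> 'a minf" where "times_minf x y = Mk (mat_mult (mat_of x) (mat_of y))"
definition cscale_minf :: "complex \<Rightarrow> 'a minf \<Rightarrow> 'a minf" where "cscale_minf c x = Mk (mat_scaleC c (mat_of x))"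
definition scaleR_minf :: "real \<Rightarrow> 'a minf \<Rightarrow> 'a minf" where "scaleR_minf r x = Mk (mat_scaleC (complex_of_real r) (mat_of x))"
definition adj_minf :: "'a minf \<Rightarrow> 'a minf" where "adj_minf x = Mk (mat_star (mat_of x))"
definition norm_minf :: "'a minf \<Rightarrow> real" where "norm_minf x = mat_norm (mat_of x)"
definition dist_minf :: "'a minf \<Rightarrow> 'a minf \<Rightarrow> real" where "dist_minf x y = norm (x - y)"
definition sgn_minf :: "'a minf \<Rightarrow> 'a minf" where "sgn_minf x = inverse (norm x) *\<^sub>R x"
definition uniformity_minf :: "('a minf \<times> 'a minf) filter" where
  "uniformity_minf = (INF e\<in>{0 <..}. principal {(x, y). dist x y < e})"
definition open_minf :: "'a minf set \<Rightarrow> bool" where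
  "open_minf U = (\<forall>x\<in>U. eventually (\<lambda>(x', y). x' = x \<longrightarrow> y \<in> U) uniformity)"

lemma mat_zero: "mat_of (0 :: 'a minf) = 0"
  by (simp add: zero_minf_def Mk_inverse Mat_infI[OF zero_Mat])

lemma mat_plus: "mat_of (x + y :: 'a minf) = mat_of x + mat_of y"
  by (rule mat_in_Mat2[of x y]) (simp add: plus_minf_def Mk_inverse Mat_infI[OF add_Mat])

lemma mat_minus: "mat_of (x - y :: 'a minf) = mat_of x - mat_of y"
  by (rule mat_in_Mat2[of x y]) (simp add: minus_minf_def Mk_inverse Mat_infI[OF minus_Mat])

lemma mat_uminus: "mat_of (- x :: 'a minf) = - mat_of x"
  by (rule mat_in_Mat[of x]) (simp add: uminus_minf_def Mk_inverse Mat_infI[OF uminus_Mat])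

lemma mat_times: "mat_of (x * y :: 'a minf) = mat_mult (mat_of x) (mat_of y)"
  by (rule mat_in_Mat2[of x y]) (simp add: times_minf_def Mk_inverse Mat_infI[OF mat_mult_Mat])

lemma mat_cscale: "mat_of (c *\<^sub>C x :: 'a minf) = mat_scaleC c (mat_of x)"
  by (rule mat_in_Mat[of x]) (simp add: cscale_minf_def Mk_inverse Mat_infI[OF mat_scaleC_Mat])

lemma scaleR_minf: "r *\<^sub>R x = complex_of_real r *\<^sub>C (x :: 'a minf)"
  by (simp add: scaleR_minf_def cscale_minf_def)

lemma mat_adj: "mat_of (adj x :: 'a minf) = mat_star (mat_of x)"
  by (rule mat_in_Mat[of x]) (simp add: adj_minf_def Mk_inverse Mat_infI[OF mat_star_Mat])

lemmas mat_simps = mat_zero mat_plus mat_minus mat_uminus mat_times mat_cscale mat_adj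

text \<open>For fixed n the norm lies between each single entry and the sum of the norms of all
  entries, so convergence is entrywise.\<close>

lemma minf_complete: "complete_wrt dist {x :: 'a minf. mat_of x \<in> Mat n}"
  unfolding complete_wrt_def dist_minf_def
proof (intro allI impI)
  fix X :: "nat \<Rightarrow> 'a minf"
  assume "\<forall>k. X k \<in> {x. mat_of x \<in> Mat n}"
    and C: "\<forall>e>0. \<exists>M. \<forall>m\<ge>M. \<forall>k\<ge>M. norm (X m - X k) < e"
  then have X: "mat_of (X k) \<in> Mat n" for k by simp
  have "\<exists>l. (\<lambda>k. mat_of (X k) i j) \<longlonglongrightarrow> l" for i j
  proof -
    have "Cauchy (\<lambda>k. mat_of (X k) i j)"
    proof (rule CauchyI)
      fix e :: real assume "e > 0"
      then obtain M where M: "\<forall>m\<ge>M. \<forall>k\<ge>M. norm (X m - X k) < e" using C by blast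
      have "norm (mat_of (X m) i j - mat_of (X k) i j) < e" if "m \<ge> M" "k \<ge> M" for m k
      proof -
        have "norm ((mat_of (X m) - mat_of (X k)) i j) \<le> norm (X m - X k)"
          unfolding norm_minf_def mat_minus by (rule norm_entry_le[OF minus_Mat[OF X X]])
        then show ?thesis using M that by fastforce
      qed
      then show "\<exists>M. \<forall>m\<ge>M. \<forall>k\<ge>M. norm (mat_of (X m) i j - mat_of (X k) i j) < e" by blast
    qed
    then show ?thesis using Cauchy_convergent convergent_def by blast
  qed
  then have "\<forall>i. \<exists>f. \<forall>j. (\<lambda>k. mat_of (X k) i j) \<longlonglongrightarrow> f j" by (intro allI choice)
  from choice[OF this] obtain L where L: "\<And>i j. (\<lambda>k. mat_of (X k) i j) \<longlonglongrightarrow> L i j" by blast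
  have LM: "L \<in> Mat n" unfolding Mat_def
  proof (intro CollectI allI impI)
    fix i j assume "n \<le> i \<or> n \<le> j"
    then have "(\<lambda>k. mat_of (X k) i j) = (\<lambda>k. 0)" using X by (auto simp: Mat_def)
    then show "L i j = 0" using L[of i j] LIMSEQ_unique tendsto_const by metis
  qed
  have mk: "mat_of (Mk L) = L" by (simp add: Mk_inverse Mat_infI[OF LM])
  have "(\<lambda>k. mat_size n (mat_of (X k) - L)) \<longlonglongrightarrow> (\<Sum>i<n. \<Sum>j<n. norm (L i j - L i j))"
    unfolding mat_size_def fun_diff_def by (intro tendsto_intros L)
  then have lim: "(\<lambda>k. mat_size n (mat_of (X k) - L)) \<longlonglongrightarrow> 0" by simp
  have "\<exists>M. \<forall>k\<ge>M. norm (X k - Mk L) < e" if e: "e > 0" for e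
  proof -
    obtain M where M: "\<forall>k\<ge>M. mat_size n (mat_of (X k) - L) < e"
      using order_tendstoD(2)[OF lim e] by (auto simp: eventually_sequentially)
    have "norm (X k - Mk L) \<le> mat_size n (mat_of (X k) - L)" for k
      unfolding norm_minf_def mat_minus mk by (rule mat_norm_le_size[OF minus_Mat[OF X LM]])
    then show ?thesis using M by (meson le_less_trans)
  qed
  then show "\<exists>l\<in>{x. mat_of x \<in> Mat n}. \<forall>e>0. \<exists>M. \<forall>k\<ge>M. norm (X k - l) < e"
    using LM by (intro bexI[of _ "Mk L"]) (auto simp: mk)
qed

instance
proof
  fix x y z :: "'a minf" and a b :: real and c d :: complex
  obtain n where n: "mat_of x \<in> Mat n" "mat_of y \<in> Mat n" "mat_of z \<in> Mat n" by (rule mat_in_Mat3)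
  show "x + y + z = x + (y + z)" "x + y = y + x" "0 + x = x" "- x + x = 0" "x - y = x + - y"
    by (rule minf_eqI; simp add: mat_simps add_ac)+
  show c: "c *\<^sub>C (x + y) = c *\<^sub>C x + c *\<^sub>C y" "(c + d) *\<^sub>C x = c *\<^sub>C x + d *\<^sub>C x"
    "c *\<^sub>C d *\<^sub>C x = (c * d) *\<^sub>C x" for c d
    by (rule minf_eqI; intro ext; simp add: mat_simps mat_scaleC_def scaleC_add_right scaleC_add_left scaleC_scaleC)+
  show "a *\<^sub>R x = complex_of_real a *\<^sub>C x" by (rule scaleR_minf)
  show "a *\<^sub>R (x + y) = a *\<^sub>R x + a *\<^sub>R y" "(a + b) *\<^sub>R x = a *\<^sub>R x + b *\<^sub>R x"
    "a *\<^sub>R b *\<^sub>R x = (a * b) *\<^sub>R x"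
    by (simp_all add: scaleR_minf c)
  show "1 *\<^sub>R x = x"
    by (rule minf_eqI, intro ext) (simp add: scaleR_minf mat_simps mat_scaleC_def)
  show "dist x y = norm (x - y)" "sgn x = inverse (norm x) *\<^sub>R x"
    by (simp_all add: dist_minf_def sgn_minf_def)
  show "uniformity = (INF e\<in>{0 <..}. principal {(x, y::'a minf). dist x y < e})"
    by (rule uniformity_minf_def)
  show "open U = (\<forall>x\<in>U. eventually (\<lambda>(x', y). x' = x \<longrightarrow> y \<in> U) uniformity)" for U :: "'a minf set"
    by (rule open_minf_def)
  show nc: "norm (c *\<^sub>C x) = cmod c * norm x" for c
    by (simp add: norm_minf_def mat_simps mat_norm_scaleC[OF n(1)])
  then show "norm (a *\<^sub>R x) = \<bar>a\<bar> * norm x" by (simp add: scaleR_minf)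
  show "norm x = 0 \<longleftrightarrow> x = 0"
  proof
    assume "norm x = 0"
    then have "mat_of x i j = 0" for i j using norm_entry_le[OF n(1), of i j] by (simp add: norm_minf_def)
    then show "x = 0" by (intro minf_eqI ext) (simp add: mat_zero)
  next
    assume "x = 0"
    then have "x = 0 *\<^sub>C x" by (intro minf_eqI ext) (simp add: mat_simps mat_scaleC_def)
    then show "norm x = 0" using nc[of 0] by simp
  qed
  show "norm (x + y) \<le> norm x + norm y" "norm (x * y) \<le> norm x * norm y"
    by (simp_all add: norm_minf_def mat_simps mat_norm_triangle[OF n(1,2)] mat_norm_mult[OF n(1,2)])
  show "x * y * z = x * (y * z)" "(x + y) * z = x * z + y * z" "x * (y + z) = x * y + x * z"
    by (rule minf_eqI; simp add: mat_simps mat_mult_assoc[OF n(1,2)] mat_mult_add_left[OF n(1,2)] mat_mult_add_right[OF n(1)])+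
  show cm: "c *\<^sub>C x * y = c *\<^sub>C (x * y)" "x * c *\<^sub>C y = c *\<^sub>C (x * y)" for c
    by (rule minf_eqI; simp add: mat_simps mat_mult_scaleC_left[OF n(1)] mat_mult_scaleC_right[OF n(1)])+
  show "a *\<^sub>R x * y = a *\<^sub>R (x * y)" "x * a *\<^sub>R y = a *\<^sub>R (x * y)"
    by (simp_all add: scaleR_minf cm)
  show "adj (x + y) = adj x + adj y" "adj (c *\<^sub>C x) = cnj c *\<^sub>C adj x" "adj (adj x) = x"
    by (rule minf_eqI; intro ext; simp add: mat_simps mat_star_def mat_scaleC_def star_add star_scaleC star_star)+
  show "adj (x * y) = adj y * adj x"
    by (rule minf_eqI) (simp add: mat_simps mat_star_mult[OF n(1,2)])
  show "norm (adj x * x) = (norm x)\<^sup>2"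
    by (simp add: norm_minf_def mat_simps mat_norm_star_mult[OF n(1)])
  let ?S = "{x. mat_of x \<in> Mat n}"
  have mem: "x \<in> ?S" using n by simp
  have closed: "(\<forall>y\<in>?S. \<forall>z\<in>?S. y + z \<in> ?S \<and> y * z \<in> ?S) \<and> (\<forall>c. \<forall>y\<in>?S. c *\<^sub>C y \<in> ?S)"
    by (simp add: mat_simps add_Mat mat_mult_Mat mat_scaleC_Mat)
  show "\<exists>S. x \<in> S \<and> complete_wrt dist S \<and>
      (\<forall>y\<in>S. \<forall>z\<in>S. y + z \<in> S \<and> y * z \<in> S) \<and> (\<forall>c. \<forall>y\<in>S. c *\<^sub>C y \<in> S)"
    by (rule exI[of _ ?S], intro conjI mem closed[THEN conjunct1] closed[THEN conjunct2] minf_complete)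
qed

end

section \<open>Translation of limits, spectrum, positivity and functional calculus\<close>

lemma norm_mat_entry_le: "norm (mat_of x i j) \<le> norm x"
  by (rule mat_in_Mat[of x]) (simp add: norm_minf_def norm_entry_le)

lemma mat_sum: "mat_of (sum f A) = (\<Sum>i\<in>A. mat_of (f i))"
  by (induction A rule: infinite_finite_induct) (auto simp: mat_simps)

lemma mat_lim_iff: "mat_lim (\<lambda>k. mat_of (X k)) (mat_of x) \<longleftrightarrow> X \<longlonglongrightarrow> x"
  unfolding mat_lim_def mat_minus[symmetric] norm_minf_def[symmetric]
  by (simp add: tendsto_norm_zero_iff LIM_zero_iff)

lemma mat_spectrum_eq: "mat_spectrum (mat_of x) = spec (emb x)"
proof -
  have eq: "Uni u s * Uni v t = 1 \<longleftrightarrow> unitization_mult (mat_of u, s) (mat_of v, t) = (0, 1)"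
    for u v :: "'a minf" and s t
  proof -
    have "Uni u s * Uni v t = 1 \<longleftrightarrow> u * v + s *\<^sub>C v + t *\<^sub>C u = 0 \<and> s * t = 1"
      by (simp add: uni_defs)
    also have "u * v + s *\<^sub>C v + t *\<^sub>C u = 0 \<longleftrightarrow> mat_mult (mat_of u) (mat_of v) + mat_scaleC s (mat_of v) + mat_scaleC t (mat_of u) = 0"
      by (simp only: mat_simps[symmetric] mat_of_inject)
    finally show ?thesis by (simp add: unitization_mult_def)
  qed
  have "is_inv (l *\<^sub>C 1 - emb x) \<longleftrightarrow> (\<exists>w \<in> Mat_inf \<times> UNIV.
     unitization_mult (- mat_of x, l) w = (0, 1) \<and> unitization_mult w (- mat_of x, l) = (0, 1))" (is "_ \<longleftrightarrow> ?R") for l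
  proof -
    have l: "l *\<^sub>C 1 - emb x = Uni (- x) l" by (simp add: uni_defs)
    have "is_inv (Uni (- x) l) \<longleftrightarrow> (\<exists>v t. Uni (- x) l * Uni v t = 1 \<and> Uni v t * Uni (- x) l = 1)"
      unfolding is_inv_def
    proof
      assume "\<exists>y. Uni (- x) l * y = 1 \<and> y * Uni (- x) l = 1"
      then obtain y where "Uni (- x) l * y = 1 \<and> y * Uni (- x) l = 1" ..
      then show "\<exists>v t. Uni (- x) l * Uni v t = 1 \<and> Uni v t * Uni (- x) l = 1"
        by (intro exI[of _ "uvec y"] exI[of _ "uscal y"]) simp
    qed blast
    also have "\<dots> \<longleftrightarrow> ?R"
    proof
      assume "\<exists>v t. Uni (- x) l * Uni v t = 1 \<and> Uni v t * Uni (- x) l = 1"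
      then obtain v t where "Uni (- x) l * Uni v t = 1" "Uni v t * Uni (- x) l = 1" by blast
      then show ?R by (intro bexI[of _ "(mat_of v, t)"]) (simp_all add: eq mat_uminus mat_of)
    next
      assume ?R
      then obtain w t where "w \<in> Mat_inf" "unitization_mult (- mat_of x, l) (w, t) = (0, 1)"
        "unitization_mult (w, t) (- mat_of x, l) = (0, 1)" by auto
      then show "\<exists>v t. Uni (- x) l * Uni v t = 1 \<and> Uni v t * Uni (- x) l = 1"
        by (intro exI[of _ "Mk w"] exI[of _ t]) (simp add: eq mat_uminus Mk_inverse)
    qed
    finally show ?thesis by (simp only: l)
  qed
  then show ?thesis by (simp add: mat_spectrum_def spec_def)
qed

lemma Mat_pos_iff: "mat_of x \<in> Mat_pos \<longleftrightarrow> pos (emb x)"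
proof -
  have sa: "mat_star (mat_of x) = mat_of x \<longleftrightarrow> adj (emb x) = emb x"
    by (simp add: emb_simps(8)[symmetric] mat_adj[symmetric] mat_of_inject)
  have "spec (emb x) \<subseteq> complex_of_real ` {0..} \<longleftrightarrow> (\<forall>t\<in>rspec (emb x). 0 \<le> t)" if h: "adj (emb x) = emb x"
  proof
    assume "spec (emb x) \<subseteq> complex_of_real ` {0..}"
    then show "\<forall>t\<in>rspec (emb x). 0 \<le> t" by (force simp: rspec_def)
  next
    assume p: "\<forall>t\<in>rspec (emb x). 0 \<le> t"
    show "spec (emb x) \<subseteq> complex_of_real ` {0..}"
    proof
      fix l assume "l \<in> spec (emb x)"
      then obtain t where "t \<in> rspec (emb x)" "l = complex_of_real t" using spec_selfadjointE[OF h] by blast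
      then show "l \<in> complex_of_real ` {0..}" using p by auto
    qed
  qed
  then show ?thesis using sa mat_of[of x] by (auto simp: Mat_pos_def pos_def mat_spectrum_eq)
qed

lemma emb_funpow: "emb ((times x ^^ k) x) = emb x ^ Suc k"
  by (induction k) (auto simp: emb_simps)

lemma mat_funpow: "(mat_mult (mat_of x) ^^ k) (mat_of x) = mat_of ((times x ^^ k) x)"
  by (induction k) (auto simp: mat_times)

lemma reval_sum: "reval p h = (\<Sum>i\<le>degree p. coeff p i *\<^sub>R h ^ i)"
  by (simp add: reval_def ceval_def degree_map_poly coeff_map_poly scaleR_cscale)

lemma emb_sum: "emb (sum f A) = (\<Sum>i\<in>A. emb (f i))"
  by (induction A rule: infinite_finite_induct) (auto simp: emb_simps)

text \<open>Without constant term a polynomial maps the algebra, as an ideal of its unitization,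
  into itself. The k-fold iterate is the power with exponent k + 1, hence the shifted
  coefficient.\<close>

lemma reval_emb:
  assumes "poly p 0 = 0"
  shows "reval p (emb x) = emb (\<Sum>k<degree p. coeff p (Suc k) *\<^sub>R ((times x ^^ k) x))"
proof -
  have "coeff p 0 = 0" using assms by (simp add: poly_0_coeff_0)
  then have "reval p (emb x) = (\<Sum>k<degree p. coeff p (Suc k) *\<^sub>R emb x ^ Suc k)"
    unfolding reval_sum by (simp add: lessThan_Suc_atMost[symmetric] sum.lessThan_Suc_shift del: sum.lessThan_Suc power_Suc)
  then show ?thesis by (simp add: emb_sum emb_simps(7) emb_funpow)
qed

lemma mat_poly_eq:
  assumes "poly p 0 = 0" shows "mat_poly p (mat_of x) = mat_of (uvec (reval p (emb x)))"
  by (simp add: reval_emb[OF assms] mat_poly_def mat_sum scaleR_cscale mat_cscale mat_funpow)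

text \<open>The algebra is a proper ideal of its unitization, so none of its elements is invertible
  there. It follows that polynomials converging to f on the spectrum have constant terms tending to
  f 0.\<close>

lemma zero_in_rspec_emb: "0 \<in> rspec (emb x)"
proof -
  have "\<not> is_inv (- emb x)"
  proof
    assume "is_inv (- emb x)"
    then obtain y where "- emb x * y = 1" by (auto simp: is_inv_def)
    then have "uscal (- emb x * y) = 1" by simp
    then show False by simp
  qed
  then show ?thesis by (simp add: rspec_def spec_def)
qed

lemma tendsto_uvec:
  fixes X :: "nat \<Rightarrow> 'a::local_cstar uni"
  assumes X: "X \<longlonglongrightarrow> x" and s: "\<And>k. uscal (X k) = 0" shows "uscal x = 0" "(\<lambda>k. uvec (X k)) \<longlonglongrightarrow> uvec x"
proof -
  have lim: "(\<lambda>k. norm (X k - x)) \<longlonglongrightarrow> 0" using X by (simp add: LIM_zero_iff tendsto_norm_zero_iff)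
  have "cmod (uscal x) \<le> norm (X k - x)" for k
    using norm_uni_scal[of "X k - x"] by (simp add: s)
  then have "cmod (uscal x) \<le> 0" by (intro LIMSEQ_le_const[OF lim]) auto
  then show x: "uscal x = 0" by simp
  have *: "norm (X k - x) = norm (uvec (X k) - uvec x)" for k
    using emb_uvec[OF s[of k]] emb_uvec[OF x] by (metis emb_simps(3) norm_emb)
  then show "(\<lambda>k. uvec (X k)) \<longlonglongrightarrow> uvec x"
    using lim by (simp only: * tendsto_norm_zero_iff LIM_zero_iff)
qed

text \<open>Uniqueness in the definite description needs one admissible sequence; otherwise every
  matrix would satisfy it vacuously.\<close>

lemma mat_fun_calc_eq:
  assumes h: "adj (emb x) = emb x" and f: "continuous_on UNIV f" and f0: "f 0 = 0"
  shows "mat_fun_calc f (mat_of x) = mat_of (uvec (fc f (emb x)))" "uscal (fc f (emb x)) = 0"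
proof -
  have rs: "{t. complex_of_real t \<in> mat_spectrum (mat_of x)} = rspec (emb x)"
    by (simp add: mat_spectrum_eq rspec_def)
  have lim: "uscal (fc f (emb x)) = 0 \<and> (\<lambda>k. uvec (reval (p k) (emb x))) \<longlonglongrightarrow> uvec (fc f (emb x))"
    if p0: "\<And>k. poly (p k) 0 = 0" and ul: "uniform_limit (rspec (emb x)) (\<lambda>k. poly (p k)) f sequentially" for p
    using tendsto_uvec[OF fc_limit[OF h f ul]] by (simp add: reval_emb[OF p0])
  obtain q where q: "uniform_limit (rspec (emb x)) (\<lambda>k. poly (q k)) f sequentially"
    using fc_sequence[OF h f] by blast
  \<comment> \<open>Removing the constant terms preserves the limit, since 0 lies in the spectrum
    and f 0 = 0.\<close>
  define p where "p k = q k - [:poly (q k) 0:]" for k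
  have p0: "poly (p k) 0 = 0" for k by (simp add: p_def)
  have pul: "uniform_limit (rspec (emb x)) (\<lambda>k. poly (p k)) f sequentially"
  proof (rule uniform_limitI)
    fix e :: real assume "e > 0"
    then have "\<forall>\<^sub>F k in sequentially. \<forall>t\<in>rspec (emb x). dist (poly (q k) t) (f t) < e / 2"
      using uniform_limitD[OF q, of "e/2"] by simp
    then show "\<forall>\<^sub>F k in sequentially. \<forall>t\<in>rspec (emb x). dist (poly (p k) t) (f t) < e"
    proof (rule eventually_mono, intro ballI)
      fix k t assume k: "\<forall>t\<in>rspec (emb x). dist (poly (q k) t) (f t) < e / 2" and t: "t \<in> rspec (emb x)"
      have "\<bar>poly (q k) t - f t\<bar> < e / 2" "\<bar>poly (q k) 0\<bar> < e / 2"
        using k[rule_format, OF t] k[rule_format, OF zero_in_rspec_emb] by (auto simp: dist_real_def f0)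
      then show "dist (poly (p k) t) (f t) < e"
        using abs_triangle_ineq4[of "poly (q k) t - f t" "poly (q k) 0"]
        by (simp add: p_def dist_real_def algebra_simps)
    qed
  qed
  show u: "uscal (fc f (emb x)) = 0" using lim[OF p0 pul] by blast
  show "mat_fun_calc f (mat_of x) = mat_of (uvec (fc f (emb x)))"
    unfolding mat_fun_calc_def rs
  proof (rule the_equality, intro conjI allI impI mat_of)
    fix p assume p: "(\<forall>k. poly (p k) 0 = 0) \<and> uniform_limit (rspec (emb x)) (\<lambda>k. poly (p k)) f sequentially"
    then show "mat_lim (\<lambda>k. mat_poly (p k) (mat_of x)) (mat_of (uvec (fc f (emb x))))"
      using lim[of p] by (simp add: mat_poly_eq mat_lim_iff)
  next
    fix c assume c: "c \<in> Mat_inf \<and> (\<forall>p. (\<forall>k. poly (p k) 0 = 0) \<and> uniform_limit (rspec (emb x)) (\<lambda>k. poly (p k)) f sequentially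
        \<longrightarrow> mat_lim (\<lambda>k. mat_poly (p k) (mat_of x)) c)"
    then have cM: "mat_of (Mk c) = c" by (simp add: Mk_inverse)
    have "mat_lim (\<lambda>k. mat_poly (p k) (mat_of x)) c" using c p0 pul by simp
    then have "mat_lim (\<lambda>k. mat_of (uvec (reval (p k) (emb x)))) (mat_of (Mk c))"
      by (simp add: mat_poly_eq[OF p0] cM)
    then have "(\<lambda>k. uvec (reval (p k) (emb x))) \<longlonglongrightarrow> Mk c" by (simp only: mat_lim_iff)
    then have "Mk c = uvec (fc f (emb x))" using lim[OF p0 pul] LIMSEQ_unique by blast
    then show "c = mat_of (uvec (fc f (emb x)))" using cM by simp
  qed
qed

text \<open>Collects what \<open>below_of_cut_le\<close> asks of g. The last property holds because
  g h - \<epsilon> g = g^2, as one sees from f(t) (t - \<epsilon>) = f(t)^2 for f(t) = max(t -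
  \<epsilon>, 0).\<close>

lemma cut_down_exists:
  assumes x: "pos (emb x)" and e: "\<epsilon> > 0"
  obtains g where "cut_down (mat_of x) \<epsilon> = mat_of g" "pos (emb g)" "emb g * emb x = emb x * emb g"
    "pos (emb g * emb x - \<epsilon> *\<^sub>R emb g)"
proof -
  let ?f = "\<lambda>t::real. max (t - \<epsilon>) 0"
  have h: "adj (emb x) = emb x" using x posD by blast
  have f: "continuous_on UNIV ?f" by (intro continuous_intros)
  define G where "G = fc ?f (emb x)"
  have G: "emb (uvec G) = G" "cut_down (mat_of x) \<epsilon> = mat_of (uvec G)"
    using mat_fun_calc_eq[OF h f] e by (auto simp: G_def cut_down_def emb_uvec)
  have "pos G" unfolding G_def by (rule pos_fc[OF h f]) simp
  moreover have "G * emb x = emb x * G" unfolding G_def by (rule fc_commute[OF h f]) simp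
  moreover have "G * emb x - \<epsilon> *\<^sub>R G = G * G"
  proof -
    have "fc (\<lambda>t. ?f t * t + ?f t * (- \<epsilon>)) (emb x) = G * emb x + G * of_real (- \<epsilon>)"
      unfolding G_def fc_add[OF h continuous_on_mult[OF f continuous_on_id] continuous_on_mult[OF f continuous_on_const]]
        fc_mult[OF h f continuous_on_id] fc_mult[OF h f continuous_on_const] fc_id[OF h] fc_const[OF h] ..
    moreover have "fc (\<lambda>t. ?f t * t + ?f t * (- \<epsilon>)) (emb x) = fc (\<lambda>t. ?f t * ?f t) (emb x)"
      by (rule fc_cong) (auto simp: max_def algebra_simps)
    ultimately show ?thesis by (simp add: G_def fc_mult[OF h f f] of_real_def)
  qed
  moreover have "pos (G * G)" using pos_square posD(1) \<open>pos G\<close> by blast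
  ultimately show ?thesis using that[of "uvec G"] G by simp
qed

section \<open>Cuntz comparison\<close>

text \<open>The conjugating elements are not tied to a fixed matrix size, which makes transitivity
  immediate; \<open>cuntz_below_iff\<close> restores the size by compression.\<close>

definition below :: "'a::local_cstar \<Rightarrow> 'a \<Rightarrow> bool" where
  "below x y \<longleftrightarrow> (\<forall>e>0. \<exists>z. norm (x - z * y * adj z) < e)"

lemma below_conj: "below (z * y * adj z) y"
  unfolding below_def by (intro allI impI exI[of _ z]) simp

lemma norm_conj_le: "norm (z * x * adj z) \<le> (norm z)\<^sup>2 * norm (x :: 'a::local_cstar)"
proof -
  have "norm (z * x * adj z) \<le> norm z * norm x * norm (adj z)"
    by (rule order_trans[OF norm_mult_ineq mult_right_mono[OF norm_mult_ineq]]) simp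
  then show ?thesis by (simp add: power2_eq_square mult_ac)
qed

lemma below_trans:
  assumes xy: "below x y" and yw: "below y w" shows "below x w"
  unfolding below_def
proof (intro allI impI)
  fix e :: real assume e: "e > 0"
  then have "e / 2 > 0" by simp
  then obtain z where z: "norm (x - z * y * adj z) < e / 2" using xy unfolding below_def by blast
  \<comment> \<open>The summand 1 allows division by K when z = 0.\<close>
  define K where "K = (norm z)\<^sup>2 + 1"
  have K: "K > 0" "(norm z)\<^sup>2 \<le> K" by (simp_all add: K_def add_nonneg_pos)
  define d where "d = e / 2 / K"
  have "d > 0" using e K by (simp add: d_def)
  then obtain u where u: "norm (y - u * w * adj u) < d" using yw unfolding below_def by blast
  have eq: "x - (z * u) * w * adj (z * u) = (x - z * y * adj z) + z * (y - u * w * adj u) * adj z"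
    by (simp add: adj_mult algebra_simps)
  have "norm (x - (z * u) * w * adj (z * u)) \<le> norm (x - z * y * adj z) + (norm z)\<^sup>2 * norm (y - u * w * adj u)"
    unfolding eq by (rule order_trans[OF norm_triangle_ineq add_left_mono[OF norm_conj_le]])
  also have "(norm z)\<^sup>2 * norm (y - u * w * adj u) \<le> K * d"
    using u K \<open>d > 0\<close> by (intro mult_mono) auto
  also have "\<dots> = e / 2" using K by (simp add: d_def)
  finally show "\<exists>z. norm (x - z * w * adj z) < e" using z by (intro exI[of _ "z * u"]) simp
qed

text \<open>The factor \<open>psqrt (emb g)\<close> has scalar part 0, so the whole conjugating
  element comes from the algebra.\<close>

lemma below_if_below_in_unitization:
  assumes g: "pos (emb g)"
    and w: "\<And>e. e > 0 \<Longrightarrow> \<exists>w. norm (emb g - (psqrt (emb g) * w) * emb c * adj (psqrt (emb g) * w)) < e"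
  shows "below g c"
  unfolding below_def
proof (intro allI impI)
  fix e :: real assume "e > 0"
  then obtain w where w: "norm (emb g - (psqrt (emb g) * w) * emb c * adj (psqrt (emb g) * w)) < e"
    using w by blast
  define z where "z = psqrt (emb g) * w"
  have "uscal z = 0" using uscal_psqrt[OF g] by (simp add: z_def)
  then have "emb (uvec z) = z" by (rule emb_uvec)
  then have "emb (g - uvec z * c * adj (uvec z)) = emb g - z * emb c * adj z" by (simp add: emb_simps)
  then have "norm (g - uvec z * c * adj (uvec z)) < e" using w by (metis norm_emb z_def)
  then show "\<exists>z. norm (g - z * c * adj z) < e" by blast
qed

text \<open>Without a unit to conjugate by, this is the case x \<le> x of
  \<open>cuntz_below_of_le\<close>.\<close>

lemma below_refl: "pos (emb x) \<Longrightarrow> below x x"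
  by (rule below_if_below_in_unitization) (auto intro!: cuntz_below_of_le)

lemma below_of_cut_le:
  assumes "pos (emb g)" "pos (emb c)" "emb g * emb h = emb h * emb g"
    "pos (emb g * emb h - \<epsilon> *\<^sub>R emb g)" "pos (emb c - (emb h - of_real \<delta>))" "\<delta> < \<epsilon>"
  shows "below g c"
  using assms by (intro below_if_below_in_unitization cuntz_below_of_cut_le) auto

text \<open>Cutting by the corner projection 1_n. For nonunital A that projection is not a matrix
  over A, hence the entrywise form.\<close>

definition compress :: "nat \<Rightarrow> 'a::cstar_algebra minf \<Rightarrow> 'a minf" where
  "compress n x = Mk (\<lambda>i j. if i < n \<and> j < n then mat_of x i j else 0)"

lemma compress_Mat: "mat_of (compress n x) \<in> Mat n"
  and mat_compress: "mat_of (compress n x) = (\<lambda>i j. if i < n \<and> j < n then mat_of x i j else 0)"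
proof -
  have "(\<lambda>i j. if i < n \<and> j < n then mat_of x i j else 0) \<in> Mat n" by (auto simp: Mat_def)
  then show "mat_of (compress n x) = (\<lambda>i j. if i < n \<and> j < n then mat_of x i j else 0)" "mat_of (compress n x) \<in> Mat n"
    by (simp_all add: compress_def Mk_inverse Mat_infI)
qed

lemma norm_compress_le: "norm (compress n x) \<le> norm x"
proof -
  obtain k where k: "mat_of x \<in> Mat k" by (rule mat_in_Mat)
  define m where "m = max n k"
  have m: "n \<le> m" and xm: "mat_of x \<in> Mat m" using k by (auto simp: m_def intro: Mat_mono)
  show ?thesis unfolding norm_minf_def
  proof (rule mat_norm_le[OF compress_Mat])
    fix v :: "nat \<Rightarrow> 'a"
    let ?v = "\<lambda>i. if i < n then v i else 0"
    have "mat_vec (mat_of (compress n x)) v i = mat_vec (mat_of x) ?v i" if "i < n" for i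
    proof -
      have "mat_vec (mat_of x) ?v i = (\<Sum>j<n. mat_of x i j * ?v j)"
        unfolding mat_vec_eq[OF xm] using m by (intro sum.mono_neutral_right) auto
      then show ?thesis using that by (subst mat_vec_eq[OF compress_Mat]) (simp add: mat_compress)
    qed
    then have "cnorm n (mat_vec (mat_of (compress n x)) v) = cnorm n (mat_vec (mat_of x) ?v)"
      by (simp add: cnorm_def ip_def)
    also have "\<dots> \<le> cnorm m (mat_vec (mat_of x) ?v)" by (rule cnorm_mono[OF m])
    also have "\<dots> \<le> mat_norm (mat_of x) * cnorm m ?v" by (rule cnorm_mat_vec[OF xm])
    also have "cnorm m ?v = cnorm n v"
    proof -
      have "ip m ?v ?v = ip n v v" unfolding ip_def using m
        by (subst sum.mono_neutral_right[of "{..<m}" "{..<n}"]) auto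
      then show ?thesis by (simp add: cnorm_def)
    qed
    finally show "cnorm n (mat_vec (mat_of (compress n x)) v) \<le> mat_norm (mat_of x) * cnorm n v" .
  qed (rule mat_norm_nonneg[OF xm])
qed

lemma mat_mult_eq_right:
  assumes x: "x \<in> Mat_inf" and y: "y \<in> Mat n" shows "mat_mult x y i j = (\<Sum>k<n. x i k * y k j)"
proof -
  obtain l where "x \<in> Mat l" using x by (rule Mat_infE)
  then have "x \<in> Mat (max n l)" by (rule Mat_mono) simp
  then have "mat_mult x y i j = (\<Sum>k<max n l. x i k * y k j)" by (rule mat_mult_eq)
  also have "\<dots> = (\<Sum>k<n. x i k * y k j)"
    using y by (intro sum.mono_neutral_right) (auto simp: Mat_def)
  finally show ?thesis .
qed

lemma mat_conj_eq:
  assumes "mat_of y \<in> Mat n"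
  shows "mat_of (z * y * adj w) i j = (\<Sum>l<n. (\<Sum>k<n. mat_of z i k * mat_of y k l) * star (mat_of w j l))"
proof -
  obtain m where m: "mat_of (z * y) \<in> Mat m" by (rule mat_in_Mat)
  have e: "mat_of (z * y) i l = (\<Sum>k<n. mat_of z i k * mat_of y k l)" for i l
    unfolding mat_times by (rule mat_mult_eq_right[OF mat_of assms])
  have M: "mat_of (z * y) \<in> Mat (max n m)" using m by (rule Mat_mono) simp
  have Z: "mat_of (z * y) i l = 0" if "n \<le> l" for i l using assms that by (simp add: e Mat_def)
  have "mat_of (z * y * adj w) i j = (\<Sum>l<n. mat_of (z * y) i l * mat_of (adj w) l j)"
    unfolding mat_times[of "z * y"] by (subst mat_mult_eq[OF M], rule sum.mono_neutral_right) (auto simp: Z)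
  then show ?thesis by (simp add: e mat_adj mat_star_def)
qed

text \<open>As y sits in the corner, columns of z beyond n never meet it, and rows of z beyond n
  only affect entries outside the corner.\<close>

lemma compress_conj:
  assumes "mat_of x \<in> Mat n" "mat_of y \<in> Mat n"
  shows "x - compress n z * y * adj (compress n z) = compress n (x - z * y * adj z)"
proof (rule minf_eqI, intro ext)
  fix i j
  have "mat_of (compress n z * y * adj (compress n z)) i j = (if i < n \<and> j < n then mat_of (z * y * adj z) i j else 0)"
    by (auto simp: mat_conj_eq[OF assms(2)] mat_compress intro!: sum.cong)
  then show "mat_of (x - compress n z * y * adj (compress n z)) i j = mat_of (compress n (x - z * y * adj z)) i j"
    using assms(1) by (auto simp: mat_compress mat_minus Mat_def)
qed

lemma cuntz_below_iff: "cuntz_below (mat_of x) (mat_of y) \<longleftrightarrow> below x y"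
proof
  assume "cuntz_below (mat_of x) (mat_of y)"
  then obtain n z where z: "\<And>k. z k \<in> Mat n"
    and lim: "mat_lim (\<lambda>k. mat_mult (mat_mult (z k) (mat_of y)) (mat_star (z k))) (mat_of x)"
    unfolding cuntz_below_def by blast
  have "mat_of (Mk (z k)) = z k" for k by (simp add: Mk_inverse Mat_infI[OF z])
  then have "(\<lambda>k. mat_mult (mat_mult (z k) (mat_of y)) (mat_star (z k))) = (\<lambda>k. mat_of (Mk (z k) * y * adj (Mk (z k))))"
    by (simp add: mat_simps)
  then have lim: "(\<lambda>k. Mk (z k) * y * adj (Mk (z k))) \<longlonglongrightarrow> x" using lim by (simp only: mat_lim_iff)
  show "below x y" unfolding below_def
  proof (intro allI impI)
    fix e :: real assume "e > 0"
    then obtain k where "norm (Mk (z k) * y * adj (Mk (z k)) - x) < e" using LIMSEQ_D[OF lim] by blast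
    then show "\<exists>z. norm (x - z * y * adj z) < e" by (subst (asm) norm_minus_commute) blast
  qed
next
  assume b: "below x y"
  obtain n where n: "mat_of x \<in> Mat n" "mat_of y \<in> Mat n" by (rule mat_in_Mat2)
  have "\<exists>z. mat_of z \<in> Mat n \<and> norm (x - z * y * adj z) < 1 / real (Suc k)" for k
  proof -
    obtain z where z: "norm (x - z * y * adj z) < 1 / real (Suc k)"
      using b unfolding below_def by (meson of_nat_0_less_iff zero_less_Suc zero_less_divide_1_iff)
    have "norm (x - compress n z * y * adj (compress n z)) < 1 / real (Suc k)"
      unfolding compress_conj[OF n] using norm_compress_le z by (rule le_less_trans)
    then show ?thesis using compress_Mat by blast
  qed
  then have "\<forall>k. \<exists>z. mat_of z \<in> Mat n \<and> norm (x - z * y * adj z) < 1 / real (Suc k)" by blast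
  from choice[OF this] obtain z where z: "\<And>k. mat_of (z k) \<in> Mat n"
    "\<And>k. norm (x - z k * y * adj (z k)) < 1 / real (Suc k)" by blast
  have "(\<lambda>k. norm (z k * y * adj (z k) - x)) \<longlonglongrightarrow> 0"
  proof (rule tendsto_sandwich[OF _ _ tendsto_const LIMSEQ_inverse_real_of_nat])
    show "\<forall>\<^sub>F k in sequentially. norm (z k * y * adj (z k) - x) \<le> inverse (real (Suc k))"
      using z(2) by (intro always_eventually allI less_imp_le)
        (simp add: norm_minus_commute inverse_eq_divide)
  qed simp
  then have "(\<lambda>k. z k * y * adj (z k)) \<longlonglongrightarrow> x" by (simp only: tendsto_norm_zero_iff LIM_zero_iff)
  then have "mat_lim (\<lambda>k. mat_of (z k * y * adj (z k))) (mat_of x)" by (simp only: mat_lim_iff)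
  then show "cuntz_below (mat_of x) (mat_of y)"
    unfolding cuntz_below_def using n z(1)
    by (intro exI[of _ n] exI[of _ "\<lambda>k. mat_of (z k)"] conjI) (simp_all add: mat_simps)
qed

lemma mat_in_cuntz_class: "pos (emb x) \<Longrightarrow> mat_of x \<in> cuntz_class (mat_of x)"
  by (simp add: cuntz_class_def cuntz_rel_def Mat_pos_iff cuntz_below_iff below_refl)

text \<open>The order on classes only provides some pair of representatives; transitivity carries
  the comparison back to x and y.\<close>

lemma cuntz_le_imp_below:
  assumes "cuntz_le (cuntz_class (mat_of x)) (cuntz_class (mat_of y))" shows "below x y"
proof -
  obtain u v where uv: "(mat_of x, u) \<in> cuntz_rel" "(mat_of y, v) \<in> cuntz_rel" "cuntz_below u v"
    using assms unfolding cuntz_le_def cuntz_class_def by blast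
  then have "u \<in> Mat_inf" "v \<in> Mat_inf" by (auto simp: cuntz_rel_def Mat_pos_def)
  then obtain u' v' where "u = mat_of u'" "v = mat_of v'" by (metis Mk_inverse)
  then have "below x u'" "below u' v'" "below v' y" using uv by (auto simp: cuntz_rel_def cuntz_below_iff)
  then show ?thesis using below_trans by blast
qed

section \<open>Direct sums\<close>

definition dsum :: "nat \<Rightarrow> 'a::cstar_algebra minf \<Rightarrow> 'a minf \<Rightarrow> 'a minf" where
  "dsum n x y = Mk (mat_dsum n (mat_of x) (mat_of y))"

lemma mat_dsum_Mat: "y \<in> Mat m \<Longrightarrow> mat_dsum n x y \<in> Mat (n + m)"
  by (auto simp: Mat_def mat_dsum_def)

lemma mat_dsum: "mat_of (dsum n x y) = mat_dsum n (mat_of x) (mat_of y)"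
proof -
  obtain m where "mat_of y \<in> Mat m" by (rule mat_in_Mat)
  then show ?thesis by (simp add: dsum_def Mk_inverse Mat_infI[OF mat_dsum_Mat])
qed

lemma sum_lessThan_add: "(\<Sum>k<n + m. f k) = (\<Sum>k<n. f k) + (\<Sum>k<m. f (n + k :: nat))"
  for f :: "nat \<Rightarrow> 'b::comm_monoid_add"
  by (induction m) (auto simp: add_ac)

lemma dsum_mult:
  assumes s: "mat_of s \<in> Mat n" shows "dsum n s t * dsum n u v = dsum n (s * u) (t * v)"
proof (rule minf_eqI, intro ext)
  fix i j
  obtain m where t: "mat_of t \<in> Mat m" by (rule mat_in_Mat)
  show "mat_of (dsum n s t * dsum n u v) i j = mat_of (dsum n (s * u) (t * v)) i j"
    unfolding mat_times mat_dsum mat_mult_eq[OF mat_dsum_Mat[OF t]] sum_lessThan_add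
    by (auto simp: mat_dsum_def mat_times mat_mult_eq[OF s] mat_mult_eq[OF t])
qed

lemma dsum_adj: "adj (dsum n s t) = dsum n (adj s) (adj t)"
  by (rule minf_eqI, intro ext) (simp add: mat_adj mat_dsum mat_star_def mat_dsum_def)

lemma psqrt_emb:
  assumes "pos (emb x)" obtains s where "adj s = s" "s * s = x"
proof -
  have u: "emb (uvec (psqrt (emb x))) = psqrt (emb x)" using uscal_psqrt[OF assms] by (intro emb_uvec) simp
  have "emb (adj (uvec (psqrt (emb x)))) = emb (uvec (psqrt (emb x)))"
    by (simp only: emb_simps u adj_psqrt[OF assms])
  moreover have "emb (uvec (psqrt (emb x)) * uvec (psqrt (emb x))) = emb x"
    by (simp only: emb_simps u psqrt_mult_self[OF assms])
  ultimately show ?thesis using that by simp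
qed

lemma pos_emb_adj_mult: "pos (emb (adj x * x))"
  using pos_adj_mult[of "emb x"] by (simp add: emb_simps)

text \<open>If b = s^2 and d = t^2, the direct sum is (s \<oplus> t)* (s \<oplus> t). The size n has
  to fit s as well as b.\<close>

lemma dsum_pos:
  assumes b: "pos (emb b)" and d: "pos (emb d)"
  obtains n where "mat_of b \<in> Mat n" "pos (emb (dsum n b d))"
proof -
  obtain s where s: "adj s = s" "s * s = b" using psqrt_emb[OF b] .
  obtain t where t: "adj t = t" "t * t = d" using psqrt_emb[OF d] .
  obtain n where n: "mat_of b \<in> Mat n" "mat_of s \<in> Mat n" by (rule mat_in_Mat2)
  have "dsum n b d = adj (dsum n s t) * dsum n s t"
    by (simp add: dsum_adj dsum_mult[OF n(2)] s t)
  then show ?thesis using that[OF n(1)] pos_emb_adj_mult by metis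
qed

text \<open>The witness is the block row (z u), with u moved past the first n columns. It turns a
  sum of conjugates into one conjugate of a direct sum.\<close>

lemma dsum_conj:
  assumes b: "mat_of b \<in> Mat n"
  shows "\<exists>w. z * b * adj z + u * d * adj u = w * dsum n b d * adj w"
proof -
  obtain m where d: "mat_of d \<in> Mat m" by (rule mat_in_Mat)
  obtain l where l: "mat_of z \<in> Mat l" "mat_of u \<in> Mat l" by (rule mat_in_Mat2)
  define W where "W = (\<lambda>i j. if j < n then mat_of z i j else mat_of u i (j - n))"
  have "W \<in> Mat (n + l)" using l by (auto simp: W_def Mat_def)
  then have W: "mat_of (Mk W) = W" by (simp add: Mk_inverse Mat_infI)
  have D: "mat_of (dsum n b d) \<in> Mat (n + m)" unfolding mat_dsum by (rule mat_dsum_Mat[OF d])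
  have "z * b * adj z + u * d * adj u = Mk W * dsum n b d * adj (Mk W)"
  proof (rule minf_eqI, intro ext)
    fix i j
    show "mat_of (z * b * adj z + u * d * adj u) i j = mat_of (Mk W * dsum n b d * adj (Mk W)) i j"
      unfolding mat_plus plus_fun_apply mat_conj_eq[OF b] mat_conj_eq[OF d] mat_conj_eq[OF D] W mat_dsum sum_lessThan_add
      by (simp add: W_def mat_dsum_def)
  qed
  then show ?thesis by blast
qed

section \<open>Sums of conjugates and sums of two-sided products\<close>

inductive_set conj_sums :: "'a::local_cstar set \<Rightarrow> 'a set" for Q where
  conj_sums_0: "0 \<in> conj_sums Q"
| conj_sums_add: "d \<in> Q \<Longrightarrow> c \<in> conj_sums Q \<Longrightarrow> z * d * adj z + c \<in> conj_sums Q"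

lemma conj_sums_pos:
  assumes "\<And>d. d \<in> Q \<Longrightarrow> pos (emb d)" "c \<in> conj_sums Q" shows "pos (emb c)"
  using assms(2)
proof induction
  case conj_sums_0
  then show ?case by (simp add: emb_simps)
next
  case (conj_sums_add d c z)
  have "pos (adj (adj (emb z)) * emb d * adj (emb z))" by (intro pos_conj assms conj_sums_add)
  then show ?case using conj_sums_add pos_add by (simp add: emb_simps)
qed

text \<open>The algebraic ideal without the elements of Q themselves: in the absence of a unit such
  an element need not have this form. Scalars are absorbed in the left factor.\<close>

inductive_set two_sided :: "'a::local_cstar set \<Rightarrow> 'a set" for Q where
  two_sided_0: "0 \<in> two_sided Q"
| two_sided_add: "d \<in> Q \<Longrightarrow> x \<in> two_sided Q \<Longrightarrow> r * d * y + x \<in> two_sided Q"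

lemma two_sided_plus:
  assumes "x \<in> two_sided Q" "y \<in> two_sided Q" shows "x + y \<in> two_sided Q"
  using assms(1) by induction (auto simp: assms(2) add.assoc intro: two_sided_add)

lemma two_sided_mult_left: "x \<in> two_sided Q \<Longrightarrow> a * x \<in> two_sided Q"
proof (induction rule: two_sided.induct)
  case (two_sided_add d x r y)
  then have "(a * r) * d * y + a * x \<in> two_sided Q" by (intro two_sided.two_sided_add)
  then show ?case by (simp add: distrib_left mult.assoc)
qed (simp add: two_sided_0)

lemma two_sided_mult_right: "x \<in> two_sided Q \<Longrightarrow> x * a \<in> two_sided Q"
proof (induction rule: two_sided.induct)
  case (two_sided_add d x r y)
  then have "r * d * (y * a) + x * a \<in> two_sided Q" by (intro two_sided.two_sided_add)
  then show ?case by (simp add: distrib_right mult.assoc)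
qed (simp add: two_sided_0)

lemma two_sided_cscale: "x \<in> two_sided Q \<Longrightarrow> c *\<^sub>C x \<in> two_sided Q"
proof (induction rule: two_sided.induct)
  case (two_sided_add d x r y)
  then have "(c *\<^sub>C r) * d * y + c *\<^sub>C x \<in> two_sided Q" by (intro two_sided.two_sided_add)
  then show ?case by (simp add: cscale_add_right)
qed (simp add: two_sided_0)

lemma two_sided_le_conj_sums:
  assumes Q: "\<And>d. d \<in> Q \<Longrightarrow> pos (emb d)" and w: "w \<in> two_sided Q"
  shows "\<exists>c\<in>conj_sums Q. pos (emb (c - (w + adj w)))"
  using w
proof induction
  case two_sided_0
  then show ?case by (intro bexI[of _ 0]) (auto simp: emb_simps intro: conj_sums_0)
next
  case (two_sided_add d x r y)
  then obtain c where c: "c \<in> conj_sums Q" "pos (emb (c - (x + adj x)))" by blast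
  define c' where "c' = r * d * adj r + (adj y * d * adj (adj y) + c)"
  have "c' \<in> conj_sums Q" unfolding c'_def by (intro conj_sums_add two_sided_add c)
  moreover have "pos (emb (r * d * adj r + adj y * d * y - (r * d * y + adj (r * d * y))) + emb (c - (x + adj x)))"
    using pos_add[OF pos_polarization[OF Q[OF two_sided_add(1)], of "emb r" "emb y"] c(2)]
    by (simp add: emb_simps)
  then have "pos (emb (c' - (r * d * y + x + adj (r * d * y + x))))"
    by (simp add: c'_def adj_add algebra_simps flip: emb_simps)
  ultimately show ?case by blast
qed

text \<open>Approximate h by w up to \<epsilon>/2. As h is self-adjoint, the real part of w is
  equally close, so h - \<epsilon>/2 is at most this real part, which is dominated by a sum of
  conjugates c. The remaining \<epsilon>/2 is the gap required by
  \<open>below_of_cut_le\<close>.\<close>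

lemma below_conj_sum:
  assumes Q: "\<And>d. d \<in> Q \<Longrightarrow> pos (emb d)" and h: "pos (emb h)" and hQ: "h \<in> closure (two_sided Q)"
    and g: "pos (emb g)" "emb g * emb h = emb h * emb g" "pos (emb g * emb h - \<epsilon> *\<^sub>R emb g)" and e: "\<epsilon> > 0"
  shows "\<exists>c\<in>conj_sums Q. below g c"
proof -
  obtain w where w: "w \<in> two_sided Q" "dist w h < \<epsilon> / 2"
    using hQ e unfolding closure_approachable by (meson half_gt_zero)
  \<comment> \<open>The factor 1/2 makes v + adj v the real part of w.\<close>
  define v where "v = complex_of_real (1/2) *\<^sub>C w"
  have v: "v \<in> two_sided Q" unfolding v_def by (rule two_sided_cscale[OF w(1)])
  obtain c where c: "c \<in> conj_sums Q" "pos (emb (c - (v + adj v)))"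
    using two_sided_le_conj_sums[OF Q v] by blast
  have sa: "adj h = h"
  proof -
    have "emb (adj h) = emb h" using posD(1)[OF h] by (simp only: emb_simps)
    then show ?thesis by simp
  qed
  define k where "k = (1/2) *\<^sub>R (h - w)"
  have vk: "h - (v + adj v) = k + adj k"
    by (simp add: k_def v_def scaleR_cscale adj_simps sa cscale_diff_right algebra_simps flip: cscale_add_left)
  have "norm (k + adj k) \<le> norm k + norm (adj k)" by (rule norm_triangle_ineq)
  also have "\<dots> = norm (h - w)" by (simp add: k_def)
  also have "\<dots> \<le> \<epsilon> / 2" using w(2) by (simp add: dist_norm norm_minus_commute)
  finally have "norm (emb (k + adj k)) \<le> \<epsilon> / 2" by simp
  moreover have "adj (emb (k + adj k)) = emb (k + adj k)" by (simp add: adj_add add.commute flip: emb_simps)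
  ultimately have "pos (of_real (\<epsilon> / 2) - emb (k + adj k))" by (intro pos_of_real_diff)
  from pos_add[OF c(2) this] have "pos (emb c - (emb h - of_real (\<epsilon> / 2)))"
    by (simp add: vk[symmetric] emb_simps algebra_simps)
  then have "below g c"
    using g e conj_sums_pos[OF Q c(1)] by (intro below_of_cut_le[where h = h and \<epsilon> = \<epsilon> and \<delta> = "\<epsilon> / 2"]) auto
  then show ?thesis using c(1) by blast
qed

text \<open>A relation rather than a function, since the block size n is chosen anew at each step;
  every choice represents the same multiple of the class of b.\<close>

inductive multiple_of :: "'a::cstar_algebra minf \<Rightarrow> nat \<Rightarrow> 'a minf \<Rightarrow> bool" for b where
  multiple_of_0: "multiple_of b 0 0"
| multiple_of_Suc: "multiple_of b m D \<Longrightarrow> mat_of b \<in> Mat n \<Longrightarrow> pos (emb (dsum n b D)) \<Longrightarrow>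
    multiple_of b (Suc m) (dsum n b D)"

lemma multiple_of_pos: "multiple_of b m D \<Longrightarrow> pos (emb D)"
  by (induction rule: multiple_of.induct) (auto simp: emb_simps)

lemma mat_multiple_of:
  assumes b: "pos (emb b)" and D: "multiple_of b m D"
  shows "mat_of D \<in> cuntz_multiple m (cuntz_class (mat_of b))"
  using D
proof induction
  case multiple_of_0
  have "mat_of (0::'a minf) \<in> cuntz_class (mat_of 0)" by (intro mat_in_cuntz_class) (simp add: emb_simps)
  then show ?case unfolding cuntz_multiple_def by (simp only: mat_zero funpow_0)
next
  case (multiple_of_Suc m D n)
  have "mat_of (dsum n b D) \<in> cuntz_class (mat_dsum n (mat_of b) (mat_of D))"
    using mat_in_cuntz_class[OF multiple_of_Suc(3)] by (simp add: mat_dsum)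
  then have "mat_of (dsum n b D) \<in> cuntz_add (cuntz_class (mat_of b)) (cuntz_multiple m (cuntz_class (mat_of b)))"
    unfolding cuntz_add_def using mat_in_cuntz_class[OF b] multiple_of_Suc by blast
  then show ?case by (simp add: cuntz_multiple_def)
qed

lemma multiple_of_add:
  assumes b: "pos (emb b)" and D: "multiple_of b m D"
  shows "\<exists>D' w. multiple_of b (Suc m) D' \<and> z * b * adj z + u * D * adj u = w * D' * adj w"
proof -
  obtain n where n: "mat_of b \<in> Mat n" "pos (emb (dsum n b D))" using dsum_pos[OF b multiple_of_pos[OF D]] .
  then show ?thesis using multiple_of_Suc[OF D n] dsum_conj[OF n(1)] by blast
qed

text \<open>Each summand contributes one more copy of b, so m counts the summands.\<close>

lemma conj_sums_multiple:
  assumes b: "pos (emb b)" and c: "c \<in> conj_sums {b}"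
  shows "\<exists>m D z. multiple_of b m D \<and> c = z * D * adj z"
  using c
proof induction
  case conj_sums_0
  have "multiple_of b 0 0 \<and> 0 = 0 * 0 * adj (0::'a minf)" by (simp add: multiple_of_0)
  then show ?case by blast
next
  case (conj_sums_add d c z)
  then obtain m D u where D: "multiple_of b m D" "c = u * D * adj u" by blast
  then show ?case using multiple_of_add[OF b D(1), of z u] conj_sums_add(1) by blast
qed

text \<open>Further copies of b are conjugated by 0. This makes a common m possible for b_1 and
  b_2.\<close>

lemma multiple_of_increase:
  assumes b: "pos (emb b)" and D: "multiple_of b m D" "c = z * D * adj z" and mk: "m \<le> k"
  shows "\<exists>D z. multiple_of b k D \<and> c = z * D * adj z"
  using mk
proof (induction k rule: dec_induct)
  case base
  then show ?case using D by blast
next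
  case (step k)
  then obtain D z where "multiple_of b k D" "c = z * D * adj z" by blast
  then show ?case using multiple_of_add[OF b, of k D 0 z] by simp
qed

section \<open>Ideals\<close>

lemma closed_ideal_ideal_generated: "closed_ideal (ideal_generated S)"
  unfolding ideal_generated_def closed_ideal_def by (auto intro!: closed_Inter)

lemma closed_ideal_Int: "closed_ideal I \<Longrightarrow> closed_ideal J \<Longrightarrow> closed_ideal (I \<inter> J)"
  unfolding closed_ideal_def by (auto intro!: closed_Int)

lemma ideal_generated_subset: "closed_ideal I \<Longrightarrow> S \<subseteq> I \<Longrightarrow> ideal_generated S \<subseteq> I"
  by (auto simp: ideal_generated_def)

lemma subset_ideal_generated: "S \<subseteq> ideal_generated S"
  by (auto simp: ideal_generated_def)

lemma closed_ideal_sum: "closed_ideal I \<Longrightarrow> (\<And>k. k \<in> A \<Longrightarrow> f k \<in> I) \<Longrightarrow> sum f A \<in> I"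
  by (induction A rule: infinite_finite_induct) (auto simp: closed_ideal_def)

text \<open>Ideals live in A; that a matrix lies over an ideal is expressed through its
  entries.\<close>

definition entries :: "'a::cstar_algebra minf \<Rightarrow> 'a set" where
  "entries x = {mat_of x i j | i j. True}"

lemma entries_conj:
  assumes I: "closed_ideal I" and y: "entries y \<subseteq> I" shows "entries (z * y * adj z) \<subseteq> I"
proof -
  obtain n where n: "mat_of y \<in> Mat n" by (rule mat_in_Mat)
  have "mat_of y k l \<in> I" for k l using y by (auto simp: entries_def)
  then have "a * mat_of y k l \<in> I" for a k l using I by (simp add: closed_ideal_def)
  then have "(\<Sum>k<n. f k * mat_of y k l) \<in> I" for f l by (intro closed_ideal_sum[OF I])
  then have "(\<Sum>k<n. f k * mat_of y k l) * a \<in> I" for f l a using I by (simp add: closed_ideal_def)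
  then show ?thesis
    by (auto simp: entries_def mat_conj_eq[OF n] intro!: closed_ideal_sum[OF I])
qed

text \<open>Entries of z y z* lie in the ideal, they converge to those of x because the norm
  controls entries, and the ideal is closed.\<close>

lemma entries_below:
  assumes I: "closed_ideal I" and y: "entries y \<subseteq> I" and xy: "below x y" shows "entries x \<subseteq> I"
proof
  fix a assume "a \<in> entries x"
  then obtain i j where a: "a = mat_of x i j" by (auto simp: entries_def)
  have "\<exists>b\<in>I. dist b a < e" if "e > 0" for e
  proof -
    obtain z where z: "norm (x - z * y * adj z) < e" using xy \<open>e > 0\<close> unfolding below_def by blast
    have "mat_of (z * y * adj z) i j \<in> I" using entries_conj[OF I y] by (auto simp: entries_def)
    moreover have "dist (mat_of (z * y * adj z) i j) a < e"
      using norm_mat_entry_le[of "x - z * y * adj z" i j] z by (simp add: a dist_norm norm_minus_commute mat_minus)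
    ultimately show ?thesis by blast
  qed
  then have "a \<in> closure I" by (simp add: closure_approachable)
  then show "a \<in> I" using I by (simp add: closed_ideal_def)
qed

section \<open>Matrix units with coefficients\<close>

definition unit_mat :: "nat \<Rightarrow> nat \<Rightarrow> 'a::cstar_algebra \<Rightarrow> 'a minf" where
  "unit_mat i j a = Mk (\<lambda>k l. if k = i \<and> l = j then a else 0)"

lemma mat_unit_mat: "mat_of (unit_mat i j a) = (\<lambda>k l. if k = i \<and> l = j then a else 0)"
proof -
  have "(\<lambda>k l. if k = i \<and> l = j then a else 0) \<in> Mat (Suc (max i j))" by (auto simp: Mat_def)
  then show ?thesis by (simp add: unit_mat_def Mk_inverse Mat_infI)
qed

lemma unit_mat_Mat: "i < n \<Longrightarrow> j < n \<Longrightarrow> mat_of (unit_mat i j a) \<in> Mat n"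
  by (auto simp: Mat_def mat_unit_mat)

lemma norm_unit_mat_le: "norm (unit_mat i j a) \<le> norm a"
proof -
  let ?n = "Suc (max i j)"
  have "norm (unit_mat i j a) \<le> mat_size ?n (mat_of (unit_mat i j a))"
    unfolding norm_minf_def by (intro mat_norm_le_size unit_mat_Mat) auto
  also have "\<dots> = (\<Sum>k<?n. \<Sum>l<?n. if k = i \<and> l = j then norm a else 0)"
    unfolding mat_size_def mat_unit_mat by (intro sum.cong refl) auto
  also have "\<dots> = (\<Sum>k<?n. if k = i then norm a else 0)"
    by (intro sum.cong refl) (auto simp: sum.delta)
  also have "\<dots> = norm a" by (subst sum.delta) auto
  finally show ?thesis .
qed

lemma unit_mat_add: "unit_mat i j (a + b) = unit_mat i j a + unit_mat i j b"
  and unit_mat_diff: "unit_mat i j (a - b) = unit_mat i j a - unit_mat i j b"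
  and unit_mat_scaleC: "unit_mat i j (scaleC c a) = c *\<^sub>C unit_mat i j a"
  and unit_mat_star: "adj (unit_mat i j a) = unit_mat j i (star a)"
  and unit_mat_0: "unit_mat i j 0 = 0"
  by (rule minf_eqI; intro ext; auto simp: mat_simps mat_unit_mat mat_scaleC_def mat_star_def)+

lemma unit_mat_mult: "unit_mat i k a * unit_mat k j b = unit_mat i j (a * b)"
proof (rule minf_eqI, intro ext)
  fix r s
  obtain m where m: "i < m" "k < m" using less_Suc_eq_le max.cobounded1 max.cobounded2 by metis
  have "mat_of (unit_mat i k a * unit_mat k j b) r s =
      (\<Sum>l<m. if l = k then mat_of (unit_mat i k a) r l * mat_of (unit_mat k j b) l s else 0)"
    unfolding mat_times
    by (subst mat_mult_eq[OF unit_mat_Mat[OF m]], rule sum.cong) (auto simp: mat_unit_mat)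
  also have "\<dots> = mat_of (unit_mat i j (a * b)) r s"
    by (subst sum.delta) (use m in \<open>auto simp: mat_unit_mat\<close>)
  finally show "mat_of (unit_mat i k a * unit_mat k j b) r s = mat_of (unit_mat i j (a * b)) r s" .
qed

lemma closure_two_sided:
  fixes Q :: "'a::local_cstar set"
  shows "x \<in> closure (two_sided Q) \<Longrightarrow> y \<in> closure (two_sided Q) \<Longrightarrow> x + y \<in> closure (two_sided Q)"
    and "x \<in> closure (two_sided Q) \<Longrightarrow> a * x \<in> closure (two_sided Q)"
    and "x \<in> closure (two_sided Q) \<Longrightarrow> x * a \<in> closure (two_sided Q)"
    and "x \<in> closure (two_sided Q) \<Longrightarrow> c *\<^sub>C x \<in> closure (two_sided Q)"
proof -
  let ?T = "two_sided Q"
  have image: "f x \<in> closure ?T" if f: "bounded_linear f" "\<And>y. y \<in> ?T \<Longrightarrow> f y \<in> ?T" and x: "x \<in> closure ?T" for f x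
  proof -
    have "f ` closure ?T \<subseteq> closure ?T"
      by (rule image_closure_subset) (use f closure_subset in \<open>auto intro: linear_continuous_on\<close>)
    then show ?thesis using x by blast
  qed
  show "x \<in> closure ?T \<Longrightarrow> a * x \<in> closure ?T"
    by (rule image[OF bounded_linear_mult_right two_sided_mult_left])
  show "x \<in> closure ?T \<Longrightarrow> x * a \<in> closure ?T"
    by (rule image[OF bounded_linear_mult_left two_sided_mult_right])
  show "x \<in> closure ?T \<Longrightarrow> c *\<^sub>C x \<in> closure ?T"
    by (rule image[OF bounded_linear_cscale two_sided_cscale])
  assume "x \<in> closure ?T" "y \<in> closure ?T"
  then obtain u v where uv: "\<And>n. u n \<in> ?T" "u \<longlonglongrightarrow> x" "\<And>n. v n \<in> ?T" "v \<longlonglongrightarrow> y"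
    unfolding closure_sequential by blast
  have "(\<lambda>n. u n + v n) \<longlonglongrightarrow> x + y" by (intro tendsto_add uv)
  moreover have "\<forall>n. u n + v n \<in> ?T" using uv two_sided_plus by blast
  ultimately show "x + y \<in> closure ?T"
    unfolding closure_sequential by (intro exI[of _ "\<lambda>n. u n + v n"] conjI)
qed

lemma closure_two_sided_sum:
  "(\<And>k. k \<in> A \<Longrightarrow> f k \<in> closure (two_sided Q)) \<Longrightarrow> sum f A \<in> closure (two_sided Q)"
  using closure_subset[of "two_sided Q"] two_sided_0[of Q]
  by (induction A rule: infinite_finite_induct) (auto intro: closure_two_sided(1))

lemma mat_sum_apply: "mat_of (sum f A) r s = (\<Sum>i\<in>A. mat_of (f i) r s)"
  by (induction A rule: infinite_finite_induct) (auto simp: mat_simps)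

lemma minf_sum_unit_mat:
  assumes "mat_of x \<in> Mat n" shows "x = (\<Sum>i<n. \<Sum>j<n. unit_mat i j (mat_of x i j))"
proof (rule minf_eqI, intro ext)
  fix r s
  have "mat_of (\<Sum>i<n. \<Sum>j<n. unit_mat i j (mat_of x i j)) r s = (\<Sum>i<n. \<Sum>j<n. if r = i \<and> s = j then mat_of x i j else 0)"
    by (simp add: mat_sum_apply mat_unit_mat)
  also have "\<dots> = (\<Sum>i<n. if i = r then (if s < n then mat_of x i s else 0) else 0)"
    by (intro sum.cong refl) (auto simp: sum.delta')
  also have "\<dots> = mat_of x r s" using assms by (subst sum.delta) (auto simp: Mat_def)
  finally show "mat_of x r s = mat_of (\<Sum>i<n. \<Sum>j<n. unit_mat i j (mat_of x i j)) r s" by simp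
qed

text \<open>The coefficients a for which all matrices \<open>unit_mat i j a\<close> lie in the
  closure form a closed ideal of A, because multiplication in A is realized by products of matrix
  units. It contains S, hence all entries of x, and x is the sum of its entries placed in
  position.\<close>

lemma in_closure_two_sided_of_entries:
  assumes S: "\<And>s i j. s \<in> S \<Longrightarrow> unit_mat i j s \<in> closure (two_sided Q)"
    and x: "entries x \<subseteq> ideal_generated S"
  shows "x \<in> closure (two_sided Q)"
proof -
  let ?T = "closure (two_sided Q)"
  define K where "K = {a. \<forall>i j. unit_mat i j a \<in> ?T}"
  have "closed_ideal K" unfolding closed_ideal_def
  proof (intro conjI ballI allI)
    show "0 \<in> K" using closure_subset two_sided_0 by (auto simp: K_def unit_mat_0)
    show "a + b \<in> K" if "a \<in> K" "b \<in> K" for a b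
      using that by (auto simp: K_def unit_mat_add intro: closure_two_sided)
    show "scaleC c a \<in> K" if "a \<in> K" for c a
      using that by (auto simp: K_def unit_mat_scaleC intro: closure_two_sided)
    show "b * a \<in> K" if "a \<in> K" for a b
      using that unfolding K_def unit_mat_mult[where k = i for i, symmetric]
    proof (intro CollectI allI)
      fix i j
      have "unit_mat i i b * unit_mat i j a \<in> ?T" using that by (intro closure_two_sided) (simp add: K_def)
      then show "unit_mat i j (b * a) \<in> ?T" by (simp add: unit_mat_mult)
    qed
    show "a * b \<in> K" if "a \<in> K" for a b
      unfolding K_def
    proof (intro CollectI allI)
      fix i j
      have "unit_mat i j a * unit_mat j j b \<in> ?T" using that by (intro closure_two_sided) (simp add: K_def)
      then show "unit_mat i j (a * b) \<in> ?T" by (simp add: unit_mat_mult)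
    qed
    have "closure K \<subseteq> K"
    proof
      fix a assume a: "a \<in> closure K"
      show "a \<in> K" unfolding K_def
      proof (intro CollectI allI)
        fix i j
        have "\<exists>y\<in>?T. dist y (unit_mat i j a) < e" if e: "e > 0" for e
        proof -
          obtain b where b: "b \<in> K" "dist b a < e" using a e unfolding closure_approachable by blast
          have "dist (unit_mat i j b) (unit_mat i j a) < e"
            using norm_unit_mat_le[of i j "b - a"] b(2) by (simp add: dist_norm unit_mat_diff)
          then show ?thesis using b(1) by (auto simp: K_def)
        qed
        then have "unit_mat i j a \<in> closure ?T" by (subst closure_approachable) blast
        then show "unit_mat i j a \<in> ?T" by simp
      qed
    qed
    then show "closed K" by (simp add: closure_subset_eq)
  qed
  moreover have "S \<subseteq> K" using S by (auto simp: K_def)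
  ultimately have "entries x \<subseteq> K" using x ideal_generated_subset by blast
  then have *: "unit_mat i j (mat_of x i j) \<in> ?T" for i j by (auto simp: K_def entries_def)
  obtain n where n: "mat_of x \<in> Mat n" by (rule mat_in_Mat)
  show ?thesis by (subst minf_sum_unit_mat[OF n]) (intro closure_two_sided_sum *)
qed

text \<open>Scalar matrix units that would extract an entry of b need not exist over A. Instead b is
  approximated by z b z*, whose entry (p, q) is row p of z times b times the adjoint of row
  q.\<close>

lemma unit_mat_entry_in_closure:
  assumes b: "pos (emb b)" and s: "s \<in> entries b" shows "unit_mat i j s \<in> closure (two_sided {b})"
  unfolding closure_approachable
proof (intro allI impI)
  fix e :: real assume "e > 0"
  obtain p q where s: "s = mat_of b p q" using s by (auto simp: entries_def)
  obtain z where z: "norm (b - z * b * adj z) < e" using below_refl[OF b] \<open>e > 0\<close> unfolding below_def by blast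
  obtain n where n: "mat_of b \<in> Mat n" "mat_of z \<in> Mat n" by (rule mat_in_Mat2)
  \<comment> \<open>Row p of z moved to position i, so that the product lands in entry (i,
    j).\<close>
  define row where "row i p = Mk (\<lambda>k l. if k = i then mat_of z p l else 0)" for i p
  have mrow: "mat_of (row i p) = (\<lambda>k l. if k = i then mat_of z p l else 0)" for i p
  proof -
    have "(\<lambda>k l. if k = i then mat_of z p l else 0) \<in> Mat (max (Suc i) n)" using n(2) by (auto simp: Mat_def)
    then show ?thesis by (simp add: row_def Mk_inverse Mat_infI)
  qed
  have eq: "row i p * b * adj (row j q) = unit_mat i j (mat_of (z * b * adj z) p q)"
    by (rule minf_eqI, intro ext) (auto simp: mat_conj_eq[OF n(1)] mrow mat_unit_mat)
  have "row i p * b * adj (row j q) + 0 \<in> two_sided {b}" by (intro two_sided_add two_sided_0) simp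
  moreover have "norm (unit_mat i j (mat_of (z * b * adj z) p q - s)) < e"
    using norm_unit_mat_le[of i j "mat_of (z * b * adj z) p q - s"] norm_mat_entry_le[of "b - z * b * adj z" p q] z
    by (simp add: s mat_minus norm_minus_commute)
  ultimately show "\<exists>y\<in>two_sided {b}. dist y (unit_mat i j s) < e"
    by (intro bexI[of _ "row i p * b * adj (row j q)"]) (simp_all add: eq dist_norm unit_mat_diff)
qed

section \<open>Projections over an ideal and the comparison with them\<close>

definition projections_in :: "'a::cstar_algebra set \<Rightarrow> 'a minf set" where
  "projections_in I = {p. adj p = p \<and> p * p = p \<and> entries p \<subseteq> I}"

lemma projections_in_pos: "p \<in> projections_in I \<Longrightarrow> pos (emb p)"
  using pos_emb_adj_mult[of p] by (simp add: projections_in_def)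

lemma dsum_projections_in:
  assumes I: "closed_ideal I" and p: "p \<in> projections_in I" "mat_of p \<in> Mat n" and q: "q \<in> projections_in I"
  shows "dsum n p q \<in> projections_in I"
proof -
  have "0 \<in> I" using I by (simp add: closed_ideal_def)
  then have "entries (dsum n p q) \<subseteq> I" using p q by (auto simp: projections_in_def entries_def mat_dsum mat_dsum_def)
  then show ?thesis using p q by (simp add: projections_in_def dsum_adj dsum_mult)
qed

text \<open>A sum of projections need not be a projection, but their direct sum is, and
  \<open>dsum_conj\<close> writes the sum of conjugates through it.\<close>

lemma conj_sums_projection:
  assumes I: "closed_ideal I" and c: "c \<in> conj_sums (projections_in I)"
  shows "\<exists>p\<in>projections_in I. \<exists>z. c = z * p * adj z"
  using c
proof induction
  case conj_sums_0
  have "entries 0 \<subseteq> I" using I by (auto simp: entries_def mat_zero closed_ideal_def)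
  then show ?case by (intro bexI[of _ 0] exI[of _ 0]) (auto simp: projections_in_def)
next
  case (conj_sums_add d c z)
  then obtain p u where p: "p \<in> projections_in I" "c = u * p * adj u" by blast
  obtain n where n: "mat_of d \<in> Mat n" by (rule mat_in_Mat)
  show ?case using dsum_projections_in[OF I conj_sums_add(1) n p(1)] dsum_conj[OF n, of z u p] p(2) by blast
qed

lemma below_projection:
  assumes ip: "ideal_property TYPE('a::cstar_algebra)" and I: "closed_ideal I"
    and x: "pos (emb (x :: 'a minf))" "entries x \<subseteq> I"
    and g: "pos (emb g)" "emb g * emb x = emb x * emb g" "pos (emb g * emb x - \<epsilon> *\<^sub>R emb g)" and e: "\<epsilon> > 0"
  obtains p where "p \<in> projections_in I" "below g p"
proof -
  let ?Q = "projections_in I"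
  have gen: "ideal_generated {p \<in> I. projection p} = I" using ip I by (simp add: ideal_property_def)
  have xQ: "x \<in> closure (two_sided ?Q)"
  proof (rule in_closure_two_sided_of_entries)
    show "entries x \<subseteq> ideal_generated {p \<in> I. projection p}" using x(2) gen by simp
    fix s i j assume s: "s \<in> {p \<in> I. projection p}"
    then have "0 \<in> I" "s \<in> I" "star s = s" "s * s = s" using I by (auto simp: projection_def closed_ideal_def)
    then have "unit_mat i i s \<in> ?Q"
      by (auto simp: projections_in_def unit_mat_star unit_mat_mult entries_def mat_unit_mat)
    \<comment> \<open>Idempotency of s lets it stand in for the missing unit on both sides of the
      projection \<open>unit_mat i i s\<close>.\<close>
    then have "unit_mat i i s * unit_mat i i s * unit_mat i j s + 0 \<in> two_sided ?Q" by (intro two_sided_add two_sided_0)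
    then show "unit_mat i j s \<in> closure (two_sided ?Q)"
      using \<open>s * s = s\<close> closure_subset by (auto simp: unit_mat_mult)
  qed
  have "\<exists>c\<in>conj_sums ?Q. below g c"
    by (rule below_conj_sum[OF _ x(1) xQ g e]) (rule projections_in_pos)
  then obtain c where c: "c \<in> conj_sums ?Q" "below g c" by (elim bexE)
  from conj_sums_projection[OF I c(1)] obtain p z where p: "p \<in> ?Q" "c = z * p * adj z" by (elim bexE exE)
  show ?thesis by (rule that[OF p(1)]) (rule below_trans[OF c(2)[unfolded p(2)] below_conj])
qed

text \<open>\<open>below_conj_sum\<close> applies with g = h = p. The conclusion covers all large k,
  so that one multiple can later serve both b_1 and b_2.\<close>

lemma projection_below_multiple:
  assumes b: "pos (emb b)" and p: "p \<in> projections_in (ideal_generated (entries b))"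
  obtains m where "\<And>k. m \<le> k \<Longrightarrow> \<exists>D. multiple_of b k D \<and> below p D"
proof -
  have pp: "pos (emb p)" "p * p = p" "entries p \<subseteq> ideal_generated (entries b)"
    using p projections_in_pos by (auto simp: projections_in_def)
  have "p \<in> closure (two_sided {b})"
    by (rule in_closure_two_sided_of_entries[OF unit_mat_entry_in_closure[OF b] pp(3)])
  \<comment> \<open>The constant 1/2 stands for any number in (0, 1): p p - p/2 = p/2 is positive,
    so p needs no cutting down.\<close>
  moreover have "emb p * emb p - (1/2) *\<^sub>R emb p = (1/2) *\<^sub>R emb p"
    by (simp add: pp(2) emb_simps(5)[symmetric] scaleR_diff_left[symmetric, where b = "1/2" and a = 1, simplified])
  then have "pos (emb p * emb p - (1/2) *\<^sub>R emb p)" using pos_scaleR[OF pp(1), of "1/2"] by simp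
  ultimately obtain c where c: "c \<in> conj_sums {b}" "below p c"
    using below_conj_sum[of "{b}" p p "1/2"] b pp(1) by auto
  obtain m D z where D: "multiple_of b m D" "c = z * D * adj z" using conj_sums_multiple[OF b c(1)] by blast
  show ?thesis
  proof (rule that[of m])
    fix k assume "m \<le> k"
    then obtain D z where "multiple_of b k D" "c = z * D * adj z" using multiple_of_increase[OF b D] by blast
    moreover from this have "below p D" using below_trans[OF c(2)] below_conj[of z D] by simp
    ultimately show "\<exists>D. multiple_of b k D \<and> below p D" by blast
  qed
qed

theorem theorem2p2:
  fixes a b :: "nat \<Rightarrow> 'a::cstar_algebra infmat" and \<epsilon> :: real
  assumes "ideal_property TYPE('a)"
    and "\<And>i. i \<in> {1, 2} \<Longrightarrow> a i \<in> Mat_pos"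
    and "\<And>j. j \<in> {1, 2} \<Longrightarrow> b j \<in> Mat_pos"
    and "\<And>i j. i \<in> {1, 2} \<Longrightarrow> j \<in> {1, 2} \<Longrightarrow> cuntz_le (cuntz_class (a i)) (cuntz_class (b j))"
    and "\<epsilon> > 0"
  shows "\<exists>p \<in> mat_projections. \<exists>m::nat. m \<ge> 1 \<and>
    (\<forall>i\<in>{1, 2}. \<forall>j\<in>{1, 2}.
       cuntz_le (cuntz_class (cut_down (a i) \<epsilon>)) (cuntz_class p) \<and>
       cuntz_le (cuntz_class p) (cuntz_multiple m (cuntz_class (b j))))"
proof -
  define A where "A i = Mk (a i)" for i
  define B where "B j = Mk (b j)" for j
  have A: "mat_of (A i) = a i" "pos (emb (A i))" if "i \<in> {1, 2}" for i
  proof -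
    show *: "mat_of (A i) = a i" using assms(2)[OF that] by (simp add: A_def Mk_inverse Mat_pos_def)
    show "pos (emb (A i))" using assms(2)[OF that] by (simp only: *[symmetric] Mat_pos_iff)
  qed
  have B: "mat_of (B j) = b j" "pos (emb (B j))" if "j \<in> {1, 2}" for j
  proof -
    show *: "mat_of (B j) = b j" using assms(3)[OF that] by (simp add: B_def Mk_inverse Mat_pos_def)
    show "pos (emb (B j))" using assms(3)[OF that] by (simp only: *[symmetric] Mat_pos_iff)
  qed
  define J where "J j = ideal_generated (entries (B j))" for j
  have J: "closed_ideal (J j)" for j unfolding J_def by (rule closed_ideal_ideal_generated)
  define I where "I = J 1 \<inter> J 2"
  have I: "closed_ideal I" unfolding I_def by (intro closed_ideal_Int J)
  have AB: "below (A i) (B j)" if "i \<in> {1, 2}" "j \<in> {1, 2}" for i j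
    using assms(4)[OF that] that by (intro cuntz_le_imp_below) (simp add: A B)
  have AJ: "entries (A i) \<subseteq> J j" if "i \<in> {1, 2}" "j \<in> {1, 2}" for i j
    by (rule entries_below[OF J _ AB[OF that]]) (simp add: J_def subset_ideal_generated)
  have "\<exists>g p. cut_down (a i) \<epsilon> = mat_of g \<and> pos (emb g) \<and> p \<in> projections_in I \<and> below g p" if i: "i \<in> {1, 2}" for i
  proof -
    obtain g where g: "cut_down (mat_of (A i)) \<epsilon> = mat_of g" "pos (emb g)" "emb g * emb (A i) = emb (A i) * emb g"
      "pos (emb g * emb (A i) - \<epsilon> *\<^sub>R emb g)"
      using cut_down_exists[OF A(2)[OF i] assms(5)] .
    have "entries (A i) \<subseteq> I" using AJ[OF i, of 1] AJ[OF i, of 2] by (simp add: I_def)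
    then obtain p where "p \<in> projections_in I" "below g p"
      using below_projection[OF assms(1) I A(2)[OF i] _ g(2-4) assms(5)] by blast
    then show ?thesis using g A(1)[OF i] by auto
  qed
  then have "\<forall>i\<in>{1, 2}. \<exists>gp. cut_down (a i) \<epsilon> = mat_of (fst gp) \<and> pos (emb (fst gp)) \<and>
      snd gp \<in> projections_in I \<and> below (fst gp) (snd gp)" by simp
  from bchoice[OF this] obtain f where f: "\<And>i. i \<in> {1, 2} \<Longrightarrow> cut_down (a i) \<epsilon> = mat_of (fst (f i)) \<and>
      pos (emb (fst (f i))) \<and> snd (f i) \<in> projections_in I \<and> below (fst (f i)) (snd (f i))" by blast
  define p1 where "p1 = snd (f 1)"
  define p2 where "p2 = snd (f 2)"
  have p12: "p1 \<in> projections_in I" "p2 \<in> projections_in I" using f[of 1] f[of 2] by (simp_all add: p1_def p2_def)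
  obtain n where n: "mat_of p1 \<in> Mat n" by (rule mat_in_Mat)
  define P where "P = dsum n p1 p2"
  have P: "P \<in> projections_in I" unfolding P_def by (rule dsum_projections_in[OF I p12(1) n p12(2)])
  have pb: "below p1 P" "below p2 P"
  proof -
    \<comment> \<open>A projection conjugates itself to itself; with 0 as the other conjugating
      element, \<open>dsum_conj\<close> exhibits each summand below the direct sum.\<close>
    have pi: "p * p * adj p = p" if "p \<in> projections_in I" for p using that by (simp add: projections_in_def)
    obtain w where "p1 * p1 * adj p1 + 0 * p2 * adj 0 = w * P * adj w" using dsum_conj[OF n] unfolding P_def by blast
    then have "p1 = w * P * adj w" by (simp add: pi[OF p12(1)])
    then show "below p1 P" using below_conj by metis
    obtain w where "0 * p1 * adj 0 + p2 * p2 * adj p2 = w * P * adj w" using dsum_conj[OF n] unfolding P_def by blast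
    then have "p2 = w * P * adj w" by (simp add: pi[OF p12(2)])
    then show "below p2 P" using below_conj by metis
  qed
  have Ppos: "pos (emb P)" by (rule projections_in_pos[OF P])
  have gP: "below (fst (f i)) P" if i: "i \<in> {1, 2}" for i
  proof -
    have "below (snd (f i)) P" using pb i by (auto simp: p1_def p2_def)
    then show ?thesis using f[OF i] below_trans by blast
  qed
  have PJ: "P \<in> projections_in (ideal_generated (entries (B j)))" if "j \<in> {1, 2}" for j
    using P that unfolding projections_in_def I_def J_def by force
  obtain m1 where m1: "\<And>k. m1 \<le> k \<Longrightarrow> \<exists>D. multiple_of (B 1) k D \<and> below P D"
    using projection_below_multiple[OF B(2) PJ] by blast
  obtain m2 where m2: "\<And>k. m2 \<le> k \<Longrightarrow> \<exists>D. multiple_of (B 2) k D \<and> below P D"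
    using projection_below_multiple[OF B(2) PJ] by blast
  \<comment> \<open>The maximum serves both b_1 and b_2, and the successor makes m positive.\<close>
  define m where "m = Suc (max m1 m2)"
  have mD: "\<exists>D. multiple_of (B j) m D \<and> below P D" if "j \<in> {1, 2}" for j
    using that m1[of m] m2[of m] by (auto simp: m_def)
  have "mat_of P \<in> mat_projections"
    using P mat_of[of P] by (simp add: mat_projections_def projections_in_def mat_adj[symmetric] mat_times[symmetric])
  moreover have "cuntz_le (cuntz_class (cut_down (a i) \<epsilon>)) (cuntz_class (mat_of P))" if i: "i \<in> {1, 2}" for i
  proof -
    have "cuntz_below (mat_of (fst (f i))) (mat_of P)" using gP[OF i] by (simp add: cuntz_below_iff)
    then show ?thesis using mat_in_cuntz_class f[OF i] mat_in_cuntz_class[OF Ppos] unfolding cuntz_le_def by metis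
  qed
  moreover have "cuntz_le (cuntz_class (mat_of P)) (cuntz_multiple m (cuntz_class (b j)))" if j: "j \<in> {1, 2}" for j
  proof -
    obtain D where D: "multiple_of (B j) m D" "below P D" using mD[OF j] by blast
    have "mat_of D \<in> cuntz_multiple m (cuntz_class (b j))" using mat_multiple_of[OF B(2)[OF j] D(1)] B(1)[OF j] by simp
    moreover have "cuntz_below (mat_of P) (mat_of D)" using D(2) by (simp add: cuntz_below_iff)
    ultimately show ?thesis using mat_in_cuntz_class[OF Ppos] unfolding cuntz_le_def by blast
  qed
  moreover have "m \<ge> 1" by (simp add: m_def)
  ultimately show ?thesis by (intro bexI[of _ "mat_of P"] exI[of _ m]) simp_all
qed

end
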